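(* Let $d\in\{1,2,3,\dots\}\setminus\{4\}$. Define $$\beta=\begin{cases}\dfrac{d-6+\sqrt{d^2-20d+68}}{2}&\text{if }d\le3,\\ d-4&\text{if }d\ge5,\end{cases}$$ and define $(\alpha_\ell)_{\ell\ge0}$ inductively by $\alpha_0=\max(8-2d,0)$, $\alpha_1=1$ and $$\alpha_\ell=\frac{1}{(\beta^2\ell+|2d-8|)(\ell-1)}\sum_{k=1}^{\ell-1}\alpha_k\alpha_{\ell-k},\qquad \ell\ge2.$$ Let $R_\alpha>0$ be the radius of convergence of the power series $x\mapsto\sum_{\ell=0}^\infty\alpha_\ell x^\ell$. Then there exists a constant $\mu_1=\mu_1(d)\in\mathbb{R}$ such that $$\mathbb{P}_{r,\infty}(N_1>0)=\sum_{\ell=0}^\infty\alpha_\ell\,\mu_1^\ell\, r^{-2-\beta\ell}$$ for every $r>\max\big(1,(|\mu_1|/R_\alpha)^{1/\beta}\big)$. Moreover, $\mu_1$ is negative when $d\in\{1,2,3\}$ and is strictly between $0$ and $1$ when $d\ge5$. Furthermore, when $d\ge5$, $\mu_1$ is the unique solution in $(0,1)$ to the equation $\sum_{\ell=1}^\infty\alpha_\ell\mu_1^\ell=1$.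
   Context: Critical binary branching Brownian motion in $\mathbb{R}^d$: each particle performs a standard Brownian motion for an independent exponential lifetime of mean $1$, and is then replaced at its current location by $0$ or $2$ particles with probability $1/2$ each, the offspring evolving independently in the same way. $\mathbb{P}_{r,\infty}$ is the law of this process (with no killing) started from a single particle at a point of norm $r$. $N_1$ is the number of pioneers on the closed unit ball $B$ centred at the origin, i.e. the number of points $v$ of the genealogical real tree whose position lies in $B$ while the positions of all strict ancestors lie outside $B$; thus $\{N_1>0\}$ is the event that some particle hits the unit ball. *)

theory Defs
  imports "HOL-Probability.Probability" "HOL-Library.Sublist"
begin

text \<open>
  Wiener measure, the law of standard Brownian motion started at the origin, on the space of
  continuous paths with the \<open>\<sigma>\<close>-algebra generated by the evaluations.  A path is a function that is
  \<open>undefined\<close> at negative times.  These conditions fix all finite-dimensional distributions, hence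
  determine the measure uniquely.
\<close>

definition path_space :: "(real \<Rightarrow> 'a::euclidean_space) measure" where
  "path_space = restrict_space (\<Pi>\<^sub>M t\<in>{0..}. borel) {w. continuous_on {0..} w \<and> w 0 = 0}"

definition wiener_measure :: "(real \<Rightarrow> 'a::euclidean_space) measure \<Rightarrow> bool" where
  "wiener_measure W \<longleftrightarrow>
     prob_space W \<and> sets W = sets path_space \<and>
     (\<forall>s t. 0 \<le> s \<and> s < t \<longrightarrow>
        distributed W lborel (\<lambda>w. w t - w s)
          (\<lambda>x. ennreal (\<Prod>b\<in>Basis. normal_density 0 (sqrt (t - s)) (x \<bullet> b)))) \<and>
     (\<forall>(n::nat) t. 0 \<le> t 0 \<and> (\<forall>i<n. t i \<le> t (Suc i)) \<longrightarrow>
        prob_space.indep_vars W (\<lambda>_. borel) (\<lambda>i w. w (t (Suc i)) - w (t i)) {..<n})"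

text \<open>
  Potential particles are labelled by finite words; the parent of \<open>b # u\<close> is \<open>u\<close>, so the strict
  ancestors of a particle are the strict suffixes of its label.  Each label carries an independent
  displacement path, a lifetime, and a coin deciding between two offspring (\<open>True\<close>) and none; marks
  of labels that are never born are ignored.
\<close>

type_synonym label = "bool list"
type_synonym 'a marks = "label \<Rightarrow> (real \<Rightarrow> 'a) \<times> real \<times> bool"

definition bbm :: "(real \<Rightarrow> 'a::euclidean_space) measure \<Rightarrow> 'a marks measure" where
  "bbm W = (\<Pi>\<^sub>M u\<in>UNIV. W \<Otimes>\<^sub>M
     (density lborel (\<lambda>s. ennreal (exponential_density 1 s)) \<Otimes>\<^sub>M measure_pmf (bernoulli_pmf (1/2))))"

definition displacement :: "'a marks \<Rightarrow> label \<Rightarrow> real \<Rightarrow> 'a" where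
  "displacement \<omega> u = fst (\<omega> u)"

definition lifetime :: "'a marks \<Rightarrow> label \<Rightarrow> real" where
  "lifetime \<omega> u = fst (snd (\<omega> u))"

definition splits :: "'a marks \<Rightarrow> label \<Rightarrow> bool" where
  "splits \<omega> u = snd (snd (\<omega> u))"

primrec born :: "'a marks \<Rightarrow> label \<Rightarrow> bool" where
  "born \<omega> [] \<longleftrightarrow> True"
| "born \<omega> (b # u) \<longleftrightarrow> born \<omega> u \<and> splits \<omega> u"

primrec birthplace :: "'a::euclidean_space \<Rightarrow> 'a marks \<Rightarrow> label \<Rightarrow> 'a" where
  "birthplace x \<omega> [] = x"
| "birthplace x \<omega> (b # u) = birthplace x \<omega> u + displacement \<omega> u (lifetime \<omega> u)"

text \<open>
  A point \<open>(u, s)\<close> of the genealogical real tree is particle \<open>u\<close> at age \<open>s\<close>.  Apart from the root,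
  age \<open>0\<close> is excluded: the birth of \<open>b # u\<close> is the same tree point as the death of \<open>u\<close>, and is to be
  counted once only.
\<close>

type_synonym tree_point = "label \<times> real"

definition genealogical_tree :: "'a marks \<Rightarrow> tree_point set" where
  "genealogical_tree \<omega> =
     insert ([], 0) {(u, s). born \<omega> u \<and> 0 < s \<and> s \<le> lifetime \<omega> u}"

definition position :: "'a::euclidean_space \<Rightarrow> 'a marks \<Rightarrow> tree_point \<Rightarrow> 'a" where
  "position x \<omega> v = birthplace x \<omega> (fst v) + displacement \<omega> (fst v) (snd v)"

definition strict_ancestor :: "tree_point \<Rightarrow> tree_point \<Rightarrow> bool" where
  "strict_ancestor v' v \<longleftrightarrow>
     strict_suffix (fst v') (fst v) \<or> (fst v' = fst v \<and> snd v' < snd v)"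

definition pioneers :: "'a::euclidean_space set \<Rightarrow> 'a \<Rightarrow> 'a marks \<Rightarrow> tree_point set" where
  "pioneers K x \<omega> = {v \<in> genealogical_tree \<omega>. position x \<omega> v \<in> K \<and>
     (\<forall>v'\<in>genealogical_tree \<omega>. strict_ancestor v' v \<longrightarrow> position x \<omega> v' \<notin> K)}"

definition N1 :: "'a::euclidean_space \<Rightarrow> 'a marks \<Rightarrow> ennreal" where
  "N1 x \<omega> = emeasure (count_space UNIV) (pioneers (cball 0 1) x \<omega>)"

definition beta :: "nat \<Rightarrow> real" where
  "beta d = (if d \<le> 3 then (real d - 6 + sqrt ((real d)\<^sup>2 - 20 * real d + 68)) / 2
             else real d - 4)"

function alpha :: "nat \<Rightarrow> nat \<Rightarrow> real" where
  "alpha d l =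
     (if l = 0 then max (8 - 2 * real d) 0
      else if l = 1 then 1
      else 1 / (((beta d)\<^sup>2 * real l + \<bar>2 * real d - 8\<bar>) * (real l - 1))
             * (\<Sum>k = 1..l - 1. alpha d k * alpha d (l - k)))"
  by auto
termination by (relation "Wellfounded.measure snd") auto

declare alpha.simps [simp del]

end

(*
  The survival probability v(x) = P(no particle hits the ball) satisfies, by decomposing at the first
  branching time, the fixed point equation
    v(x) = E int_0^tau e^-s (1/2 + v(B_s)^2/2) ds,
  tau being the hitting time of the ball by Brownian motion; among functions with values in [0,1] its
  solution is unique.  On the other hand, if u is radial, bounded between 0 and 1, equal to 1 on the
  unit sphere and solves Laplace u = u^2 outside the ball, then 1 - u solves the same equation by
  Dynkin's formula, which is obtained from a second order Taylor expansion along dyadic times.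
  It remains to solve the radial equation.  With t = ln r and y = r^2 u it becomes the autonomous
  equation y'' = (6 - d) y' - (8 - 2d) y + y^2, and the recursion for alpha says exactly that
  y = sum alpha_l (mu e^(-beta t))^l is a solution.  For d >= 5 the radius of convergence exceeds 1 and
  mu is found by the intermediate value theorem.  For d <= 3 this solution is followed backwards in
  time from a neighbourhood of the equilibrium 8 - 2d; like a travelling wave of KPP type it decreases
  until it reaches the value 1, and a time shift of it is the required solution.
*)

theory Submission
  imports Defs
begin

section \<open>Power series of the coefficients\<close>

text \<open>Linearisation explains \<open>beta\<close>: perturbations exp (- b t) of an equilibrium
  of the autonomous equation decay at the positive root b of its characteristic equation, taken at 8
  - 2d for d <= 3 and at 0 for d >= 5, where b = d - 4. At d = 4 the two equilibria collide and the
  rate vanishes. The constant mu is the free amplitude of this mode, equivalently a time shift, and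
  is fixed by y = 1 at t = 0. For d <= 3 the value 1 lies below 8 - 2d, whence mu < 0; the proved
  radius of convergence need not reach back to t = 0, so the orbit has to be continued by other
  means. On the probabilistic side, Brownian motion is accessible only through its increments, and a
  time grid can miss a visit to the unit ball. Killing is therefore done at dyadic times and at a
  radius rho > 1; the error is the value of 1 - u on the sphere of radius rho, which tends to 0 with
  rho -> 1 because u = 1 on the unit sphere. A grid step can also jump into the ball, where u is not
  given, so 1 - u is extended there as a twice continuously differentiable function of the squared
  norm.\<close>

lemma beta_pos:
  assumes "1 \<le> d" "d \<noteq> 4" shows "beta d > 0"
proof -
  consider "d = 1" | "d = 2" | "d = 3" | "d \<ge> 5" using assms by linarith
  then show ?thesis
  proof cases
    case 1
    then show ?thesis by (simp add: beta_def real_less_rsqrt)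
  next
    case 2
    then show ?thesis by (simp add: beta_def real_less_rsqrt)
  next
    case 3
    then show ?thesis by (simp add: beta_def real_less_rsqrt)
  next
    case 4
    then show ?thesis by (simp add: beta_def)
  qed
qed

lemma beta_ge_1: "5 \<le> d \<Longrightarrow> beta d \<ge> 1"
  by (simp add: beta_def)

text \<open>The characteristic equation of the linearisation w'' = (6 - d) w' + (8 - 2d) w at the
  equilibrium 8 - 2d, tested on w = exp (- b t).\<close>

lemma beta_quadratic:
  assumes "1 \<le> d" "d \<le> 3"
  shows "(beta d)\<^sup>2 + (6 - real d) * beta d = 8 - 2 * real d"
proof -
  define s where "s = sqrt ((real d)\<^sup>2 - 20 * real d + 68)"
  have "0 \<le> (real d)\<^sup>2 - 20 * real d + 68"
    using assms by (auto simp: le_Suc_eq numeral_3_eq_3)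
  then have "s\<^sup>2 = (real d)\<^sup>2 - 20 * real d + 68"
    unfolding s_def by simp
  moreover have "beta d = (real d - 6 + s) / 2"
    using assms by (simp add: beta_def s_def)
  ultimately have "s = 2 * beta d - real d + 6" "s\<^sup>2 = (real d)\<^sup>2 - 20 * real d + 68"
    by (simp_all add: field_simps)
  then show ?thesis by algebra
qed

lemma alpha_0: "alpha d 0 = max (8 - 2 * real d) 0"
  by (simp add: alpha.simps)

lemma alpha_1: "alpha d (Suc 0) = 1"
  by (simp add: alpha.simps)

lemma alpha_rec:
  assumes "l \<ge> 2"
  shows "alpha d l = 1 / (((beta d)\<^sup>2 * real l + \<bar>2 * real d - 8\<bar>) * (real l - 1))
             * (\<Sum>k = 1..l - 1. alpha d k * alpha d (l - k))"
  using assms by (subst alpha.simps) simp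

lemma alpha_nonneg: "alpha d l \<ge> 0"
proof (induction l rule: less_induct)
  case (less l)
  show ?case
  proof (cases "l \<ge> 2")
    case True
    then show ?thesis
      by (subst alpha_rec) (auto intro!: mult_nonneg_nonneg divide_nonneg_nonneg sum_nonneg less)
  next
    case False
    then have "l = 0 \<or> l = 1" by auto
    then show ?thesis by (auto simp: alpha_0 alpha_1)
  qed
qed

lemma sum_mult_diff: "(\<Sum>k = 1..n - 1. real k * real (n - k)) = real (n + 1) * real n * (real n - 1) / 6"
proof -
  have eq: "real k * real (n - k) = real n * real k - (real k)\<^sup>2" if "k \<in> {1..n - 1}" for k
    using that by (auto simp: of_nat_diff algebra_simps power2_eq_square)
  have lin: "(\<Sum>k=1..m. real k) = real m * (real m + 1) / 2" for m :: nat
    by (induction m) (auto simp: field_simps)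
  have sq: "(\<Sum>k=1..m. (real k)\<^sup>2) = real m * (real m + 1) * (2 * real m + 1) / 6" for m :: nat
    by (induction m) (auto simp: field_simps power2_eq_square)
  have "(\<Sum>k = 1..n - 1. real k * real (n - k)) = (\<Sum>k=1..n - 1. real n * real k - (real k)\<^sup>2)"
    using eq by (intro sum.cong) auto
  also have "\<dots> = real n * (\<Sum>k=1..n-1. real k) - (\<Sum>k=1..n-1. (real k)\<^sup>2)"
    by (simp add: sum_subtractf sum_distrib_left)
  also have "\<dots> = real (n + 1) * real n * (real n - 1) / 6"
    unfolding lin sq by (cases n) (auto simp: field_simps power2_eq_square)
  finally show ?thesis .
qed

text \<open>The majorant l c^(l-1) is chosen because its self-convolution is cubic in l, by
  \<open>sum_mult_diff\<close>, and the denominator of the recursion cancels two of the three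
  powers. What remains is (l + 1) / (6 b^2 l) with b = \<open>beta d\<close>, which for l >= 2 is at
  most 1 / (4 b^2); this is the origin of the constant c.\<close>

lemma alpha_le:
  assumes "1 \<le> d" "d \<noteq> 4" "1 \<le> l"
  shows "alpha d l \<le> real l * (1 / (4 * (beta d)\<^sup>2)) ^ (l - 1)"
  using assms(3)
proof (induction l rule: less_induct)
  case (less l)
  define c where "c = 1 / (4 * (beta d)\<^sup>2)"
  have b: "beta d > 0" using beta_pos assms by auto
  then have c: "c > 0" by (simp add: c_def)
  show ?case
  proof (cases "l \<ge> 2")
    case False
    then have "l = 1" using less by auto
    then show ?thesis by (simp add: alpha_1)
  next
    case True
    have "(\<Sum>k = 1..l - 1. alpha d k * alpha d (l - k)) \<le> (\<Sum>k = 1..l - 1. (real k * real (l - k)) * c ^ (l - 2))"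
    proof (rule sum_mono)
      fix k assume k: "k \<in> {1..l - 1}"
      have "alpha d k * alpha d (l - k) \<le> (real k * c ^ (k - 1)) * (real (l - k) * c ^ (l - k - 1))"
        using k True c unfolding c_def by (intro mult_mono less alpha_nonneg) auto
      also have "\<dots> = (real k * real (l - k)) * c ^ ((k - 1) + (l - k - 1))"
        by (simp only: power_add) simp
      also have "(k - 1) + (l - k - 1) = l - 2" using k by auto
      finally show "alpha d k * alpha d (l - k) \<le> (real k * real (l - k)) * c ^ (l - 2)" .
    qed
    also have "\<dots> = real (l + 1) * real l * (real l - 1) / 6 * c ^ (l - 2)"
      by (simp only: sum_distrib_right[symmetric] sum_mult_diff)
    finally have S: "(\<Sum>k = 1..l - 1. alpha d k * alpha d (l - k)) \<le> real (l + 1) * real l * (real l - 1) / 6 * c ^ (l - 2)" .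
    define q where "q = (beta d)\<^sup>2 * real l + \<bar>2 * real d - 8\<bar>"
    have q: "q \<ge> (beta d)\<^sup>2 * real l" "(beta d)\<^sup>2 * real l > 0" unfolding q_def using b True by auto
    have "alpha d l \<le> 1 / (q * (real l - 1)) * (real (l + 1) * real l * (real l - 1) / 6 * c ^ (l - 2))"
      unfolding alpha_rec[OF True] q_def[symmetric] using S q True by (intro mult_left_mono) auto
    also have "\<dots> = real l * c ^ (l - 2) * (real (l + 1) / (6 * q))"
    proof -
      have "real l - 1 \<noteq> 0" "q \<noteq> 0" using True q by auto
      then show ?thesis by (simp add: divide_simps)
    qed
    also have "\<dots> \<le> real l * c ^ (l - 2) * c"
    proof (rule mult_left_mono)
      have "real (l + 1) / (6 * q) \<le> real (l + 1) / (6 * ((beta d)\<^sup>2 * real l))"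
        using less_le_trans[OF q(2,1)] q(1) b \<open>l \<ge> 2\<close>
        by (intro divide_left_mono mult_pos_pos) (linarith | simp)+
      also have "\<dots> \<le> c"
        unfolding c_def using b True by (simp add: field_simps)
      finally show "real (l + 1) / (6 * q) \<le> c" .
    qed (use c in auto)
    also have "\<dots> = real l * c ^ (l - 1)"
    proof -
      have "l - 1 = Suc (l - 2)" using True by auto
      then show ?thesis by simp
    qed
    finally show ?thesis unfolding c_def .
  qed
qed

text \<open>For d >= 5 the bound is at least 4, which puts the point 1 inside the disc of
  convergence; for d <= 3 its positivity is what is used.\<close>

lemma conv_radius_alpha_ge:
  assumes "1 \<le> d" "d \<noteq> 4"
  shows "conv_radius (alpha d) \<ge> ereal (4 * (beta d)\<^sup>2)"
proof (rule conv_radius_geI_ex')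
  fix r :: real
  assume r: "0 < r" "ereal r < ereal (4 * (beta d)\<^sup>2)"
  define q where "q = r / (4 * (beta d)\<^sup>2)"
  have b: "beta d > 0" using beta_pos assms by auto
  have q: "0 < q" "q < 1" using r b by (auto simp: q_def)
  have "summable (\<lambda>n. real (Suc n) * q ^ n)"
    using geometric_deriv_sums[of q] q by (auto simp: sums_iff)
  then have "summable (\<lambda>n. r * (real (Suc n) * q ^ n))" by (rule summable_mult)
  then have "summable (\<lambda>n. alpha d (Suc n) * r ^ Suc n)"
  proof (rule summable_comparison_test'[where N = 0])
    fix n :: nat
    have "alpha d (Suc n) * r ^ Suc n \<le> (real (Suc n) * (1 / (4 * (beta d)\<^sup>2)) ^ n) * r ^ Suc n"
      using alpha_le[OF assms, of "Suc n"] r by (intro mult_right_mono) auto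
    also have "\<dots> = r * (real (Suc n) * q ^ n)"
      by (simp add: q_def power_divide)
    finally show "norm (alpha d (Suc n) * r ^ Suc n) \<le> r * (real (Suc n) * q ^ n)"
      using alpha_nonneg[of d "Suc n"] r by simp
  qed
  then show "summable (\<lambda>n. alpha d n * of_real r ^ n)"
    by (subst (asm) summable_Suc_iff) simp
qed

text \<open>The Euler operator \<open>x d/dx\<close> is the time derivative in the variable \<open>x = exp (- t)\<close>.\<close>

definition alpha_fps :: "nat \<Rightarrow> real fps" where
  "alpha_fps d = Abs_fps (alpha d)"

definition euler_fps :: "real fps \<Rightarrow> real fps" where
  "euler_fps f = fps_X * fps_deriv f"

lemma euler_fps_nth: "fps_nth (euler_fps f) n = real n * fps_nth f n"
  by (cases n) (simp_all add: euler_fps_def)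

lemma fps_conv_radius_euler: "fps_conv_radius (euler_fps f) \<ge> fps_conv_radius f"
proof -
  have "fps_conv_radius (euler_fps f) \<ge> min (fps_conv_radius (fps_X :: real fps)) (fps_conv_radius (fps_deriv f))"
    unfolding euler_fps_def by (rule fps_conv_radius_mult)
  then show ?thesis using fps_conv_radius_deriv[of f] by (auto intro: order_trans)
qed

lemma fps_conv_radius_alpha: "fps_conv_radius (alpha_fps d) = conv_radius (alpha d)"
  by (simp add: fps_conv_radius_def alpha_fps_def)

text \<open>Comparison of coefficients after inserting the series into the radial equation, now for
  every l. At l = 0 it says that \<open>alpha d 0\<close> is an equilibrium. At l = 1 it holds
  whatever the value of the first coefficient, so the normalisation to 1 is free. For l >= 2 it is
  the recursion with the end terms k = 0 and k = l put back.\<close>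

lemma alpha_convolution:
  assumes "1 \<le> d" "d \<noteq> 4"
  shows "((beta d)\<^sup>2 * (real l)\<^sup>2 + (6 - real d) * beta d * real l + (8 - 2 * real d)) * alpha d l
    = (\<Sum>k = 0..l. alpha d k * alpha d (l - k))"
proof -
  \<comment> \<open>The characteristic polynomial at \<open>beta d * l\<close> takes the value
    \<open>2 * alpha d 0\<close> at l = 1, hence the factor l - 1 in the recursion.\<close>
  have ident: "(beta d)\<^sup>2 * (real l)\<^sup>2 + (6 - real d) * beta d * real l + (8 - 2 * real d)
      = ((beta d)\<^sup>2 * real l + \<bar>2 * real d - 8\<bar>) * (real l - 1) + 2 * alpha d 0"
  proof (cases "d \<le> 3")
    case True
    have "\<bar>2 * real d - 8\<bar> = 8 - 2 * real d" "alpha d 0 = 8 - 2 * real d" using True by (auto simp: alpha_0)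
    moreover have "(beta d)\<^sup>2 = 8 - 2 * real d - (6 - real d) * beta d"
      using beta_quadratic[of d] True assms by simp
    ultimately show ?thesis by algebra
  next
    case False
    then have "\<bar>2 * real d - 8\<bar> = 2 * real d - 8" "alpha d 0 = 0" "beta d = real d - 4"
      using assms by (auto simp: alpha_0 beta_def)
    then show ?thesis by algebra
  qed
  consider "l = 0" | "l = 1" | "l \<ge> 2" by linarith
  then show ?thesis
  proof cases
    case 1
    then show ?thesis by (auto simp: alpha_0)
  next
    case 2
    then show ?thesis using ident by (simp add: alpha_1)
  next
    case 3
    define q where "q = ((beta d)\<^sup>2 * real l + \<bar>2 * real d - 8\<bar>) * (real l - 1)"
    have "q > 0" unfolding q_def using 3 beta_pos[OF assms]
      by (intro mult_pos_pos add_pos_nonneg) auto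
    then have q: "q * alpha d l = (\<Sum>k = 1..l - 1. alpha d k * alpha d (l - k))"
      by (subst alpha_rec[OF 3]) (unfold q_def[symmetric], simp)
    have "{0..l} = insert 0 (insert l {1..l - 1})" using 3 by auto
    then have "(\<Sum>k = 0..l. alpha d k * alpha d (l - k)) =
        2 * alpha d 0 * alpha d l + (\<Sum>k = 1..l - 1. alpha d k * alpha d (l - k))"
      using 3 by (simp add: sum.insert)
    then show ?thesis unfolding ident q_def[symmetric] q[symmetric] by (simp add: algebra_simps)
  qed
qed

definition alpha_fun :: "nat \<Rightarrow> real \<Rightarrow> real" where
  "alpha_fun d x = eval_fps (alpha_fps d) x"

definition alpha_fun1 :: "nat \<Rightarrow> real \<Rightarrow> real" where
  "alpha_fun1 d x = eval_fps (euler_fps (alpha_fps d)) x"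

definition alpha_fun2 :: "nat \<Rightarrow> real \<Rightarrow> real" where
  "alpha_fun2 d x = eval_fps (euler_fps (euler_fps (alpha_fps d))) x"

lemma has_derivative_eval_euler:
  assumes "ereal \<bar>x\<bar> < fps_conv_radius f" and that: "x = m * exp (- b * t)"
  shows "((\<lambda>t. eval_fps f (m * exp (- b * t))) has_real_derivative
      - b * eval_fps (euler_fps f) (m * exp (- b * t))) (at t)"
proof -
  have d: "(eval_fps f has_field_derivative eval_fps (fps_deriv f) x) (at x)"
    using assms by (intro has_field_derivative_eval_fps) (auto simp: in_eball_iff dist_real_def)
  have e: "eval_fps (euler_fps f) x = x * eval_fps (fps_deriv f) x"
    unfolding euler_fps_def using assms fps_conv_radius_deriv[of f]
    by (subst eval_fps_mult) (auto intro: order_less_le_trans)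
  have "((\<lambda>t. m * exp (- b * t)) has_real_derivative m * (exp (- b * t) * (- b))) (at t)"
    by (auto intro!: derivative_eq_intros)
  from DERIV_chain2[of "eval_fps f", OF d[unfolded that] this]
  show ?thesis using e that by (simp add: mult_ac)
qed

text \<open>The equation is first an identity of formal power series, namely
  \<open>alpha_convolution\<close>, and is then evaluated. The Euler operator does not shrink the
  radius of convergence, so all terms can be evaluated at the same points.\<close>

lemma alpha_fun_ode:
  assumes "1 \<le> d" "d \<noteq> 4" "ereal \<bar>x\<bar> < conv_radius (alpha d)"
  shows "(beta d)\<^sup>2 * alpha_fun2 d x + (6 - real d) * beta d * alpha_fun1 d x
    + (8 - 2 * real d) * alpha_fun d x = (alpha_fun d x)\<^sup>2"
proof -
  let ?F = "alpha_fps d"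
  let ?G = "fps_const ((beta d)\<^sup>2) * euler_fps (euler_fps ?F) + fps_const ((6 - real d) * beta d) * euler_fps ?F
      + fps_const (8 - 2 * real d) * ?F"
  have G: "?G = ?F * ?F"
  proof (rule fps_ext)
    fix n
    show "fps_nth ?G n = fps_nth (?F * ?F) n"
      using alpha_convolution[OF assms(1,2), of n] unfolding fps_mult_nth[of ?F ?F]
      by (simp add: euler_fps_nth alpha_fps_def algebra_simps power2_eq_square)
  qed
  have r0: "ereal (norm x) < fps_conv_radius ?F" using assms by (simp add: fps_conv_radius_alpha)
  have r1: "ereal (norm x) < fps_conv_radius (euler_fps ?F)"
    by (rule order_less_le_trans[OF r0 fps_conv_radius_euler])
  have r2: "ereal (norm x) < fps_conv_radius (euler_fps (euler_fps ?F))"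
    by (rule order_less_le_trans[OF r1 fps_conv_radius_euler])
  have rc: "ereal (norm x) < fps_conv_radius (fps_const c * f)" 
    if "ereal (norm x) < fps_conv_radius f" for c :: real and f
    by (rule order_less_le_trans[OF _ fps_conv_radius_mult]) (use that in simp)
  have ra: "ereal (norm x) < fps_conv_radius (f + g)" 
    if "ereal (norm x) < fps_conv_radius f" "ereal (norm x) < fps_conv_radius g" for f g :: "real fps"
    by (rule order_less_le_trans[OF _ fps_conv_radius_add]) (use that in simp)
  have ec: "eval_fps (fps_const c * f) x = c * eval_fps f x"
    if "ereal (norm x) < fps_conv_radius f" for c :: real and f
    using that by (subst eval_fps_mult) auto
  have "eval_fps ?G x = (eval_fps ?F x)\<^sup>2"
    unfolding G using r0 by (simp add: eval_fps_mult power2_eq_square)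
  then show ?thesis
    unfolding alpha_fun_def alpha_fun1_def alpha_fun2_def
    by (simp only: eval_fps_add ec rc ra r0 r1 r2)
qed

lemma alpha_fun_sums:
  assumes "ereal \<bar>x\<bar> < conv_radius (alpha d)"
  shows "(\<lambda>l. alpha d l * x ^ l) sums alpha_fun d x"
  unfolding alpha_fun_def using sums_eval_fps[of x "alpha_fps d"] assms
  by (simp add: fps_conv_radius_alpha alpha_fps_def fps_conv_radius_def)

section \<open>A globally Lipschitz initial value problem\<close>

lemma integral_exp_mult:
  fixes l s :: real
  assumes "l > 0" "s \<ge> 0"
  shows "((\<lambda>t. exp (l * t)) has_integral (exp (l * s) - 1) / l) {0..s}"
proof -
  have "((\<lambda>t. exp (l * t)) has_integral exp (l * s) / l - exp (l * 0) / l) {0..s}"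
    using assms
    by (intro fundamental_theorem_of_calculus)
       (auto intro!: derivative_eq_intros simp flip: has_real_derivative_iff_has_vector_derivative)
  then show ?thesis by (simp add: diff_divide_distrib)
qed

text \<open>Weighting by \<open>exp (- 2 L t)\<close> turns the Picard operator into a contraction on all of
  \<open>[0, \<infinity>)\<close> at once, so that no continuation argument is needed.\<close>

lemma global_lipschitz_ode:
  fixes G :: "'a::banach \<Rightarrow> 'a"
  assumes L: "L > 0" "\<And>x y. norm (G x - G y) \<le> L * norm (x - y)"
  shows "\<exists>X. X 0 = x0 \<and> (\<forall>t\<ge>0. (X has_vector_derivative G (X t)) (at t within {0..}))"
proof -
  define l where "l = 2 * L"
  have l: "l > 0" using L by (simp add: l_def)
  have Gcont: "continuous_on UNIV G"
    by (rule lipschitz_on_continuous_on[where L = L], rule lipschitz_onI)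
       (use L in \<open>auto simp: dist_norm\<close>)
  \<comment> \<open>The unknown is the rescaled solution \<open>exp (- l * t)\<close> X(t), a
    bounded function, so that its supremum norm is the weighted norm of X.\<close>
  define J where "J \<phi> s = integral {0..s} (\<lambda>t. G (exp (l * t) *\<^sub>R apply_bcontfun \<phi> t))"
    for \<phi> :: "real \<Rightarrow>\<^sub>C 'a" and s
  have icont: "continuous_on A (\<lambda>t. G (exp (l * t) *\<^sub>R apply_bcontfun \<phi> t))" for A \<phi>
    by (intro continuous_on_compose2[OF Gcont] continuous_intros) auto
  have iint: "(\<lambda>t. G (exp (l * t) *\<^sub>R apply_bcontfun \<phi> t)) integrable_on {a..b}" for a b \<phi>
    by (intro integrable_continuous_real icont)
  \<comment> \<open>Bounded continuous functions live on the whole line here; \<open>max 0 t\<close>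
    extends those on the half line by a constant.\<close>
  define T where "T \<phi> t = exp (- l * max 0 t) *\<^sub>R (x0 + J \<phi> (max 0 t))" for \<phi> t
  have Jcont: "continuous_on {0..} (J \<phi>)" for \<phi>
  proof -
    have "continuous_on {0..n} (J \<phi>)" for n
      unfolding J_def by (rule indefinite_integral_continuous_1[OF iint])
    then have "continuous (at t within {0..t+1}) (J \<phi>)" if "t \<ge> 0" for t
      using that by (simp add: continuous_on_eq_continuous_within)
    moreover have "at t within {0..t+1} = at t within {0..}" for t :: real
      by (rule at_within_nhd[where S = "{..<t+1}"]) auto
    ultimately show ?thesis
      by (simp add: continuous_on_eq_continuous_within)
  qed
  have Tcont: "continuous_on UNIV (T \<phi>)" for \<phi>
    unfolding T_def by (intro continuous_intros continuous_on_compose2[OF Jcont]) auto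
  \<comment> \<open>The factor 1 / l gained by integrating the weight beats the Lipschitz constant:
    L / l = 1 / 2.\<close>
  have expint: "integral {0..s} (\<lambda>t. exp (l * t) * c) \<le> exp (l * s) / l * c" if "s \<ge> 0" "c \<ge> 0" for s c
  proof -
    have "integral {0..s} (\<lambda>t. exp (l * t) * c) = (exp (l * s) - 1) / l * c"
      using integral_exp_mult[OF l that(1)] by (intro integral_unique has_integral_mult_left)
    also have "\<dots> \<le> exp (l * s) / l * c"
      using l that by (intro mult_right_mono divide_right_mono) auto
    finally show ?thesis .
  qed
  have eint: "(\<lambda>t. exp (l * t) * c) integrable_on {a..b}" for a b c :: real
    by (intro integrable_continuous_real continuous_intros)
  have Jdist: "norm (J \<phi> s - J \<psi> s) \<le> exp (l * s) * (dist \<phi> \<psi> / 2)" if "s \<ge> 0" for \<phi> \<psi> s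
  proof -
    have "norm (J \<phi> s - J \<psi> s) = norm (integral {0..s} (\<lambda>t. G (exp (l * t) *\<^sub>R apply_bcontfun \<phi> t)
         - G (exp (l * t) *\<^sub>R apply_bcontfun \<psi> t)))"
      unfolding J_def by (subst integral_diff[OF iint iint]) simp
    also have "\<dots> \<le> integral {0..s} (\<lambda>t. exp (l * t) * (L * dist \<phi> \<psi>))"
    proof (rule integral_norm_bound_integral)
      fix t assume "t \<in> {0..s}"
      have "norm (G (exp (l * t) *\<^sub>R apply_bcontfun \<phi> t) - G (exp (l * t) *\<^sub>R apply_bcontfun \<psi> t))
          \<le> L * norm (exp (l * t) *\<^sub>R apply_bcontfun \<phi> t - exp (l * t) *\<^sub>R apply_bcontfun \<psi> t)" by (rule L)
      also have "\<dots> = L * (exp (l * t) * dist (apply_bcontfun \<phi> t) (apply_bcontfun \<psi> t))"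
        by (simp add: dist_norm flip: scaleR_diff_right)
      also have "\<dots> \<le> exp (l * t) * (L * dist \<phi> \<psi>)"
        using L dist_bounded[of \<phi> t \<psi>] by simp
      finally show "norm (G (exp (l * t) *\<^sub>R apply_bcontfun \<phi> t) - G (exp (l * t) *\<^sub>R apply_bcontfun \<psi> t)) \<le> exp (l * t) * (L * dist \<phi> \<psi>)" .
    qed (intro integrable_diff iint eint)+
    also have "\<dots> \<le> exp (l * s) / l * (L * dist \<phi> \<psi>)" using that L by (intro expint) auto
    also have "\<dots> = exp (l * s) * (dist \<phi> \<psi> / 2)" using L by (simp add: l_def)
    finally show ?thesis .
  qed
  have Tdist: "dist (T \<phi> t) (T \<psi> t) \<le> dist \<phi> \<psi> / 2" for \<phi> \<psi> t
  proof -
    have "dist (T \<phi> t) (T \<psi> t) = exp (- l * max 0 t) * norm (J \<phi> (max 0 t) - J \<psi> (max 0 t))"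
      unfolding T_def dist_norm by (simp flip: scaleR_diff_right)
    also have "\<dots> \<le> exp (- l * max 0 t) * (exp (l * max 0 t) * (dist \<phi> \<psi> / 2))"
      by (intro mult_left_mono Jdist) auto
    also have "\<dots> = dist \<phi> \<psi> / 2" by (simp flip: exp_add mult.assoc)
    finally show ?thesis .
  qed
  \<comment> \<open>One bounded image suffices for the operator to preserve boundedness, since all
    other images stay at bounded distance from it by \<open>Tdist\<close>.\<close>
  have T0: "norm (T 0 t) \<le> norm x0 + norm (G 0) / l" for t
  proof -
    define s where "s = max 0 t"
    have s: "s \<ge> 0" by (simp add: s_def)
    have "J 0 s = s *\<^sub>R G 0" using s by (simp add: J_def)
    then have "norm (T 0 t) \<le> exp (- l * s) * (norm x0 + s * norm (G 0))"
      unfolding T_def s_def[symmetric] using s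
      by (auto intro!: mult_left_mono order_trans[OF norm_triangle_ineq])
    also have "\<dots> = exp (- l * s) * norm x0 + (exp (- l * s) * (l * s)) * (norm (G 0) / l)"
      using l by (simp add: field_simps)
    also have "\<dots> \<le> 1 * norm x0 + 1 * (norm (G 0) / l)"
    proof (intro add_mono mult_right_mono)
      have "l * s \<le> exp (l * s)" using exp_ge_add_one_self[of "l * s"] by linarith
      then show "exp (- l * s) * (l * s) \<le> 1" by (simp add: exp_minus field_simps)
    qed (use s l in auto)
    finally show ?thesis by simp
  qed
  have Tb: "T \<phi> \<in> bcontfun" for \<phi>
  proof (rule bcontfun_normI[OF Tcont])
    fix t
    have "norm (T \<phi> t) \<le> norm (T 0 t) + dist (T \<phi> t) (T 0 t)"
      by (metis dist_norm norm_triangle_sub)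
    also have "\<dots> \<le> (norm x0 + norm (G 0) / l) + dist \<phi> 0 / 2" by (intro add_mono T0 Tdist)
    finally show "norm (T \<phi> t) \<le> (norm x0 + norm (G 0) / l) + dist \<phi> 0 / 2" .
  qed
  have "\<exists>!\<phi>. Bcontfun (T \<phi>) = \<phi>"
  proof (rule banach_fix_type[where c = "1/2"], goal_cases)
    case 3
    show ?case
      using Tdist by (intro allI dist_bound) (simp add: Bcontfun_inverse[OF Tb])
  qed auto
  then obtain \<phi> where phi: "Bcontfun (T \<phi>) = \<phi>" by blast
  have phi_T: "apply_bcontfun \<phi> t = T \<phi> t" for t
    by (subst phi[symmetric]) (simp add: Bcontfun_inverse[OF Tb])
  define X where "X t = exp (l * t) *\<^sub>R apply_bcontfun \<phi> t" for t
  have X: "X t = x0 + integral {0..t} (\<lambda>s. G (X s))" if "t \<ge> 0" for t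
    using that unfolding X_def by (subst phi_T) (simp add: T_def J_def flip: exp_add)
  have "(X has_vector_derivative G (X t)) (at t within {0..})" if t: "t \<ge> 0" for t
  proof -
    have GX: "continuous_on {0..t+1} (\<lambda>s. G (X s))" unfolding X_def by (rule icont)
    have "((\<lambda>t. x0 + integral {0..t} (\<lambda>s. G (X s))) has_vector_derivative 0 + G (X t)) (at t within {0..t+1})"
      using t by (intro has_vector_derivative_add has_vector_derivative_const integral_has_vector_derivative GX) auto
    then have "(X has_vector_derivative G (X t)) (at t within {0..t+1})"
      using t by (auto intro: has_vector_derivative_transform[rotated 2] simp: X)
    moreover have "at t within {0..t+1} = at t within {0..}"
      by (rule at_within_nhd[where S = "{..<t+1}"]) auto
    ultimately show ?thesis by simp
  qed
  moreover have "X 0 = x0" using X[of 0] by simp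
  ultimately show ?thesis by blast
qed

section \<open>The radial equation in logarithmic time\<close>

text \<open>First-order form of the radial equation, z being y'. Derivatives are taken within S, so
  that they are one-sided at the ends of an interval and orbits on adjacent intervals can be
  glued.\<close>

definition orbit_on :: "real \<Rightarrow> real set \<Rightarrow> (real \<Rightarrow> real) \<Rightarrow> (real \<Rightarrow> real) \<Rightarrow> bool" where
  "orbit_on d S y z \<longleftrightarrow> (\<forall>t\<in>S. (y has_real_derivative z t) (at t within S) \<and>
     (z has_real_derivative (6 - d) * z t - (8 - 2 * d) * y t + (y t)\<^sup>2) (at t within S))"

lemma orbit_on_subset: "orbit_on d S y z \<Longrightarrow> T \<subseteq> S \<Longrightarrow> orbit_on d T y z"
  unfolding orbit_on_def by (meson DERIV_subset subset_eq)

lemma orbit_on_continuous: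
  assumes "orbit_on d S y z"
  shows "continuous_on S y" "continuous_on S z"
proof -
  show "continuous_on S y"
    by (rule DERIV_continuous_on[where D = z]) (use assms in \<open>auto simp: orbit_on_def\<close>)
  show "continuous_on S z"
    by (rule DERIV_continuous_on) (use assms in \<open>auto simp: orbit_on_def\<close>)
qed

text \<open>A Gronwall argument that transports equality backwards in time, from the large times
  where the series is known to represent the orbit. The difference of the squares is (f + g) times
  the difference, so the difference solves a linear equation with bounded coefficients.\<close>

lemma orbit_on_unique:
  assumes f: "orbit_on d {s..t} f f1" and g: "orbit_on d {s..t} g g1"
    and st: "s \<le> t" and eqs: "f t = g t" "f1 t = g1 t"
  shows "f s = g s"
proof -
  have "compact ((\<lambda>x. f x + g x - (8 - 2 * d)) ` {s..t})"
    by (intro compact_continuous_image continuous_intros orbit_on_continuous[OF f] orbit_on_continuous[OF g]) auto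
  then have "bounded ((\<lambda>x. f x + g x - (8 - 2 * d)) ` {s..t})" by (rule compact_imp_bounded)
  then obtain M where M: "\<And>x. x \<in> {s..t} \<Longrightarrow> \<bar>f x + g x - (8 - 2 * d)\<bar> \<le> M"
    unfolding bounded_iff ball_simps real_norm_def by blast
  \<comment> \<open>Large enough that the exponential weight makes \<open>E\<close> nondecreasing: 1
    + M absorbs the mixed terms in \<open>w\<close> and \<open>v\<close>, the remainder the friction
    term.\<close>
  define K where "K = 1 + M + 2 * \<bar>6 - d\<bar>"
  define w where "w x = f x - g x" for x
  define v where "v x = f1 x - g1 x" for x
  define E where "E x = ((w x)\<^sup>2 + (v x)\<^sup>2) * exp (K * x)" for x
  have "E s \<le> E t"
  proof (rule DERIV_nonneg_imp_increasing_open[OF st])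
    show "continuous_on {s..t} E"
      unfolding E_def w_def v_def
      by (intro continuous_intros orbit_on_continuous[OF f] orbit_on_continuous[OF g])
    fix x assume x: "s < x" "x < t"
    have at_in: "at x within {s..t} = at x" using x by (rule at_within_Icc_at)
    have [derivative_intros]: "(w has_real_derivative v x) (at x)"
      using f g x unfolding orbit_on_def at_in w_def v_def
      by (intro derivative_intros) (auto simp: at_in dest!: bspec[of _ _ x])
    define q where "q = f x + g x - (8 - 2 * d)"
    have [derivative_intros]: "(v has_real_derivative (6 - d) * v x + q * w x) (at x)"
    proof -
      have "(v has_real_derivative ((6 - d) * f1 x - (8 - 2 * d) * f x + (f x)\<^sup>2) - ((6 - d) * g1 x - (8 - 2 * d) * g x + (g x)\<^sup>2)) (at x)"
        using f g x unfolding orbit_on_def at_in v_def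
        by (intro derivative_intros) (auto simp: at_in dest!: bspec[of _ _ x])
      then show ?thesis by (rule DERIV_cong) (simp add: v_def w_def q_def power2_eq_square algebra_simps)
    qed
    have D: "(E has_real_derivative (2 * w x * v x + 2 * v x * ((6 - d) * v x + q * w x) + K * ((w x)\<^sup>2 + (v x)\<^sup>2)) * exp (K * x)) (at x)"
      unfolding E_def by (auto intro!: derivative_eq_intros simp: algebra_simps power2_eq_square)
    have q: "\<bar>q\<bar> \<le> M" unfolding q_def using x by (intro M) auto
    have wv: "2 * \<bar>w x * v x\<bar> \<le> (w x)\<^sup>2 + (v x)\<^sup>2"
      using sum_squares_bound[of "\<bar>w x\<bar>" "\<bar>v x\<bar>"] by (simp add: abs_mult)
    have "- (2 * w x * v x + 2 * v x * ((6 - d) * v x + q * w x)) = - (2 * (w x * v x)) * (1 + q) - 2 * (6 - d) * (v x)\<^sup>2"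
      by (simp add: algebra_simps power2_eq_square)
    also have "\<dots> \<le> (2 * \<bar>w x * v x\<bar>) * (1 + M) + 2 * \<bar>6 - d\<bar> * (v x)\<^sup>2"
    proof -
      have "- (2 * (w x * v x)) * (1 + q) \<le> \<bar>(2 * (w x * v x)) * (1 + q)\<bar>"
        by (subst mult_minus_left) (rule abs_ge_minus_self)
      also have "\<dots> = (2 * \<bar>w x * v x\<bar>) * \<bar>1 + q\<bar>" by (simp add: abs_mult)
      also have "\<dots> \<le> (2 * \<bar>w x * v x\<bar>) * (1 + M)" using q by (intro mult_left_mono) auto
      finally have 1: "- (2 * (w x * v x)) * (1 + q) \<le> (2 * \<bar>w x * v x\<bar>) * (1 + M)" .
      have "- (6 - d) * (v x)\<^sup>2 \<le> \<bar>6 - d\<bar> * (v x)\<^sup>2" by (intro mult_right_mono) auto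
      with 1 show ?thesis unfolding mult.assoc[of 2] by linarith
    qed
    also have "\<dots> \<le> ((w x)\<^sup>2 + (v x)\<^sup>2) * (1 + M) + 2 * \<bar>6 - d\<bar> * ((w x)\<^sup>2 + (v x)\<^sup>2)"
      using wv q by (intro add_mono mult_right_mono mult_left_mono) auto
    also have "\<dots> = K * ((w x)\<^sup>2 + (v x)\<^sup>2)" by (simp add: K_def algebra_simps)
    finally have "0 \<le> 2 * w x * v x + 2 * v x * ((6 - d) * v x + q * w x) + K * ((w x)\<^sup>2 + (v x)\<^sup>2)" by linarith
    with D show "\<exists>y. (E has_real_derivative y) (at x) \<and> 0 \<le> y" by auto
  qed
  also have "E t = 0" using eqs by (simp add: E_def w_def v_def)
  finally have "(w s)\<^sup>2 + (v s)\<^sup>2 \<le> 0" by (simp add: E_def mult_le_0_iff not_le)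
  then show ?thesis by (simp add: w_def sum_power2_le_zero_iff)
qed

text \<open>A maximum principle for u = y / r^2. The flux r^(d-1) u'(r) is nondecreasing because the
  Laplacian of u is a square, so once u increases it does so forever. If u exceeded 1 it would stay
  above 1, and y would outgrow exp (2 t) against its boundedness.\<close>

lemma orbit_on_le_exp:
  assumes y: "orbit_on d {0..} y z" and "y 0 = 1" and bd: "\<And>t. t \<ge> 0 \<Longrightarrow> y t \<le> C"
    and "t \<ge> 0"
  shows "y t \<le> exp (2 * t)"
proof (rule ccontr)
  define u where "u t = exp (- 2 * t) * y t" for t
  define v where "v t = exp (- 2 * t) * (z t - 2 * y t)" for t
  \<comment> \<open>The flux r^(d-1) u'(r) at r = exp t; its time derivative is
    \<open>exp ((d - 4) * t) * (y t)^2\<close>.\<close>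
  define w where "w t = exp ((d - 4) * t) * (z t - 2 * y t)" for t
  have at_in: "at x within {0..} = at x" if "x > 0" for x :: real
    using that by (intro at_within_interior) auto
  have yd: "(y has_real_derivative z x) (at x)"
    "(z has_real_derivative (6 - d) * z x - (8 - 2 * d) * y x + (y x)\<^sup>2) (at x)" if "x > 0" for x
    using y that unfolding orbit_on_def by (auto simp: at_in dest!: bspec[of _ _ x])
  have ud: "(u has_real_derivative v x) (at x)" if "x > 0" for x
    unfolding u_def v_def using that
    by (auto intro!: derivative_eq_intros yd simp: algebra_simps)
  have wd: "(w has_real_derivative exp ((d - 4) * x) * (y x)\<^sup>2) (at x)" if "x > 0" for x
    unfolding w_def using that
    by (auto intro!: derivative_eq_intros yd simp: algebra_simps power2_eq_square)
  have uc: "continuous_on {0..} u" unfolding u_def by (intro continuous_intros orbit_on_continuous[OF y])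
  assume "\<not> y t \<le> exp (2 * t)"
  then have ut: "u t > 1" by (simp add: u_def exp_minus field_simps)
  moreover have u0: "u 0 = 1" using assms by (simp add: u_def)
  ultimately have t: "t > 0" using assms by (cases "t = 0") auto
  have "\<exists>x>0. x < t \<and> v x > 0"
  proof (rule ccontr)
    assume "\<not> ?thesis"
    then have neg: "v x \<le> 0" if "0 < x" "x < t" for x using that by force
    have "u t \<le> u 0"
    proof (rule DERIV_nonpos_imp_decreasing_open[of 0 t u])
      fix x assume "0 < x" "x < t"
      then show "\<exists>y. (u has_real_derivative y) (at x) \<and> y \<le> 0" using ud neg by blast
    qed (use t in \<open>auto intro: continuous_on_subset[OF uc]\<close>)
    then show False using ut u0 by simp
  qed
  then obtain x where x: "x > 0" "x < t" "v x > 0" by blast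
  have wx: "w x > 0" using x by (simp add: w_def v_def zero_less_mult_iff)
  have vpos: "v s > 0" if "s \<ge> x" for s
  proof -
    have "w x \<le> w s"
      using x that by (intro DERIV_nonneg_imp_nondecreasing[OF that]) (auto intro!: exI wd)
    with wx have "w s > 0" by simp
    then show ?thesis by (simp add: w_def v_def zero_less_mult_iff)
  qed
  \<comment> \<open>A time so late that \<open>exp (2 * s)\<close> already exceeds the bound
    \<open>C\<close>.\<close>
  define s where "s = max t \<bar>C\<bar>"
  have "u t \<le> u s"
    using x by (intro DERIV_nonneg_imp_nondecreasing[of t s u])
      (auto intro!: exI conjI ud less_imp_le[OF vpos] simp: s_def)
  then have "u s > 1" using ut by simp
  then have "y s > exp (2 * s)" by (simp add: u_def exp_minus field_simps)
  moreover have "y s \<le> C" using t by (intro bd) (auto simp: s_def)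
  moreover have "exp (2 * s) \<ge> 1 + 2 * s" by (rule exp_ge_add_one_self)
  moreover have "s \<ge> C" "s \<ge> 0" using t by (auto simp: s_def)
  ultimately show False by linarith
qed

text \<open>The radial system with time reversed, for c = 6 - d and a = 8 - 2d. Between 1 and a the
  source P (a - P) is positive, which keeps the speed q away from 0, so P falls at a definite rate
  and reaches 1. The quadratic source is not globally Lipschitz; it is therefore solved with P
  clamped to [1, y1], and the clamp is inactive until P reaches 1.\<close>

lemma backward_orbit:
  assumes y1: "1 < y1" "y1 < a" and c: "c > 0" and z1: "z1 > 0"
  shows "\<exists>s0>0. \<exists>P q. P 0 = y1 \<and> q 0 = z1 \<and> P s0 = 1 \<and>
    (\<forall>s\<in>{0..s0}. 1 \<le> P s \<and> P s \<le> y1 \<and> (P has_real_derivative - q s) (at s within {0..s0}) \<and>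
       (q has_real_derivative - c * q s + P s * (a - P s)) (at s within {0..s0}))"
proof -
  define k where "k y = max 1 (min y y1)" for y :: real
  define h where "h y = k y * (a - k y)" for y :: real
  define G where "G p = (- snd p, - c * snd p + h (fst p))" for p
  have kb: "1 \<le> k y" "k y \<le> y1" for y using y1 by (auto simp: k_def)
  have hl: "\<bar>h x - h y\<bar> \<le> a * \<bar>x - y\<bar>" for x y
  proof -
    have "h x - h y = (a - (k x + k y)) * (k x - k y)"
      by (simp add: h_def algebra_simps)
    then have "\<bar>h x - h y\<bar> = \<bar>a - (k x + k y)\<bar> * \<bar>k x - k y\<bar>" by (simp add: abs_mult)
    also have "\<dots> \<le> a * \<bar>x - y\<bar>"
      using kb[of x] kb[of y] y1 by (intro mult_mono) (auto simp: k_def)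
    finally show ?thesis .
  qed
  define L where "L = 1 + c + a"
  have L: "norm (G x - G y) \<le> L * norm (x - y)" for x y
  proof -
    have "norm (G x - G y) \<le> \<bar>snd x - snd y\<bar> + \<bar>- c * (snd x - snd y) + (h (fst x) - h (fst y))\<bar>"
      unfolding G_def norm_prod_def
      by (rule order_trans[OF sqrt_sum_squares_le_sum_abs]) (auto simp: algebra_simps)
    also have "\<dots> \<le> \<bar>snd x - snd y\<bar> + (c * \<bar>snd x - snd y\<bar> + a * \<bar>fst x - fst y\<bar>)"
    proof -
      have "\<bar>- c * (snd x - snd y) + (h (fst x) - h (fst y))\<bar> \<le> \<bar>- c * (snd x - snd y)\<bar> + \<bar>h (fst x) - h (fst y)\<bar>" by linarith
      also have "\<bar>- c * (snd x - snd y)\<bar> = c * \<bar>snd x - snd y\<bar>" using c by (simp add: abs_mult)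
      finally show ?thesis using hl[of "fst x" "fst y"] by linarith
    qed
    also have "\<dots> \<le> norm (x - y) + (c * norm (x - y) + a * norm (x - y))"
      using c y1 norm_fst_le[of "x - y"] norm_snd_le[of "x - y"]
      by (intro add_mono mult_left_mono) (auto simp: norm_prod_def)
    also have "\<dots> = L * norm (x - y)" by (simp add: L_def algebra_simps)
    finally show ?thesis .
  qed
  have "L > 0" using y1 c by (simp add: L_def)
  from global_lipschitz_ode[of L G "(y1, z1)", OF this L] obtain X where
    X0: "X 0 = (y1, z1)" and X: "\<And>t. t \<ge> 0 \<Longrightarrow> (X has_vector_derivative G (X t)) (at t within {0..})" by auto
  define P where "P t = fst (X t)" for t
  define q where "q t = snd (X t)" for t
  have Pd: "(P has_real_derivative - q t) (at t within {0..})" if "t \<ge> 0" for t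
    using bounded_linear.has_vector_derivative[OF bounded_linear_fst X[OF that]]
    by (simp add: G_def P_def[abs_def] q_def[abs_def] has_real_derivative_iff_has_vector_derivative)
  have qd: "(q has_real_derivative - c * q t + h (P t)) (at t within {0..})" if "t \<ge> 0" for t
    using bounded_linear.has_vector_derivative[OF bounded_linear_snd X[OF that]]
    by (simp add: G_def P_def[abs_def] q_def[abs_def] has_real_derivative_iff_has_vector_derivative)
  have Pc: "continuous_on {0..} P" and qc: "continuous_on {0..} q"
    by (rule DERIV_continuous_on[OF Pd], simp) (rule DERIV_continuous_on[OF qd], simp)
  have at_in: "at x within {0..} = at x" if "x > 0" for x :: real
    using that by (intro at_within_interior) auto
  define m where "m = a - y1"
  have m: "m > 0" "h y \<ge> m" for y
  proof -
    show "m > 0" using y1 by (simp add: m_def)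
    have "1 * m \<le> k y * (a - k y)" using kb[of y] y1 by (intro mult_mono) (auto simp: m_def)
    then show "h y \<ge> m" by (simp add: h_def)
  qed
  define \<kappa> where "\<kappa> = min z1 (m / c)"
  have kap: "\<kappa> > 0" "\<kappa> \<le> z1" "c * \<kappa> \<le> m"
    using m(1) c z1 by (auto simp: \<kappa>_def min_def field_simps)
  have qk: "q s \<ge> \<kappa>" if s: "s \<ge> 0" for s
  proof -
    have "exp (c * 0) * (q 0 - \<kappa>) \<le> exp (c * s) * (q s - \<kappa>)"
    proof (rule DERIV_nonneg_imp_increasing_open[OF s])
      fix x :: real assume x: "0 < x" "x < s"
      have "((\<lambda>s. exp (c * s) * (q s - \<kappa>)) has_real_derivative exp (c * x) * (h (P x) - c * \<kappa>)) (at x)"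
        using qd[of x] x at_in[of x] by (auto intro!: derivative_eq_intros simp: algebra_simps)
      moreover have "exp (c * x) * (h (P x) - c * \<kappa>) \<ge> 0" using m(2)[of "P x"] kap by simp
      ultimately show "\<exists>y. ((\<lambda>s. exp (c * s) * (q s - \<kappa>)) has_real_derivative y) (at x) \<and> 0 \<le> y" by blast
    qed (intro continuous_intros continuous_on_subset[OF qc], auto)
    moreover have "q 0 \<ge> \<kappa>" using kap by (simp add: q_def X0)
    ultimately have "0 \<le> exp (c * s) * (q s - \<kappa>)" by simp
    then show ?thesis by (simp add: zero_le_mult_iff not_le)
  qed
  have Pmono: "P s + \<kappa> * (s - r) \<le> P r" if "0 \<le> r" "r \<le> s" for r s
  proof -
    have "P s + \<kappa> * s \<le> P r + \<kappa> * r"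
    proof (rule DERIV_nonpos_imp_decreasing_open[of _ _ "\<lambda>s. P s + \<kappa> * s", OF that(2)])
      fix x :: real assume x: "r < x" "x < s"
      have "((\<lambda>s. P s + \<kappa> * s) has_real_derivative - q x + \<kappa>) (at x)"
        using Pd[of x] x at_in[of x] that by (auto intro!: derivative_eq_intros)
      moreover have "- q x + \<kappa> \<le> 0" using qk[of x] x that by simp
      ultimately show "\<exists>y. ((\<lambda>s. P s + \<kappa> * s) has_real_derivative y) (at x) \<and> y \<le> 0" by blast
    qed (intro continuous_intros continuous_on_subset[OF Pc], use that in auto)
    then show ?thesis by (simp add: algebra_simps)
  qed
  have P0: "P 0 = y1" "q 0 = z1" by (auto simp: P_def q_def X0)
  \<comment> \<open>Falling at speed at least \<open>\<kappa>\<close>, the orbit covers the distance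
    y1 - 1 within this time.\<close>
  define S where "S = (y1 - 1) / \<kappa>"
  have S: "S > 0" using y1 kap by (simp add: S_def)
  have "P S \<le> 1" using Pmono[of 0 S] S kap by (simp add: P0 S_def)
  moreover have "1 \<le> P 0" using y1 P0 by simp
  ultimately obtain s0 where s0: "0 \<le> s0" "s0 \<le> S" "P s0 = 1"
    using IVT2'[of P S 1 0] S continuous_on_subset[OF Pc, of "{0..S}"] by auto
  have "s0 \<noteq> 0" using s0 P0 y1 by auto
  then have s0': "s0 > 0" using s0 by simp
  have Pb: "1 \<le> P s \<and> P s \<le> y1" if "s \<in> {0..s0}" for s
  proof -
    have "\<kappa> * (s - 0) \<ge> 0" "\<kappa> * (s0 - s) \<ge> 0" using that kap by auto
    then show ?thesis
      using Pmono[of 0 s] Pmono[of s s0] that s0(1,3) P0(1) unfolding atLeastAtMost_iff by linarith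
  qed
  show ?thesis
  proof (rule exI[of _ s0], rule conjI[OF s0'], rule exI[of _ P], rule exI[of _ q], intro conjI ballI)
    fix s assume s: "s \<in> {0..s0}"
    show "(P has_real_derivative - q s) (at s within {0..s0})"
      using s by (intro DERIV_subset[OF Pd]) auto
    have "h (P s) = P s * (a - P s)" using Pb[OF s] by (simp add: h_def k_def)
    then show "(q has_real_derivative - c * q s + P s * (a - P s)) (at s within {0..s0})"
      using s DERIV_subset[OF qd[of s], of "{0..s0}"] by auto
  qed (use Pb P0 s0 in auto)
qed

text \<open>With y = r^2 u and r = exp t, the clauses say that u solves the radial equation, equals
  1 on the unit sphere and lies in [0, 1]. Boundedness of y and y' controls the derivatives in the
  Taylor expansion. The last clause identifies y with the series wherever that converges, not only
  for late times.\<close>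

definition profile :: "nat \<Rightarrow> real \<Rightarrow> (real \<Rightarrow> real) \<Rightarrow> (real \<Rightarrow> real) \<Rightarrow> bool" where
  "profile d \<mu> y z \<longleftrightarrow> orbit_on (real d) {0..} y z \<and> y 0 = 1 \<and>
     (\<forall>t\<ge>0. 0 \<le> y t \<and> y t \<le> exp (2 * t)) \<and> bounded (y ` {0..}) \<and> bounded (z ` {0..}) \<and>
     (\<forall>t\<ge>0. ereal \<bar>\<mu> * exp (- beta d * t)\<bar> < conv_radius (alpha d) \<longrightarrow>
        y t = alpha_fun d (\<mu> * exp (- beta d * t)))"

lemma alpha_orbit:
  assumes d: "1 \<le> d" "d \<noteq> 4"
    and S: "\<And>t. t \<in> S \<Longrightarrow> ereal \<bar>\<mu> * exp (- beta d * t)\<bar> < conv_radius (alpha d)"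
  shows "orbit_on (real d) S (\<lambda>t. alpha_fun d (\<mu> * exp (- beta d * t)))
    (\<lambda>t. - beta d * alpha_fun1 d (\<mu> * exp (- beta d * t)))"
  unfolding orbit_on_def
proof (intro ballI conjI)
  fix t assume t: "t \<in> S"
  let ?x = "\<mu> * exp (- beta d * t)"
  have r: "ereal \<bar>?x\<bar> < fps_conv_radius (alpha_fps d)" using S[OF t] by (simp add: fps_conv_radius_alpha)
  show "((\<lambda>t. alpha_fun d (\<mu> * exp (- beta d * t))) has_real_derivative - beta d * alpha_fun1 d ?x) (at t within S)"
    unfolding alpha_fun_def alpha_fun1_def
    by (rule has_field_derivative_at_within, rule has_derivative_eval_euler[OF r refl])
  have r: "ereal \<bar>?x\<bar> < fps_conv_radius (euler_fps (alpha_fps d))"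
    by (rule order_less_le_trans[OF r fps_conv_radius_euler])
  have "((\<lambda>t. - beta d * alpha_fun1 d (\<mu> * exp (- beta d * t))) has_real_derivative
      - beta d * (- beta d * alpha_fun2 d ?x)) (at t within S)"
    unfolding alpha_fun1_def alpha_fun2_def
    by (rule has_field_derivative_at_within, rule DERIV_cmult, rule has_derivative_eval_euler[OF r refl])
  then show "((\<lambda>t. - beta d * alpha_fun1 d (\<mu> * exp (- beta d * t))) has_real_derivative
      (6 - real d) * (- beta d * alpha_fun1 d ?x) - (8 - 2 * real d) * alpha_fun d ?x + (alpha_fun d ?x)\<^sup>2) (at t within S)"
  proof (rule DERIV_cong)
    show "- beta d * (- beta d * alpha_fun2 d ?x) =
        (6 - real d) * (- beta d * alpha_fun1 d ?x) - (8 - 2 * real d) * alpha_fun d ?x + (alpha_fun d ?x)\<^sup>2"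
      using alpha_fun_ode[OF d S[OF t]] by algebra
  qed
qed

text \<open>All coefficients are nonnegative and the linear one is 1, so the linear term alone gives
  the bound.\<close>

lemma alpha_fun_diff_ge:
  assumes "0 \<le> y" "y \<le> x" "ereal x < conv_radius (alpha d)"
  shows "x - y \<le> alpha_fun d x - alpha_fun d y"
proof -
  have "ereal \<bar>x\<bar> < conv_radius (alpha d)" using assms by simp
  moreover have "ereal \<bar>y\<bar> \<le> ereal \<bar>x\<bar>" using assms by simp
  ultimately have "ereal \<bar>y\<bar> < conv_radius (alpha d)" "ereal \<bar>x\<bar> < conv_radius (alpha d)"
    by (blast intro: order_le_less_trans)+
  then have 1: "(\<lambda>l. alpha d l * x ^ l - alpha d l * y ^ l) sums (alpha_fun d x - alpha_fun d y)"
    by (intro sums_diff alpha_fun_sums)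
  have 2: "(\<lambda>l. if l = 1 then x - y else 0) sums (x - y)"
    using sums_single[of 1 "\<lambda>_. x - y"] by simp
  have 3: "(if l = 1 then x - y else 0) \<le> alpha d l * x ^ l - alpha d l * y ^ l" for l
    using mult_left_mono[OF power_mono[of y x l] alpha_nonneg[of d l]] assms(1,2)
    by (cases "l = 1") (simp_all add: alpha_1)
  show ?thesis by (rule sums_le[OF 3 2 1])
qed

lemma alpha_fun_0: "alpha_fun d 0 = alpha d 0"
  by (simp add: alpha_fun_def eval_fps_at_0 alpha_fps_def)

lemma isCont_alpha_fun:
  assumes "ereal \<bar>x\<bar> < conv_radius (alpha d)"
  shows "isCont (alpha_fun d) x"
proof -
  have "(eval_fps (alpha_fps d) has_field_derivative eval_fps (fps_deriv (alpha_fps d)) x) (at x)"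
    using assms by (intro has_field_derivative_eval_fps) (auto simp: fps_conv_radius_alpha)
  then show ?thesis unfolding alpha_fun_def by (rule DERIV_isCont)
qed

lemma isCont_alpha_fun1:
  assumes "ereal \<bar>x\<bar> < conv_radius (alpha d)"
  shows "isCont (alpha_fun1 d) x"
proof -
  have "ereal \<bar>x\<bar> < fps_conv_radius (euler_fps (alpha_fps d))"
    by (rule order_less_le_trans[OF _ fps_conv_radius_euler]) (use assms in \<open>simp add: fps_conv_radius_alpha\<close>)
  then have "(eval_fps (euler_fps (alpha_fps d)) has_field_derivative eval_fps (fps_deriv (euler_fps (alpha_fps d))) x) (at x)"
    by (intro has_field_derivative_eval_fps) auto
  then show ?thesis unfolding alpha_fun1_def by (rule DERIV_isCont)
qed

lemma bounded_alpha_fun1: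
  assumes "ereal m < conv_radius (alpha d)"
  shows "bounded (alpha_fun1 d ` {-m..m})"
proof (intro compact_imp_bounded compact_continuous_image continuous_at_imp_continuous_on ballI isCont_alpha_fun1)
  fix x assume "x \<in> {-m..m}"
  then have "ereal \<bar>x\<bar> \<le> ereal m" by auto
  then show "ereal \<bar>x\<bar> < conv_radius (alpha d)" using assms by (rule order_le_less_trans)
qed auto

text \<open>Here the series describes the whole orbit: the argument
  \<open>\<mu> * exp (- beta d * t)\<close> stays in [0, mu] inside the disc of convergence. The
  boundary condition y(0) = 1 becomes the equation for mu, whose uniqueness is the strict
  monotonicity of the series.\<close>

lemma profile_high_dim:
  assumes d: "5 \<le> d"
  shows "\<exists>\<mu> y z. profile d \<mu> y z \<and> 0 < \<mu> \<and> \<mu> < 1 \<and>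
    (\<forall>y. 0 < y \<and> y < 1 \<longrightarrow> ((\<lambda>l. alpha d (Suc l) * y ^ Suc l) sums 1 \<longleftrightarrow> y = \<mu>))"
proof -
  let ?A = "alpha_fun d"
  have d': "1 \<le> d" "d \<noteq> 4" using d by auto
  have b: "beta d \<ge> 1" using beta_ge_1[OF d] .
  have "(4::real) \<le> 4 * (beta d)\<^sup>2" using b by simp
  then have "ereal 4 \<le> ereal (4 * (beta d)\<^sup>2)" by simp
  also have "\<dots> \<le> conv_radius (alpha d)" by (rule conv_radius_alpha_ge[OF d'])
  finally have "ereal 4 \<le> conv_radius (alpha d)" .
  then have R: "ereal \<bar>x\<bar> < conv_radius (alpha d)" if "\<bar>x\<bar> \<le> 1" for x :: real
  proof -
    have "ereal \<bar>x\<bar> < ereal 4" using that by simp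
    also note \<open>ereal 4 \<le> conv_radius (alpha d)\<close>
    finally show ?thesis .
  qed
  have A0: "?A 0 = 0" using d by (simp add: alpha_fun_0 alpha_0)
  have s1: "alpha d sums ?A 1" using alpha_fun_sums[of 1 d] R[of 1] by simp
  \<comment> \<open>The terms of index 1 and 2 alone push the value at 1 above 1.\<close>
  have "(\<Sum>l\<in>{1,2}. alpha d l) \<le> (\<Sum>l. alpha d l)"
    using s1 by (intro sum_le_suminf) (auto simp: sums_iff alpha_nonneg)
  moreover have "alpha d 2 > 0"
    using b by (subst alpha_rec) (auto simp: alpha_1 add_pos_nonneg)
  ultimately have A1: "?A 1 > 1" using s1 by (simp add: sums_iff alpha_1)
  have "continuous_on {0..1} ?A"
    by (intro continuous_at_imp_continuous_on ballI isCont_alpha_fun R) auto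
  then obtain \<mu> where mu: "0 \<le> \<mu>" "\<mu> \<le> 1" "?A \<mu> = 1"
    using IVT'[of ?A 0 1 1] A0 A1 by auto
  have "\<mu> \<noteq> 0" "\<mu> \<noteq> 1" using mu A0 A1 by auto
  with mu have mu': "0 < \<mu>" "\<mu> < 1" by auto
  have diff: "x - y \<le> ?A x - ?A y" if "0 \<le> y" "y \<le> x" "x \<le> 1" for x y
    using R[of x] that by (intro alpha_fun_diff_ge) auto
  have uniq: "(\<lambda>l. alpha d (Suc l) * y ^ Suc l) sums 1 \<longleftrightarrow> y = \<mu>" if y: "0 < y" "y < 1" for y
  proof -
    have "(\<lambda>l. alpha d (Suc l) * y ^ Suc l) sums (?A y - alpha d 0 * y ^ 0)"
      using R[of y] y by (subst sums_Suc_iff) (auto intro: alpha_fun_sums)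
    then have "(\<lambda>l. alpha d (Suc l) * y ^ Suc l) sums ?A y" using d by (simp add: alpha_0)
    then have "(\<lambda>l. alpha d (Suc l) * y ^ Suc l) sums 1 \<longleftrightarrow> ?A y = 1"
      by (metis sums_unique2)
    also have "\<dots> \<longleftrightarrow> y = \<mu>"
      using diff[of y \<mu>] diff[of \<mu> y] mu y mu' by (cases y \<mu> rule: linorder_cases) auto
    finally show ?thesis .
  qed
  define x where "x t = \<mu> * exp (- beta d * t)" for t
  have x: "0 \<le> x t" "x t \<le> \<mu>" if "t \<ge> 0" for t
    using that mu b by (auto simp: x_def mult_le_cancel_left2)
  have Ab: "0 \<le> ?A (x t)" "?A (x t) \<le> 1" if "t \<ge> 0" for t
    using diff[of 0 "x t"] diff[of "x t" \<mu>] x[OF that] mu A0 by auto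
  have "profile d \<mu> (\<lambda>t. ?A (x t)) (\<lambda>t. - beta d * alpha_fun1 d (x t))"
    unfolding profile_def
  proof (intro conjI allI impI)
    show "orbit_on (real d) {0..} (\<lambda>t. ?A (x t)) (\<lambda>t. - beta d * alpha_fun1 d (x t))"
      unfolding x_def
    proof (rule alpha_orbit[OF d'])
      show "ereal \<bar>\<mu> * exp (- beta d * t)\<bar> < conv_radius (alpha d)" if "t \<in> {0..}" for t
        using x[of t] that mu by (intro R) (auto simp: x_def)
    qed
    show "?A (x 0) = 1" using mu by (simp add: x_def)
    show "0 \<le> ?A (x t)" if "t \<ge> 0" for t using Ab that by simp
    show "?A (x t) \<le> exp (2 * t)" if "t \<ge> 0" for t
      by (rule order_trans[OF Ab(2)]) (use that in auto)
    show "bounded ((\<lambda>t. ?A (x t)) ` {0..})"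
      using Ab by (auto simp: bounded_iff intro!: exI[of _ 1])
    have "bounded (alpha_fun1 d ` {-\<mu>..\<mu>})"
      by (rule bounded_alpha_fun1) (use R[of \<mu>] mu in auto)
    then obtain C where C: "\<And>s. s \<in> {-\<mu>..\<mu>} \<Longrightarrow> \<bar>alpha_fun1 d s\<bar> \<le> C"
      unfolding bounded_iff ball_simps real_norm_def by blast
    show "bounded ((\<lambda>t. - beta d * alpha_fun1 d (x t)) ` {0..})"
      unfolding bounded_iff
    proof (intro exI[of _ "beta d * C"] ballI)
      fix v assume "v \<in> (\<lambda>t. - beta d * alpha_fun1 d (x t)) ` {0..}"
      then obtain t where t: "t \<ge> 0" "v = - beta d * alpha_fun1 d (x t)" by auto
      have "x t \<in> {-\<mu>..\<mu>}" using x[OF t(1)] mu by auto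
      then show "norm v \<le> beta d * C"
        using b C by (auto simp: t abs_mult intro!: mult_left_mono)
    qed
  qed (simp add: x_def)
  then show ?thesis using mu' uniq by blast
qed


text \<open>Near the equilibrium the series is 8 - 2d - x + O(x^2) at - x. For small
  \<open>x1\<close> this gives a point of the orbit strictly between 1 and 8 - 2d that moves upwards
  in time, which is what \<open>backward_orbit\<close> starts from.\<close>

lemma alpha_fun_near_0:
  assumes d: "1 \<le> d" "d \<le> 3"
  shows "\<exists>x1>0. ereal x1 < conv_radius (alpha d) \<and> 1 < alpha_fun d (- x1) \<and>
    alpha_fun1 d (- x1) < 0 \<and> (\<forall>x. 0 \<le> x \<and> x \<le> x1 \<longrightarrow> 1 \<le> alpha_fun d (- x)) \<and>
    (\<forall>x. 0 < x \<and> x \<le> x1 \<longrightarrow> alpha_fun d (- x) < 8 - 2 * real d)"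
proof -
  let ?F = "alpha_fps d" and ?A' = "eval_fps (fps_deriv (alpha_fps d))"
  have d4: "d \<noteq> 4" using d by auto
  have "0 < ereal (4 * (beta d)\<^sup>2)" using beta_pos[OF d(1) d4] by simp
  also have "\<dots> \<le> conv_radius (alpha d)" by (rule conv_radius_alpha_ge[OF d(1) d4])
  finally have Rpos: "conv_radius (alpha d) > 0" .
  have R': "fps_conv_radius (fps_deriv ?F) \<ge> conv_radius (alpha d)"
    using fps_conv_radius_deriv[of ?F] by (simp add: fps_conv_radius_alpha)
  have dA: "(alpha_fun d has_field_derivative ?A' x) (at x)" if "ereal \<bar>x\<bar> < conv_radius (alpha d)" for x
    unfolding alpha_fun_def[abs_def] using that
    by (intro has_field_derivative_eval_fps) (auto simp: fps_conv_radius_alpha)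
  have A1: "alpha_fun1 d x = x * ?A' x" if "ereal \<bar>x\<bar> < conv_radius (alpha d)" for x
    unfolding alpha_fun1_def euler_fps_def using that R'
    by (subst eval_fps_mult) (auto intro: order_less_le_trans)
  have "isCont ?A' 0"
    using Rpos R' by (intro DERIV_isCont[OF has_field_derivative_eval_fps]) (auto simp: zero_ereal_def[symmetric])
  then have "(?A' \<longlongrightarrow> 1) (at 0)"
    by (simp add: isCont_def eval_fps_at_0 alpha_fps_def alpha_1)
  then have ev1: "\<forall>\<^sub>F x in at 0. ?A' x > 0" by (rule order_tendstoD) simp
  have "isCont (alpha_fun d) 0" using dA[of 0] Rpos by (auto simp: zero_ereal_def[symmetric] intro: DERIV_isCont)
  then have "(alpha_fun d \<longlongrightarrow> 8 - 2 * real d) (at 0)"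
    using d by (simp add: isCont_def alpha_fun_0 alpha_0)
  then have ev2: "\<forall>\<^sub>F x in at 0. alpha_fun d x > 1" by (rule order_tendstoD) (use d in simp)
  obtain R1 where R1: "0 < ereal R1" "ereal R1 < conv_radius (alpha d)"
    using ereal_dense2[OF Rpos] by (auto simp: zero_ereal_def)
  from eventually_conj[OF ev1 ev2] obtain e where e: "e > 0" "\<And>x. x \<noteq> 0 \<Longrightarrow> \<bar>x\<bar> < e \<Longrightarrow> ?A' x > 0 \<and> alpha_fun d x > 1"
    unfolding eventually_at by (auto simp: dist_real_def)
  define x1 where "x1 = min R1 (e / 2)"
  have x1: "x1 > 0" "x1 < e" "x1 \<le> R1" using e R1 by (auto simp: x1_def)
  have r: "ereal \<bar>x\<bar> < conv_radius (alpha d)" if "\<bar>x\<bar> \<le> x1" for x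
  proof -
    have "ereal \<bar>x\<bar> \<le> ereal R1" using that x1 by simp
    then show ?thesis using R1(2) by (rule order_le_less_trans)
  qed
  have A0: "alpha_fun d 0 = 8 - 2 * real d" using d by (simp add: alpha_fun_0 alpha_0)
  have pos: "?A' (- x) > 0" "alpha_fun d (- x) > 1" if "0 < x" "x \<le> x1" for x
    using e(2)[of "- x"] that x1 by auto
  have "alpha_fun d (- x) < 8 - 2 * real d" if x: "0 < x" "x \<le> x1" for x
  proof -
    have "alpha_fun d (- x) < alpha_fun d 0"
    proof (rule DERIV_pos_imp_increasing_open[of "- x" 0 "alpha_fun d"])
      fix s assume s: "- x < s" "s < (0::real)"
      have "?A' s > 0" using pos[of "- s"] s x by auto
      moreover have "(alpha_fun d has_field_derivative ?A' s) (at s)" using s x by (intro dA r) auto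
      ultimately show "\<exists>y. (alpha_fun d has_real_derivative y) (at s) \<and> 0 < y" by blast
    next
      show "continuous_on {- x..0} (alpha_fun d)"
        using x by (intro continuous_at_imp_continuous_on ballI DERIV_isCont[OF dA] r) auto
    qed (use x in auto)
    then show ?thesis by (simp add: A0)
  qed
  moreover have "1 \<le> alpha_fun d (- x)" if "0 \<le> x" "x \<le> x1" for x
    using pos[of x] that A0 d by (cases "x = 0") auto
  moreover have "alpha_fun1 d (- x1) < 0" "1 < alpha_fun d (- x1)" "ereal x1 < conv_radius (alpha d)"
    using pos[of x1] x1 A1[of "- x1"] r[of "x1"] by (auto simp: mult_neg_pos)
  ultimately show ?thesis using x1(1) by blast
qed

lemma has_real_derivative_glue:
  fixes p q p' q' :: "real \<Rightarrow> real"
  assumes ST: "closed S" "closed T" "S \<inter> T = {s}"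
    and p: "\<And>t. t \<in> S \<Longrightarrow> (p has_real_derivative p' t) (at t within S)"
    and q: "\<And>t. t \<in> T \<Longrightarrow> (q has_real_derivative q' t) (at t within T)"
    and e: "p s = q s" "p' s = q' s" and t: "t \<in> S \<union> T"
  shows "((\<lambda>t. if t \<in> S then p t else q t) has_real_derivative (if t \<in> S then p' t else q' t)) (at t within S \<union> T)"
proof -
  have un: "S \<union> {s} = S" "T \<union> {s} = T" using ST by auto
  have cl: "closure S \<inter> closure T = {s}" using ST by simp
  show ?thesis
    unfolding has_real_derivative_iff_has_vector_derivative
  proof (rule has_vector_derivative_If_within_closures[where T = T], goal_cases)
    case 3
    then show ?case using p[of t] unfolding cl un by (simp add: has_real_derivative_iff_has_vector_derivative)
  next
    case 4
    then show ?case using q[of t] unfolding cl un by (simp add: has_real_derivative_iff_has_vector_derivative)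
  next
    case 5
    then have "t \<in> closure S \<inter> closure T" by blast
    then show ?case unfolding cl using e by simp
  next
    case 6
    then have "t \<in> closure S \<inter> closure T" by blast
    then show ?case unfolding cl using e by simp
  qed (use t in auto)
qed

lemma orbit_on_glue:
  assumes f: "orbit_on d {0..s} f f1" and g: "orbit_on d {s..} g g1"
    and s: "0 \<le> s" and eqs: "f s = g s" "f1 s = g1 s"
  shows "orbit_on d {0..} (\<lambda>t. if t \<in> {0..s} then f t else g t) (\<lambda>t. if t \<in> {0..s} then f1 t else g1 t)"
proof -
  have set: "{0..} = {0..s} \<union> {s..}" "{0..s} \<inter> {s..} = {s}" using s by auto
  note glue = has_real_derivative_glue[where S = "{0..s}" and T = "{s..}" and s = s, folded set(1)]
  show ?thesis
    unfolding orbit_on_def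
  proof (intro ballI conjI)
    fix t :: real assume t: "t \<in> {0..}"
    show "((\<lambda>t. if t \<in> {0..s} then f t else g t) has_real_derivative (if t \<in> {0..s} then f1 t else g1 t)) (at t within {0..})"
      by (rule glue) (use f g eqs t set in \<open>auto simp: orbit_on_def\<close>)
    have "((\<lambda>t. if t \<in> {0..s} then f1 t else g1 t) has_real_derivative
       (if t \<in> {0..s} then (6 - d) * f1 t - (8 - 2 * d) * f t + (f t)\<^sup>2 else (6 - d) * g1 t - (8 - 2 * d) * g t + (g t)\<^sup>2)) (at t within {0..})"
      by (rule glue) (use f g eqs t set in \<open>auto simp: orbit_on_def\<close>)
    then show "((\<lambda>t. if t \<in> {0..s} then f1 t else g1 t) has_real_derivative
       (6 - d) * (if t \<in> {0..s} then f1 t else g1 t) - (8 - 2 * d) * (if t \<in> {0..s} then f t else g t)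
         + (if t \<in> {0..s} then f t else g t)\<^sup>2) (at t within {0..})"
      by (rule DERIV_cong) simp
  qed
qed

text \<open>The backward orbit is run in the original direction on [0, s0] and continued by the
  series, whose data at time s0 it matches.\<close>

lemma profile_low_dim:
  assumes d: "1 \<le> d" "d \<le> 3"
  shows "\<exists>\<mu> y z. profile d \<mu> y z \<and> \<mu> < 0"
proof -
  have d4: "d \<noteq> 4" using d by auto
  define a where "a = 8 - 2 * real d"
  define b where "b = beta d"
  have b: "b > 0" using beta_pos[OF d(1) d4] by (simp add: b_def)
  obtain x1 where x1: "x1 > 0" "ereal x1 < conv_radius (alpha d)" "1 < alpha_fun d (- x1)"
    "alpha_fun1 d (- x1) < 0" "\<And>x. 0 \<le> x \<Longrightarrow> x \<le> x1 \<Longrightarrow> 1 \<le> alpha_fun d (- x)"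
    "\<And>x. 0 < x \<Longrightarrow> x \<le> x1 \<Longrightarrow> alpha_fun d (- x) < a"
    using alpha_fun_near_0[OF d] unfolding a_def by blast
  have y1: "alpha_fun d (- x1) < a" using x1(1) x1(6)[of x1] by simp
  have z1: "- b * alpha_fun1 d (- x1) > 0" using b x1(4) by (simp add: mult_pos_neg)
  obtain s0 P q where s0: "s0 > 0" and P0: "P 0 = alpha_fun d (- x1)" and q0: "q 0 = - b * alpha_fun1 d (- x1)"
    and Ps: "P s0 = 1" and Pb: "\<And>s. s \<in> {0..s0} \<Longrightarrow> 1 \<le> P s \<and> P s \<le> alpha_fun d (- x1)"
    and Pd: "\<And>s. s \<in> {0..s0} \<Longrightarrow> (P has_real_derivative - q s) (at s within {0..s0})"
    and qd: "\<And>s. s \<in> {0..s0} \<Longrightarrow> (q has_real_derivative - (6 - real d) * q s + P s * (a - P s)) (at s within {0..s0})"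
    using backward_orbit[OF x1(3) y1 _ z1, of "6 - real d"] d by auto
  \<comment> \<open>The time shift: the series argument must equal - \<open>x1\<close> exactly at
    time \<open>s0\<close>.\<close>
  define \<mu> where "\<mu> = - x1 * exp (b * s0)"
  define X where "X t = \<mu> * exp (- b * t)" for t
  define y where "y t = (if t \<in> {0..s0} then P (s0 - t) else alpha_fun d (X t))" for t
  define z where "z t = (if t \<in> {0..s0} then q (s0 - t) else - b * alpha_fun1 d (X t))" for t
  have X: "- x1 \<le> X t" "X t < 0" if "t \<ge> s0" for t
    using that x1(1) b by (auto simp: X_def \<mu>_def mult.assoc simp flip: exp_add)
  have Xs: "X s0 = - x1" by (simp add: X_def \<mu>_def mult.assoc flip: exp_add)
  have XR: "ereal \<bar>X t\<bar> < conv_radius (alpha d)" if "t \<ge> s0" for t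
  proof -
    have "ereal \<bar>X t\<bar> \<le> ereal x1" using X[OF that] by simp
    then show ?thesis using x1(2) by (rule order_le_less_trans)
  qed
  have o1: "orbit_on (real d) {0..s0} (\<lambda>t. P (s0 - t)) (\<lambda>t. q (s0 - t))"
    unfolding orbit_on_def
  proof (intro ballI conjI)
    fix t assume t: "t \<in> {0..s0}"
    have r: "((\<lambda>t. s0 - t) has_real_derivative - 1) (at t within {0..s0})" by (auto intro!: derivative_eq_intros)
    have im: "(\<lambda>t. s0 - t) ` {0..s0} \<subseteq> {0..s0}" by auto
    have st: "s0 - t \<in> {0..s0}" using t by auto
    show "((\<lambda>t. P (s0 - t)) has_real_derivative q (s0 - t)) (at t within {0..s0})"
      using DERIV_image_chain[of P _ "\<lambda>t. s0 - t" t "{0..s0}", OF DERIV_subset[OF Pd[OF st] im] r] by (simp add: o_def)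
    have "((\<lambda>t. q (s0 - t)) has_real_derivative (- (6 - real d) * q (s0 - t) + P (s0 - t) * (a - P (s0 - t))) * - 1) (at t within {0..s0})"
      using DERIV_image_chain[of q _ "\<lambda>t. s0 - t" t "{0..s0}", OF DERIV_subset[OF qd[OF st] im] r] by (simp add: o_def)
    then show "((\<lambda>t. q (s0 - t)) has_real_derivative
        (6 - real d) * q (s0 - t) - (8 - 2 * real d) * P (s0 - t) + (P (s0 - t))\<^sup>2) (at t within {0..s0})"
      by (rule DERIV_cong) (simp add: a_def algebra_simps power2_eq_square)
  qed
  have o2: "orbit_on (real d) {s0..} (\<lambda>t. alpha_fun d (X t)) (\<lambda>t. - b * alpha_fun1 d (X t))"
    unfolding X_def b_def by (rule alpha_orbit[OF d(1) d4]) (use XR in \<open>simp add: X_def b_def\<close>)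
  have o: "orbit_on (real d) {0..} y z"
    unfolding y_def[abs_def] z_def[abs_def]
    by (rule orbit_on_glue[OF o1 o2]) (use s0 P0 q0 Xs in auto)
  have yb: "1 \<le> y t" "y t \<le> a" if "t \<ge> 0" for t
  proof -
    show "1 \<le> y t"
      using Pb[of "s0 - t"] x1(5)[of "- X t"] X[of t] that by (auto simp: y_def)
    show "y t \<le> a"
      using Pb[of "s0 - t"] y1 x1(6)[of "- X t"] X[of t] that by (auto simp: y_def)
  qed
  have y0: "y 0 = 1" using Ps s0 by (simp add: y_def)
  have z: "bounded (z ` {0..})"
  proof -
    have "bounded ((\<lambda>t. q (s0 - t)) ` {0..s0})"
      by (intro compact_imp_bounded compact_continuous_image orbit_on_continuous(2)[OF o1]) auto
    moreover have "bounded ((\<lambda>u. - b * alpha_fun1 d u) ` {- x1..x1})"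
      using bounded_scaling[OF bounded_alpha_fun1[OF x1(2)], of "- b"] by (simp add: image_image)
    moreover have "z ` {0..} \<subseteq> (\<lambda>t. q (s0 - t)) ` {0..s0} \<union> (\<lambda>u. - b * alpha_fun1 d u) ` {- x1..x1}"
    proof
      fix v assume "v \<in> z ` {0..}"
      then obtain t where t: "t \<ge> 0" "v = z t" by auto
      show "v \<in> (\<lambda>t. q (s0 - t)) ` {0..s0} \<union> (\<lambda>u. - b * alpha_fun1 d u) ` {- x1..x1}"
      proof (cases "t \<le> s0")
        case False
        then have "X t \<in> {- x1..x1}" using X[of t] x1(1) by auto
        then show ?thesis using t False by (auto simp: z_def)
      qed (use t in \<open>auto simp: z_def\<close>)
    qed
    ultimately show ?thesis by (meson bounded_Un bounded_subset)
  qed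
  have "profile d \<mu> y z"
    unfolding profile_def
  proof (intro conjI allI impI)
    show "y t \<le> exp (2 * t)" if "t \<ge> 0" for t
      by (rule orbit_on_le_exp[OF o y0 yb(2) that])
    show "bounded (y ` {0..})"
      unfolding bounded_iff
    proof (intro exI[of _ a] ballI)
      fix v assume "v \<in> y ` {0..}"
      then obtain t where "t \<ge> 0" "v = y t" by auto
      then show "norm v \<le> a" using yb[of t] by simp
    qed
    show "y t = alpha_fun d (\<mu> * exp (- beta d * t))"
      if t: "t \<ge> 0" "ereal \<bar>\<mu> * exp (- beta d * t)\<bar> < conv_radius (alpha d)" for t
    proof -
      \<comment> \<open>Strictly beyond \<open>s0\<close>, where \<open>y\<close> is the series by
        definition. The series argument shrinks in time, so convergence at \<open>t\<close> implies
        convergence on all of [t, T], and backward uniqueness carries equality from \<open>T\<close>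
        to \<open>t\<close>.\<close>
      define T where "T = max t (s0 + 1)"
      have "ereal \<bar>X s\<bar> < conv_radius (alpha d)" if "s \<in> {t..T}" for s
      proof -
        have "\<bar>X s\<bar> \<le> \<bar>X t\<bar>" using that b by (simp add: X_def abs_mult mult_left_mono)
        then have "ereal \<bar>X s\<bar> \<le> ereal \<bar>X t\<bar>" by simp
        also have "\<dots> < conv_radius (alpha d)" using t(2) by (simp add: X_def b_def)
        finally show ?thesis .
      qed
      then have o3: "orbit_on (real d) {t..T} (\<lambda>t. alpha_fun d (X t)) (\<lambda>t. - b * alpha_fun1 d (X t))"
        unfolding X_def b_def by (intro alpha_orbit[OF d(1) d4])
      have o4: "orbit_on (real d) {t..T} y z"
        by (rule orbit_on_subset[OF o]) (use t in auto)
      have "y t = alpha_fun d (X t)"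
        by (rule orbit_on_unique[OF o4 o3]) (auto simp: T_def y_def z_def)
      then show ?thesis by (simp add: X_def b_def)
    qed
  qed (use o y0 yb z in \<open>auto intro: order_trans[OF zero_le_one]\<close>)
  moreover have "\<mu> < 0" using x1(1) by (simp add: \<mu>_def)
  ultimately show ?thesis by blast
qed


text \<open>Here s is the squared norm and h = 1 - u. Using s instead of the norm keeps h(|x|^2)
  twice differentiable at the origin too. Half the Laplacian of h(|x|^2) is 2 s h'' + d h', so the
  stated equation is Laplace u = u^2 rewritten for h. The bound on s h'' is the form in which second
  derivatives in space are controlled.\<close>

lemma radial_solution:
  assumes pr: "profile d \<mu> y z"
  shows "\<exists>h h1 h2 C. (\<forall>s. (h has_real_derivative h1 s) (at s)) \<and> (\<forall>s. (h1 has_real_derivative h2 s) (at s)) \<and>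
    continuous_on UNIV h2 \<and> h 1 = 0 \<and>
    (\<forall>s\<ge>1. h s = 1 - y (ln s / 2) / s \<and> 0 \<le> h s \<and> h s \<le> 1 \<and>
       h s - (2 * s * h2 s + real d * h1 s) = 1 / 2 + (h s)\<^sup>2 / 2) \<and>
    (\<forall>s\<ge>0. \<bar>h s\<bar> \<le> C \<and> \<bar>h1 s\<bar> \<le> C \<and> \<bar>s * h2 s\<bar> \<le> C)"
proof -
  have o: "orbit_on (real d) {0..} y z" and y0: "y 0 = 1"
    and yb: "\<And>t. t \<ge> 0 \<Longrightarrow> 0 \<le> y t \<and> y t \<le> exp (2 * t)"
    and bd: "bounded (y ` {0..})" "bounded (z ` {0..})"
    using pr by (auto simp: profile_def)
  define z' where "z' t = (6 - real d) * z t - (8 - 2 * real d) * y t + (y t)\<^sup>2" for t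
  define \<tau> where "\<tau> s = ln s / 2" for s :: real
  define f where "f s = 1 - y (\<tau> s) / s" for s
  define f1 where "f1 s = - (z (\<tau> s) / 2 - y (\<tau> s)) / s\<^sup>2" for s
  define f2 where "f2 s = - (z' (\<tau> s) / 4 - 3 / 2 * z (\<tau> s) + 2 * y (\<tau> s)) / s ^ 3" for s
  have tau: "(\<tau> has_real_derivative 1 / (2 * s)) (at s within {1..})" if "s \<ge> 1" for s
    unfolding \<tau>_def using that by (auto intro!: derivative_eq_intros)
  have tau_im: "\<tau> ` {1..} \<subseteq> {0..}" by (auto simp: \<tau>_def)
  have tau0: "\<tau> s \<ge> 0" if "s \<ge> 1" for s using that by (simp add: \<tau>_def)
  have yd: "((\<lambda>s. y (\<tau> s)) has_real_derivative z (\<tau> s) * (1 / (2 * s))) (at s within {1..})"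
    and zd: "((\<lambda>s. z (\<tau> s)) has_real_derivative z' (\<tau> s) * (1 / (2 * s))) (at s within {1..})" if s: "s \<ge> 1" for s
    using DERIV_image_chain[OF DERIV_subset[OF _ tau_im] tau[OF s], of y "z (\<tau> s)"]
      DERIV_image_chain[OF DERIV_subset[OF _ tau_im] tau[OF s], of z "z' (\<tau> s)"] o tau0[OF s]
    by (auto simp: orbit_on_def o_def z'_def)
  have fd: "(f has_real_derivative f1 s) (at s within {1..})" if s: "s \<ge> 1" for s
    unfolding f_def f1_def using s
    by (auto intro!: derivative_eq_intros yd simp: field_simps power2_eq_square)
  have fd1: "(f1 has_real_derivative f2 s) (at s within {1..})" if s: "s \<ge> 1" for s
    unfolding f1_def f2_def using s
    by (auto intro!: derivative_eq_intros yd zd simp: field_simps power2_eq_square power3_eq_cube)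
  have yc: "continuous_on {1..} (\<lambda>s. y (\<tau> s))" "continuous_on {1..} (\<lambda>s. z (\<tau> s))"
    by (rule DERIV_continuous_on[OF yd], simp) (rule DERIV_continuous_on[OF zd], simp)
  have f2c: "continuous_on {1..} f2"
    unfolding f2_def z'_def by (intro continuous_intros yc) auto
  \<comment> \<open>Inside the ball h is continued by its second-order Taylor polynomial at s = 1,
    so that h'' is continuous; the constant term is absent since f(1) = 0.\<close>
  define h where "h s = (if s \<in> {1..} then f s else f1 1 * (s - 1) + f2 1 / 2 * (s - 1)\<^sup>2)" for s
  define h1 where "h1 s = (if s \<in> {1..} then f1 s else f1 1 + f2 1 * (s - 1))" for s
  define h2 where "h2 s = (if s \<in> {1..} then f2 s else f2 1)" for s
  have U: "UNIV = {1..} \<union> {..1::real}" "{1..} \<inter> {..1::real} = {1}" by auto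
  note glue = has_real_derivative_glue[where S = "{1..}" and T = "{..1::real}" and s = 1, folded U(1)]
  have f_1: "f 1 = 0" using y0 by (simp add: f_def \<tau>_def)
  have hd: "(h has_real_derivative h1 s) (at s)" for s
    unfolding h_def[abs_def] h1_def
    by (rule glue) (use U fd f_1 in \<open>auto intro!: derivative_eq_intros\<close>)
  have hd1: "(h1 has_real_derivative h2 s) (at s)" for s
    unfolding h1_def[abs_def] h2_def
    by (rule glue) (use U fd1 in \<open>auto intro!: derivative_eq_intros\<close>)
  have "h2 = (\<lambda>s. f2 (max 1 s))" by (auto simp: h2_def max_def)
  moreover have "continuous_on UNIV (\<lambda>s. f2 (max 1 s))"
    by (intro continuous_on_compose2[OF f2c] continuous_intros) auto
  ultimately have h2c: "continuous_on UNIV h2" by simp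
  have hs: "h s = 1 - y (ln s / 2) / s" "0 \<le> h s" "h s \<le> 1"
     "h s - (2 * s * h2 s + real d * h1 s) = 1 / 2 + (h s)\<^sup>2 / 2" if s: "s \<ge> 1" for s
  proof -
    show 1: "h s = 1 - y (ln s / 2) / s" using s by (simp add: h_def f_def \<tau>_def)
    have "0 \<le> y (\<tau> s)" "y (\<tau> s) \<le> s" using yb[OF tau0[OF s]] s by (auto simp: \<tau>_def)
    then have "0 \<le> y (\<tau> s) / s" "y (\<tau> s) / s \<le> 1" using s by auto
    then show "0 \<le> h s" "h s \<le> 1" using 1 by (auto simp: \<tau>_def)
    define g where "g = y (\<tau> s) / s"
    \<comment> \<open>With g = u, this is the radial equation in the variable s.\<close>
    have E: "2 * s * h2 s + real d * h1 s = - g\<^sup>2 / 2"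
      using s by (simp add: g_def h1_def h2_def f1_def f2_def z'_def field_simps power2_eq_square power3_eq_cube)
    have H: "h s = 1 - g" using s by (simp add: g_def h_def f_def)
    show "h s - (2 * s * h2 s + real d * h1 s) = 1 / 2 + (h s)\<^sup>2 / 2"
      unfolding E H by (simp add: power2_eq_square field_simps)
  qed
  obtain Y where Y: "\<And>t. t \<ge> 0 \<Longrightarrow> \<bar>y t\<bar> \<le> Y" using bd(1) unfolding bounded_iff ball_simps real_norm_def by auto
  obtain Z where Z: "\<And>t. t \<ge> 0 \<Longrightarrow> \<bar>z t\<bar> \<le> Z" using bd(2) unfolding bounded_iff ball_simps real_norm_def by auto
  define K where "K = \<bar>6 - real d\<bar> * Z + \<bar>8 - 2 * real d\<bar> * Y + Y\<^sup>2"
  have YZ: "0 \<le> Y" "0 \<le> Z" using Y[of 0] Z[of 0] by auto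
  have K: "\<bar>z' t\<bar> \<le> K" if "t \<ge> 0" for t
  proof -
    have "\<bar>z' t\<bar> \<le> \<bar>(6 - real d) * z t\<bar> + \<bar>(8 - 2 * real d) * y t\<bar> + \<bar>(y t)\<^sup>2\<bar>" unfolding z'_def by linarith
    also have "\<dots> \<le> K"
      unfolding K_def abs_mult power2_eq_square using Y[OF that] Z[OF that] YZ
      by (intro add_mono mult_left_mono mult_mono) auto
    finally show ?thesis .
  qed
  define N where "N = K / 4 + 3 / 2 * Z + 2 * Y"
  have f1b: "\<bar>f1 s\<bar> \<le> Z / 2 + Y" and f2b: "\<bar>s * f2 s\<bar> \<le> N" if s: "s \<ge> 1" for s
  proof -
    have "\<bar>f1 s\<bar> = \<bar>z (\<tau> s) / 2 - y (\<tau> s)\<bar> / s\<^sup>2" using s by (simp add: f1_def)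
    also have "\<dots> \<le> (Z / 2 + Y) / 1"
      using s Y[OF tau0[OF s]] Z[OF tau0[OF s]] YZ by (intro frac_le) (auto simp: abs_le_iff)
    finally show "\<bar>f1 s\<bar> \<le> Z / 2 + Y" by simp
    have "\<bar>s * f2 s\<bar> = \<bar>z' (\<tau> s) / 4 - 3 / 2 * z (\<tau> s) + 2 * y (\<tau> s)\<bar> / s\<^sup>2"
      using s by (simp add: f2_def abs_mult power2_eq_square power3_eq_cube)
    also have "\<dots> \<le> N / 1"
      using s K[OF tau0[OF s]] Y[OF tau0[OF s]] Z[OF tau0[OF s]] YZ
      unfolding N_def by (intro frac_le) (auto simp: abs_le_iff)
    finally show "\<bar>s * f2 s\<bar> \<le> N" by simp
  qed
  define C where "C = 1 + (Z / 2 + Y) + N"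
  have N0: "N \<ge> 0" using f2b[of 1] by simp
  have "\<bar>h s\<bar> \<le> C \<and> \<bar>h1 s\<bar> \<le> C \<and> \<bar>s * h2 s\<bar> \<le> C" if s: "s \<ge> 0" for s
  proof (cases "s \<ge> 1")
    case True
    then show ?thesis using hs(2,3)[OF True] f1b[OF True] f2b[OF True] YZ N0 by (auto simp: C_def h1_def h2_def)
  next
    case False
    have e: "\<bar>s - 1\<bar> \<le> 1" "\<bar>s\<bar> \<le> 1" "(s - 1)\<^sup>2 \<le> 1" using s False by (auto simp: power_le_one_iff abs_square_le_1)
    have A: "\<bar>f1 1 * (s - 1)\<bar> \<le> (Z / 2 + Y) * 1" "\<bar>f2 1 * (s - 1)\<bar> \<le> N * 1" "\<bar>s * f2 1\<bar> \<le> 1 * N"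
      "\<bar>f2 1 / 2 * (s - 1)\<^sup>2\<bar> \<le> (N / 2) * 1"
      unfolding abs_mult by (intro mult_mono; use f1b[of 1] f2b[of 1] e YZ N0 in simp)+
    have "\<bar>f1 1\<bar> \<le> Z / 2 + Y" using f1b[of 1] by simp
    moreover have "\<bar>h s\<bar> \<le> \<bar>f1 1 * (s - 1)\<bar> + \<bar>f2 1 / 2 * (s - 1)\<^sup>2\<bar>"
      "\<bar>h1 s\<bar> \<le> \<bar>f1 1\<bar> + \<bar>f2 1 * (s - 1)\<bar>" "h2 s = f2 1"
      using False unfolding h_def h1_def h2_def by (simp_all only: if_False atLeast_iff abs_triangle_ineq)
    ultimately show ?thesis using A YZ N0 unfolding C_def by auto
  qed
  moreover have "h 1 = 0" using hs(1)[of 1] y0 by simp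
  ultimately show ?thesis using hd hd1 h2c hs by blast
qed

section \<open>Gaussian moments and the generator of Brownian motion\<close>

lemma
  fixes f :: "'a::euclidean_space \<Rightarrow> real \<Rightarrow> real"
  assumes f: "\<And>b. b \<in> Basis \<Longrightarrow> integrable lborel (f b)"
  shows integral_lborel_prod: "(\<integral>z. (\<Prod>b\<in>Basis. f b (z \<bullet> b)) \<partial>lborel) = (\<Prod>b\<in>Basis. \<integral>t. f b t \<partial>lborel)"
    and integrable_lborel_prod: "integrable lborel (\<lambda>z::'a. \<Prod>b\<in>Basis. f b (z \<bullet> b))"
proof -
  interpret product_sigma_finite "\<lambda>b::'a. lborel :: real measure"
    by standard
  have [measurable]: "f b \<in> borel_measurable borel" if "b \<in> Basis" for b
    using borel_measurable_integrable[OF f[OF that]] by simp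
  have m[measurable]: "(\<lambda>x. \<Sum>b\<in>Basis. x b *\<^sub>R b) \<in> (\<Pi>\<^sub>M b\<in>Basis. lborel) \<rightarrow>\<^sub>M (borel :: 'a measure)"
    by measurable
  have fm: "(\<lambda>z::'a. \<Prod>b\<in>Basis. f b (z \<bullet> b)) \<in> borel_measurable borel" by measurable
  have e: "(\<Prod>b\<in>Basis. f b ((\<Sum>c\<in>Basis. x c *\<^sub>R c) \<bullet> b)) = (\<Prod>b\<in>Basis. f b (x b))" for x :: "'a \<Rightarrow> real"
    by (intro prod.cong) auto
  show "(\<integral>z. (\<Prod>b\<in>Basis. f b (z \<bullet> b)) \<partial>lborel) = (\<Prod>b\<in>Basis. \<integral>t. f b t \<partial>lborel)"
    unfolding lborel_eq[where 'a='a] integral_distr[OF m fm] e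
    by (rule product_integral_prod) (use f in auto)
  show "integrable lborel (\<lambda>z::'a. \<Prod>b\<in>Basis. f b (z \<bullet> b))"
    unfolding lborel_eq[where 'a='a] integrable_distr_eq[OF m fm] e
    by (rule product_integrable_prod) (use f in auto)
qed

definition gauss :: "'a::euclidean_space measure" where
  "gauss = density lborel (\<lambda>z. ennreal (\<Prod>b\<in>Basis. std_normal_density (z \<bullet> b)))"

lemma sets_gauss [measurable_cong, simp]: "sets gauss = sets borel"
  by (simp add: gauss_def)

lemma space_gauss [simp]: "space gauss = UNIV"
  by (simp add: gauss_def)

lemma prob_space_gauss: "prob_space (gauss :: 'a::euclidean_space measure)"
proof
  have "(\<integral>\<^sup>+ t. ennreal (std_normal_density t) \<partial>lborel) = 1"
    using prob_space.emeasure_space_1[OF prob_space_normal_density[of 1 0]]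
    by (simp add: emeasure_density)
  moreover have "emeasure (gauss :: 'a measure) (space gauss) = (\<integral>\<^sup>+ z. (\<Prod>b\<in>Basis. ennreal (std_normal_density ((z::'a) \<bullet> b))) \<partial>lborel)"
    by (simp add: gauss_def emeasure_density prod_ennreal)
  ultimately show "emeasure (gauss :: 'a measure) (space gauss) = 1"
    using nn_integral_lborel_prod[where 'a = 'a and f = "\<lambda>b t. ennreal (std_normal_density t)"] by simp
qed

lemma
  fixes f :: "'a::euclidean_space \<Rightarrow> real \<Rightarrow> real"
  assumes f: "\<And>b. b \<in> Basis \<Longrightarrow> integrable lborel (\<lambda>t. std_normal_density t * f b t)"
    and [measurable]: "\<And>b. f b \<in> borel_measurable borel"
  shows integral_gauss_prod: "(\<integral>z. (\<Prod>b\<in>Basis. f b (z \<bullet> b)) \<partial>gauss) = (\<Prod>b\<in>Basis. \<integral>t. std_normal_density t * f b t \<partial>lborel)"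
    and integrable_gauss_prod: "integrable gauss (\<lambda>z::'a. \<Prod>b\<in>Basis. f b (z \<bullet> b))"
proof -
  have "(\<integral>z. (\<Prod>b\<in>Basis. f b (z \<bullet> b)) \<partial>gauss) = (\<integral>z. (\<Prod>b\<in>Basis. std_normal_density (z \<bullet> b) * f b (z \<bullet> b)) \<partial>lborel)"
    unfolding gauss_def by (subst integral_density) (auto simp: prod_nonneg prod.distrib)
  also have "\<dots> = (\<Prod>b\<in>Basis. \<integral>t. std_normal_density t * f b t \<partial>lborel)"
    by (rule integral_lborel_prod[OF f])
  finally show "(\<integral>z. (\<Prod>b\<in>Basis. f b (z \<bullet> b)) \<partial>gauss) = (\<Prod>b\<in>Basis. \<integral>t. std_normal_density t * f b t \<partial>lborel)" .
  show "integrable gauss (\<lambda>z::'a. \<Prod>b\<in>Basis. f b (z \<bullet> b))"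
    unfolding gauss_def using integrable_lborel_prod[OF f]
    by (subst integrable_density) (auto simp: prod_nonneg prod.distrib)
qed

lemma
  fixes b c :: "'a::euclidean_space"
  assumes b: "b \<in> Basis" and c: "c \<in> Basis"
  shows integral_gauss_coord: "(\<integral>z. z \<bullet> b \<partial>gauss) = 0"
    and integrable_gauss_coord: "integrable gauss (\<lambda>z. z \<bullet> b)"
    and integral_gauss_coord2: "(\<integral>z. (z \<bullet> b) * (z \<bullet> c) \<partial>gauss) = (if b = c then 1 else 0)"
    and integrable_gauss_coord2: "integrable gauss (\<lambda>z. (z \<bullet> b) * (z \<bullet> c))"
proof -
  have m: "integrable lborel (\<lambda>t. std_normal_density t * t ^ k)" for k
    by (rule integrable_std_normal_moment)
  have m0: "(\<integral>t. std_normal_density t \<partial>lborel) = 1"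
    using integral_std_normal_moment_even[of 0] by simp
  have m1: "(\<integral>t. std_normal_density t * t \<partial>lborel) = 0"
    using integral_std_normal_moment_odd[of 0] by simp
  have m2: "(\<integral>t. std_normal_density t * (t * t) \<partial>lborel) = 1"
    using integral_std_normal_moment_even[of 1] by (simp add: power2_eq_square)
  \<comment> \<open>A single coordinate, and a product of two, are written as products over the
    whole basis so that the integrals factorise; for b = c the two conditions of \<open>g\<close>
    multiply to the square.\<close>
  define f where "f e t = (if e = b then t else (1::real))" for e :: 'a and t
  define g where "g e t = (if e = b then t else (1::real)) * (if e = c then t else (1::real))" for e :: 'a and t
  have fe: "(\<Prod>e\<in>Basis. f e (z \<bullet> e)) = z \<bullet> b" for z
    using b by (simp add: f_def prod.If_cases prod.delta)
  have ge: "(\<Prod>e\<in>Basis. g e (z \<bullet> e)) = (z \<bullet> b) * (z \<bullet> c)" for z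
    using b c by (simp add: g_def prod.distrib prod.delta)
  have fi: "integrable lborel (\<lambda>t. std_normal_density t * f e t)" for e
    using m[of 0] m[of 1] by (cases "e = b") (simp_all add: f_def)
  have gi: "integrable lborel (\<lambda>t. std_normal_density t * g e t)" for e
    using m[of 0] m[of 1] m[of 2] by (cases "e = b"; cases "e = c") (simp_all add: g_def power2_eq_square)
  have [measurable]: "f e \<in> borel_measurable borel" "g e \<in> borel_measurable borel" for e
    unfolding f_def g_def by measurable
  show "(\<integral>z. z \<bullet> b \<partial>gauss) = 0"
    using integral_gauss_prod[of f] b fi unfolding fe by (auto simp: f_def m1 intro!: prod_zero bexI[of _ b])
  show "integrable gauss (\<lambda>z. z \<bullet> b)"
    using integrable_gauss_prod[of f] fi unfolding fe by simp
  show "integrable gauss (\<lambda>z. (z \<bullet> b) * (z \<bullet> c))"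
    using integrable_gauss_prod[of g] gi unfolding ge by simp
  have "(\<integral>z. (z \<bullet> b) * (z \<bullet> c) \<partial>gauss) = (\<Prod>e\<in>Basis. \<integral>t. std_normal_density t * g e t \<partial>lborel)"
    using integral_gauss_prod[of g] gi unfolding ge by simp
  also have "\<dots> = (if b = c then 1 else 0)"
  proof (cases "b = c")
    case True
    then have "(\<integral>t. std_normal_density t * g e t \<partial>lborel) = 1" for e
      by (cases "e = c") (auto simp: g_def m0 m2)
    then show ?thesis using True by simp
  next
    case False
    then have "(\<integral>t. std_normal_density t * g b t \<partial>lborel) = 0"
      by (simp add: g_def m1)
    then show ?thesis using False b by (auto intro!: prod_zero bexI[of _ b])
  qed
  finally show "(\<integral>z. (z \<bullet> b) * (z \<bullet> c) \<partial>gauss) = (if b = c then 1 else 0)" .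
qed

lemma
  fixes x :: "'a::euclidean_space"
  shows integral_gauss_inner: "(\<integral>z. x \<bullet> z \<partial>gauss) = 0"
    and integrable_gauss_inner: "integrable gauss (\<lambda>z. x \<bullet> z)"
    and integral_gauss_inner2: "(\<integral>z. (x \<bullet> z)\<^sup>2 \<partial>gauss) = (norm x)\<^sup>2"
    and integrable_gauss_inner2: "integrable gauss (\<lambda>z. (x \<bullet> z)\<^sup>2)"
    and integral_gauss_norm2: "(\<integral>z. (norm (z::'a))\<^sup>2 \<partial>gauss) = DIM('a)"
    and integrable_gauss_norm2: "integrable gauss (\<lambda>z::'a. (norm z)\<^sup>2)"
proof -
  have e1: "x \<bullet> z = (\<Sum>b\<in>Basis. (x \<bullet> b) * (z \<bullet> b))" for z by (rule euclidean_inner)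
  have e2: "(x \<bullet> z)\<^sup>2 = (\<Sum>b\<in>Basis. \<Sum>c\<in>Basis. ((x \<bullet> b) * (x \<bullet> c)) * ((z \<bullet> b) * (z \<bullet> c)))" for z
    unfolding e1[of z] power2_eq_square sum_product by (simp add: mult_ac)
  have e3: "(norm z)\<^sup>2 = (\<Sum>b\<in>Basis. (z \<bullet> b) * (z \<bullet> b))" for z :: 'a
    by (subst power2_norm_eq_inner, subst euclidean_inner) simp
  note i = integrable_gauss_coord integrable_gauss_coord2
  have "integrable gauss (\<lambda>z. \<Sum>b\<in>Basis. (x \<bullet> b) * (z \<bullet> b))"
    by (intro Bochner_Integration.integrable_sum integrable_mult_right i)
  then show "integrable gauss (\<lambda>z. x \<bullet> z)" by (simp only: e1[symmetric])
  have "integrable gauss (\<lambda>z. \<Sum>b\<in>Basis. \<Sum>c\<in>Basis. ((x \<bullet> b) * (x \<bullet> c)) * ((z \<bullet> b) * (z \<bullet> c)))"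
    by (intro Bochner_Integration.integrable_sum integrable_mult_right i)
  then show "integrable gauss (\<lambda>z. (x \<bullet> z)\<^sup>2)" by (simp only: e2)
  have "integrable gauss (\<lambda>z::'a. \<Sum>b\<in>Basis. (z \<bullet> b) * (z \<bullet> b))"
    by (intro Bochner_Integration.integrable_sum i)
  then show "integrable gauss (\<lambda>z::'a. (norm z)\<^sup>2)" by (simp only: e3)
  have "(\<integral>z. (\<Sum>b\<in>Basis. (x \<bullet> b) * (z \<bullet> b)) \<partial>gauss) = 0"
    by (subst Bochner_Integration.integral_sum) (auto simp: i integral_gauss_coord)
  then show "(\<integral>z. x \<bullet> z \<partial>gauss) = 0" by (simp only: e1[symmetric])
  show "(\<integral>z. (norm (z::'a))\<^sup>2 \<partial>gauss) = DIM('a)"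
    unfolding e3 by (subst Bochner_Integration.integral_sum) (auto simp: i integral_gauss_coord2)
  have "(\<integral>z. (x \<bullet> z)\<^sup>2 \<partial>gauss) = (\<Sum>b\<in>Basis. \<Sum>c\<in>Basis. ((x \<bullet> b) * (x \<bullet> c)) * (if b = c then 1 else 0))"
    unfolding e2
    by (subst Bochner_Integration.integral_sum, (intro Bochner_Integration.integrable_sum integrable_mult_right i; assumption))
       (intro sum.cong refl, subst Bochner_Integration.integral_sum, auto simp: i integral_gauss_coord2)
  also have "\<dots> = (norm x)\<^sup>2" unfolding e3 by (simp add: if_distrib sum.delta cong: if_cong)
  finally show "(\<integral>z. (x \<bullet> z)\<^sup>2 \<partial>gauss) = (norm x)\<^sup>2" .
qed

text \<open>Moves the time step out of the measure and into the integrand, so that limits for small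
  steps can be taken under one fixed Gaussian measure.\<close>

lemma distr_gauss_scale:
  assumes s: "\<sigma> > 0"
  shows "distr gauss borel (\<lambda>z::'a::euclidean_space. \<sigma> *\<^sub>R z) =
    density lborel (\<lambda>z. ennreal (\<Prod>b\<in>Basis. normal_density 0 \<sigma> (z \<bullet> b)))"
proof (rule measure_eqI)
  fix A :: "'a set" assume "A \<in> sets (distr gauss borel (\<lambda>z. \<sigma> *\<^sub>R z))"
  then have [measurable]: "A \<in> sets borel" by simp
  have [measurable]: "(\<lambda>z. \<sigma> *\<^sub>R z) -` A \<in> sets borel"
    using measurable_sets[of "\<lambda>z. \<sigma> *\<^sub>R z" borel borel A] by simp
  have n: "normal_density 0 \<sigma> (\<sigma> * t) = std_normal_density t / \<sigma>" for t
    using s by (simp add: normal_density_def real_sqrt_mult power_mult_distrib field_simps)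
  have "emeasure (density lborel (\<lambda>z::'a. ennreal (\<Prod>b\<in>Basis. normal_density 0 \<sigma> (z \<bullet> b)))) A =
      (\<integral>\<^sup>+z. ennreal (\<Prod>b\<in>Basis. normal_density 0 \<sigma> (z \<bullet> b)) * indicator A z \<partial>lborel)"
    by (subst emeasure_density) auto
  also have "\<dots> = (\<integral>\<^sup>+z. ennreal (\<sigma> ^ DIM('a)) * (ennreal (\<Prod>b\<in>Basis. normal_density 0 \<sigma> ((\<sigma> *\<^sub>R z) \<bullet> b)) * indicator A (\<sigma> *\<^sub>R z)) \<partial>lborel)"
    by (subst lborel_affine[of \<sigma> "0::'a"]) (use s in \<open>auto simp: nn_integral_density nn_integral_distr\<close>)
  also have "\<dots> = (\<integral>\<^sup>+z. ennreal (\<Prod>b\<in>Basis. std_normal_density (z \<bullet> b)) * indicator A (\<sigma> *\<^sub>R z) \<partial>lborel)"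
  proof (rule nn_integral_cong)
    fix z :: 'a
    have "\<sigma> ^ DIM('a) * (\<Prod>b\<in>Basis. normal_density 0 \<sigma> ((\<sigma> *\<^sub>R z) \<bullet> b)) = (\<Prod>b\<in>Basis. std_normal_density (z \<bullet> b))"
      using s by (simp add: n prod_dividef)
    then show "ennreal (\<sigma> ^ DIM('a)) * (ennreal (\<Prod>b\<in>Basis. normal_density 0 \<sigma> ((\<sigma> *\<^sub>R z) \<bullet> b)) * indicator A (\<sigma> *\<^sub>R z))
        = ennreal (\<Prod>b\<in>Basis. std_normal_density (z \<bullet> b)) * indicator A (\<sigma> *\<^sub>R z)"
      using s by (simp only: mult.assoc[symmetric]) (subst ennreal_mult[symmetric], auto intro!: prod_nonneg)
  qed
  also have "\<dots> = emeasure (distr gauss borel (\<lambda>z. \<sigma> *\<^sub>R z)) A"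
    unfolding gauss_def
    by (subst emeasure_distr) (auto simp: emeasure_density intro!: nn_integral_cong split: split_indicator)
  finally show "emeasure (distr gauss borel (\<lambda>z. \<sigma> *\<^sub>R z)) A =
      emeasure (density lborel (\<lambda>z. ennreal (\<Prod>b\<in>Basis. normal_density 0 \<sigma> (z \<bullet> b)))) A" by simp
qed simp

text \<open>A function of s = |x|^2 with the bounds that make its Hessian in x bounded. The factor s
  in front of h'' comes from the Hessian term h'' (x . z)^2, which is at most s |h''| |z|^2.\<close>

locale radial =
  fixes h h1 h2 :: "real \<Rightarrow> real" and C :: real
  assumes h: "\<And>s. (h has_real_derivative h1 s) (at s)"
    and h1: "\<And>s. (h1 has_real_derivative h2 s) (at s)"
    and h2: "continuous_on UNIV h2"
    and h_le: "\<And>s. 0 \<le> s \<Longrightarrow> \<bar>h s\<bar> \<le> C"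
    and h1_le: "\<And>s. 0 \<le> s \<Longrightarrow> \<bar>h1 s\<bar> \<le> C"
    and h2_le: "\<And>s. 0 \<le> s \<Longrightarrow> \<bar>s * h2 s\<bar> \<le> C"
begin

lemma C_nonneg: "C \<ge> 0"
  using h_le[of 0] by simp

definition rad :: "'a::euclidean_space \<Rightarrow> real" where
  "rad x = h ((norm x)\<^sup>2)"

text \<open>Half the Laplacian of \<^term>\<open>rad\<close>.\<close>

definition gen :: "'a::euclidean_space \<Rightarrow> real" where
  "gen x = 2 * (norm x)\<^sup>2 * h2 ((norm x)\<^sup>2) + real DIM('a) * h1 ((norm x)\<^sup>2)"

text \<open>The second-order remainder: 2 h' (x . z) is the derivative at x in direction z, and its
  mean over Gaussian z is 0.\<close>

definition taylor_rem :: "real \<Rightarrow> 'a::euclidean_space \<Rightarrow> 'a \<Rightarrow> real" where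
  "taylor_rem e x z = (rad (x + e *\<^sub>R z) - rad x - 2 * e * h1 ((norm x)\<^sup>2) * (x \<bullet> z)) / e\<^sup>2"

text \<open>The Brownian transition operator applied to \<open>rad\<close>; the time is
  \<open>e^2\<close>, so \<open>e\<close> is a standard deviation.\<close>

definition heat :: "real \<Rightarrow> 'a::euclidean_space \<Rightarrow> real" where
  "heat e x = (\<integral>z. rad (x + e *\<^sub>R z) \<partial>gauss)"

lemma cont_h: "continuous_on A h" and cont_h1: "continuous_on A h1" and cont_h2: "continuous_on A h2"
proof -
  show "continuous_on A h" by (intro continuous_at_imp_continuous_on ballI DERIV_isCont[OF h])
  show "continuous_on A h1" by (intro continuous_at_imp_continuous_on ballI DERIV_isCont[OF h1])
  show "continuous_on A h2" by (rule continuous_on_subset[OF h2]) simp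
qed

lemma cont_rad: "continuous_on A rad"
  unfolding rad_def by (intro continuous_on_compose2[OF cont_h[of UNIV]] continuous_intros) auto

lemma cont_gen: "continuous_on A gen"
  unfolding gen_def
  by (intro continuous_intros continuous_on_compose2[OF cont_h1[of UNIV]] continuous_on_compose2[OF cont_h2[of UNIV]]) auto

lemma rad_measurable [measurable]: "rad \<in> borel_measurable borel"
  by (rule borel_measurable_continuous_onI[OF cont_rad])

lemma gen_measurable [measurable]: "gen \<in> borel_measurable borel"
  by (rule borel_measurable_continuous_onI[OF cont_gen])

lemma rad_le: "\<bar>rad x\<bar> \<le> C"
  by (simp add: rad_def h_le)

lemma gen_le: "\<bar>gen (x::'a::euclidean_space)\<bar> \<le> (2 + real DIM('a)) * C"
proof -
  let ?s = "(norm x)\<^sup>2"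
  have "\<bar>gen x\<bar> \<le> 2 * \<bar>?s * h2 ?s\<bar> + real DIM('a) * \<bar>h1 ?s\<bar>"
    unfolding gen_def by (rule order_trans[OF abs_triangle_ineq]) (simp add: abs_mult)
  also have "\<dots> \<le> 2 * C + real DIM('a) * C"
    by (intro add_mono mult_left_mono h1_le h2_le) auto
  finally show ?thesis by (simp add: algebra_simps)
qed

text \<open>The Maclaurin formula of order two for t -> h(|x + t z|^2), with \<open>d m\<close> its
  m-th derivative in the cases used. The Lagrange form evaluates the Hessian at an intermediate
  point, which suits both the bound and the limit.\<close>

lemma taylor_rem_eq:
  assumes e: "e > 0"
  shows "\<exists>t. 0 < t \<and> t < e \<and> taylor_rem e x z =
    2 * h2 ((norm (x + t *\<^sub>R z))\<^sup>2) * ((x + t *\<^sub>R z) \<bullet> z)\<^sup>2 + h1 ((norm (x + t *\<^sub>R z))\<^sup>2) * (norm z)\<^sup>2"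
proof -
  define q where "q t = (norm (x + t *\<^sub>R z))\<^sup>2" for t
  have q: "q t = (norm x)\<^sup>2 + 2 * t * (x \<bullet> z) + t\<^sup>2 * (norm z)\<^sup>2" for t
    unfolding q_def power2_norm_eq_inner by (simp add: inner_add inner_commute power2_eq_square algebra_simps)
  have qd: "(q has_real_derivative 2 * ((x + t *\<^sub>R z) \<bullet> z)) (at t)" for t
    unfolding q[abs_def] power2_norm_eq_inner
    by (auto intro!: derivative_eq_intros simp: inner_add algebra_simps)
  define d where "d m t = (if m = 0 then h (q t) else if m = 1 then h1 (q t) * (2 * ((x + t *\<^sub>R z) \<bullet> z))
      else h2 (q t) * (2 * ((x + t *\<^sub>R z) \<bullet> z))\<^sup>2 + h1 (q t) * (2 * (norm z)\<^sup>2))" for m :: nat and t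
  have d0: "DERIV (d 0) t :> d 1 t" for t
    unfolding d_def by (simp add: DERIV_chain2[OF h qd, simplified])
  have d1: "DERIV (d 1) t :> d 2 t" for t
    unfolding d_def power2_norm_eq_inner
    by (auto intro!: derivative_eq_intros DERIV_chain2[OF h1 qd] simp: inner_add algebra_simps power2_eq_square)
  have "\<forall>m t. m < 2 \<and> 0 \<le> t \<and> t \<le> e \<longrightarrow> DERIV (d m) t :> d (Suc m) t"
    using d0 d1 by (auto simp: less_2_cases_iff One_nat_def[symmetric] Suc_1 simp del: One_nat_def)
  from Maclaurin[OF e _ _ this, of "\<lambda>t. h (q t)"] obtain t where t: "0 < t" "t < e"
    "h (q e) = (\<Sum>m<2. d m 0 / fact m * e ^ m) + d 2 t / fact 2 * e ^ 2"
    by (auto simp: d_def[abs_def])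
  then have "h (q e) = h (q 0) + 2 * h1 (q 0) * (x \<bullet> z) * e + d 2 t / 2 * e\<^sup>2"
    by (simp add: numeral_2_eq_2 d_def[of 0] d_def[of "Suc 0"])
  then have "rad (x + e *\<^sub>R z) - rad x - 2 * e * h1 ((norm x)\<^sup>2) * (x \<bullet> z) = d 2 t / 2 * e\<^sup>2"
    by (simp add: rad_def q_def)
  then have "taylor_rem e x z = d 2 t / 2"
    unfolding taylor_rem_def using e by simp
  then show ?thesis using t(1,2)
    by (intro exI[of _ t]) (simp add: d_def q_def power2_eq_square algebra_simps)
qed

lemma hessian_le:
  fixes y z :: "'a::euclidean_space"
  shows "\<bar>2 * h2 ((norm y)\<^sup>2) * (y \<bullet> z)\<^sup>2 + h1 ((norm y)\<^sup>2) * (norm z)\<^sup>2\<bar> \<le> 3 * C * (norm z)\<^sup>2"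
proof -
  have "(y \<bullet> z)\<^sup>2 \<le> (norm y)\<^sup>2 * (norm z)\<^sup>2"
    using Cauchy_Schwarz_ineq[of y z] by (simp add: power2_norm_eq_inner)
  then have "\<bar>2 * h2 ((norm y)\<^sup>2) * (y \<bullet> z)\<^sup>2\<bar> \<le> 2 * \<bar>h2 ((norm y)\<^sup>2)\<bar> * ((norm y)\<^sup>2 * (norm z)\<^sup>2)"
    by (simp add: abs_mult mult_left_mono)
  also have "\<dots> = 2 * \<bar>(norm y)\<^sup>2 * h2 ((norm y)\<^sup>2)\<bar> * (norm z)\<^sup>2"
    by (simp add: abs_mult)
  also have "\<dots> \<le> 2 * C * (norm z)\<^sup>2"
    by (intro mult_right_mono mult_left_mono h2_le) auto
  finally have 1: "\<bar>2 * h2 ((norm y)\<^sup>2) * (y \<bullet> z)\<^sup>2\<bar> \<le> 2 * C * (norm z)\<^sup>2" .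
  have "\<bar>h1 ((norm y)\<^sup>2) * (norm z)\<^sup>2\<bar> \<le> C * (norm z)\<^sup>2"
    by (simp add: abs_mult mult_right_mono h1_le)
  with 1 show ?thesis by linarith
qed

lemma taylor_rem_le:
  assumes "e > 0"
  shows "\<bar>taylor_rem e x z\<bar> \<le> 3 * C * (norm z)\<^sup>2"
  using taylor_rem_eq[OF assms, of x z] hessian_le by (auto simp del: inner_add_left)

text \<open>The base point varies with n because it will be the position of the path at a grid time
  close to the time of interest. The intermediate points of the Lagrange form converge along with
  it.\<close>

lemma taylor_rem_tendsto:
  fixes x :: "'a::euclidean_space"
  assumes x: "X \<longlonglongrightarrow> x" and e: "\<And>n. e n > 0" "e \<longlonglongrightarrow> 0"
  shows "(\<lambda>n. taylor_rem (e n) (X n) z) \<longlonglongrightarrow>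
    2 * h2 ((norm x)\<^sup>2) * (x \<bullet> z)\<^sup>2 + h1 ((norm x)\<^sup>2) * (norm z)\<^sup>2"
proof -
  have "\<forall>n. \<exists>t. 0 < t \<and> t < e n \<and> taylor_rem (e n) (X n) z =
    2 * h2 ((norm (X n + t *\<^sub>R z))\<^sup>2) * ((X n + t *\<^sub>R z) \<bullet> z)\<^sup>2 + h1 ((norm (X n + t *\<^sub>R z))\<^sup>2) * (norm z)\<^sup>2"
    using taylor_rem_eq[OF e(1)] by blast
  from choice[OF this] obtain t where t: "\<And>n. 0 < t n" "\<And>n. t n < e n" "\<And>n. taylor_rem (e n) (X n) z =
    2 * h2 ((norm (X n + t n *\<^sub>R z))\<^sup>2) * ((X n + t n *\<^sub>R z) \<bullet> z)\<^sup>2 + h1 ((norm (X n + t n *\<^sub>R z))\<^sup>2) * (norm z)\<^sup>2"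
    by blast
  have "t \<longlonglongrightarrow> 0"
    by (rule real_tendsto_sandwich[OF _ _ tendsto_const e(2)]) (auto intro!: always_eventually less_imp_le t)
  then have y: "(\<lambda>n. X n + t n *\<^sub>R z) \<longlonglongrightarrow> x"
    using tendsto_add[OF x tendsto_scaleR[OF _ tendsto_const]] by fastforce
  have n2: "(\<lambda>n. (norm (X n + t n *\<^sub>R z))\<^sup>2) \<longlonglongrightarrow> (norm x)\<^sup>2" by (intro tendsto_intros y)
  have c1: "isCont h1 s" and c2: "isCont h2 s" for s
    using cont_h1[of UNIV] cont_h2[of UNIV] by (auto simp: continuous_on_eq_continuous_at)
  show ?thesis unfolding t(3)
    by (intro tendsto_intros isCont_tendsto_compose[OF c1 n2] isCont_tendsto_compose[OF c2 n2] y)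
qed

lemma taylor_rem_measurable [measurable]: "taylor_rem e x \<in> borel_measurable borel"
  unfolding taylor_rem_def by measurable

lemma heat_measurable [measurable]: "(heat e :: 'a::euclidean_space \<Rightarrow> real) \<in> borel_measurable borel"
proof -
  interpret gauss: prob_space "gauss :: 'a measure" by (rule prob_space_gauss)
  show ?thesis unfolding heat_def by measurable
qed

text \<open>The first-order Taylor term is odd in z and integrates to 0, so the change is of order
  \<open>e^2\<close>.\<close>

lemma heat_eq:
  fixes x :: "'a::euclidean_space"
  assumes e: "e > 0"
  shows "heat e x - rad x = e\<^sup>2 * (\<integral>z. taylor_rem e x z \<partial>gauss)"
proof -
  interpret gauss: prob_space "gauss :: 'a measure" by (rule prob_space_gauss)
  have i: "integrable gauss (\<lambda>z. rad (x + e *\<^sub>R z))"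
    by (rule gauss.integrable_const_bound[where B = C]) (auto simp: rad_le)
  have "(\<integral>z. e\<^sup>2 * taylor_rem e x z \<partial>gauss) = (\<integral>z. rad (x + e *\<^sub>R z) - rad x - 2 * e * h1 ((norm x)\<^sup>2) * (x \<bullet> z) \<partial>gauss)"
    unfolding taylor_rem_def using e by simp
  also have "\<dots> = heat e x - rad x - 2 * e * h1 ((norm x)\<^sup>2) * 0"
    unfolding heat_def
    by (simp add: i integrable_gauss_inner integral_gauss_inner gauss.prob_space[simplified])
  finally show ?thesis by simp
qed

lemma heat_le:
  fixes x :: "'a::euclidean_space"
  shows "\<bar>heat e x\<bar> \<le> C"
proof -
  interpret gauss: prob_space "gauss :: 'a measure" by (rule prob_space_gauss)
  have i: "integrable gauss (\<lambda>z. rad (x + e *\<^sub>R z))"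
    by (rule gauss.integrable_const_bound[where B = C]) (auto simp: rad_le)
  have "\<bar>heat e x\<bar> \<le> (\<integral>z. \<bar>rad (x + e *\<^sub>R z)\<bar> \<partial>gauss)" unfolding heat_def by (rule integral_abs_bound)
  also have "\<dots> \<le> (\<integral>z. C \<partial>(gauss :: 'a measure))" by (intro Bochner_Integration.integral_mono integrable_abs i) (auto simp: rad_le)
  finally show ?thesis by (simp add: gauss.prob_space[simplified])
qed

lemma heat_diff_le:
  fixes x :: "'a::euclidean_space"
  assumes e: "e > 0"
  shows "\<bar>heat e x - rad x\<bar> \<le> e\<^sup>2 * (3 * C * real DIM('a))"
proof -
  have i: "integrable gauss (\<lambda>z::'a. 3 * C * (norm z)\<^sup>2)" by (intro integrable_mult_right integrable_gauss_norm2)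
  have "\<bar>\<integral>z. taylor_rem e x z \<partial>gauss\<bar> \<le> (\<integral>z. 3 * C * (norm z)\<^sup>2 \<partial>(gauss :: 'a measure))"
  proof (rule order_trans[OF integral_abs_bound])
    show "(\<integral>z. \<bar>taylor_rem e x z\<bar> \<partial>gauss) \<le> (\<integral>z. 3 * C * (norm z)\<^sup>2 \<partial>(gauss :: 'a measure))"
    proof (intro Bochner_Integration.integral_mono i integrable_abs taylor_rem_le[OF e])
      show "integrable gauss (taylor_rem e x)"
        by (rule Bochner_Integration.integrable_bound[OF i])
           (auto intro!: AE_I2 order_trans[OF taylor_rem_le[OF e] abs_ge_self])
    qed
  qed
  then show ?thesis unfolding heat_eq[OF e] by (simp add: abs_mult integral_gauss_norm2 mult_left_mono)
qed

text \<open>Dominated convergence with the Gaussian-integrable bound 3 C |z|^2. The means of (x .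
  z)^2 and |z|^2 are |x|^2 and d, which assembles \<open>gen\<close>.\<close>

lemma heat_tendsto:
  fixes x :: "'a::euclidean_space"
  assumes x: "X \<longlonglongrightarrow> x" and e: "\<And>n. e n > 0" "e \<longlonglongrightarrow> 0"
  shows "(\<lambda>n. (heat (e n) (X n) - rad (X n)) / (e n)\<^sup>2) \<longlonglongrightarrow> gen x"
proof -
  let ?H = "\<lambda>z. 2 * h2 ((norm x)\<^sup>2) * (x \<bullet> z)\<^sup>2 + h1 ((norm x)\<^sup>2) * (norm z)\<^sup>2"
  have i: "integrable gauss (\<lambda>z::'a. 3 * C * (norm z)\<^sup>2)" by (intro integrable_mult_right integrable_gauss_norm2)
  have "(\<lambda>n. \<integral>z. taylor_rem (e n) (X n) z \<partial>gauss) \<longlonglongrightarrow> (\<integral>z. ?H z \<partial>gauss)"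
    by (rule integral_dominated_convergence[OF _ _ i])
       (auto intro!: AE_I2 taylor_rem_le e taylor_rem_tendsto x)
  moreover have "(\<integral>z. ?H z \<partial>gauss) = gen x"
    by (simp add: gen_def integrable_gauss_inner2 integrable_gauss_norm2 integral_gauss_inner2 integral_gauss_norm2)
  moreover have "(heat (e n) (X n) - rad (X n)) / (e n)\<^sup>2 = (\<integral>z. taylor_rem (e n) (X n) z \<partial>gauss)" for n
    unfolding heat_eq[OF e(1)] using e(1)[of n] by simp
  ultimately show ?thesis by simp
qed

end

section \<open>Brownian paths\<close>

locale wiener =
  fixes W :: "(real \<Rightarrow> 'a::euclidean_space) measure"
  assumes wiener: "wiener_measure W"
begin

sublocale prob_space W
  using wiener by (simp add: wiener_measure_def)

lemma sets_W: "sets W = sets path_space"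
  using wiener by (simp add: wiener_measure_def)

lemma space_W:
  assumes "w \<in> space W"
  shows "continuous_on {0..} w" "w 0 = 0" "t < 0 \<Longrightarrow> w t = undefined"
proof -
  have "space W = space path_space" by (rule sets_eq_imp_space_eq[OF sets_W])
  then have "w \<in> (\<Pi>\<^sub>E t\<in>{0..}. UNIV) \<inter> {w. continuous_on {0..} w \<and> w 0 = 0}"
    using assms by (simp add: path_space_def space_restrict_space space_PiM)
  then show "continuous_on {0..} w" "w 0 = 0" "t < 0 \<Longrightarrow> w t = undefined"
    by (auto simp: PiE_def extensional_def)
qed

lemma eval_measurable [measurable]: "(\<lambda>w. w t) \<in> W \<rightarrow>\<^sub>M borel"
proof (cases "t \<ge> 0")
  case True
  have "(\<lambda>w. w t) \<in> path_space \<rightarrow>\<^sub>M (borel :: 'a measure)"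
    unfolding path_space_def using True by (intro measurable_restrict_space1 measurable_component_singleton) auto
  then show ?thesis using measurable_cong_sets[OF sets_W refl] by blast
next
  case False
  have "(\<lambda>w. undefined) \<in> W \<rightarrow>\<^sub>M (borel :: 'a measure)" by simp
  then show ?thesis
  proof (rule measurable_cong[THEN iffD1, rotated])
    fix w assume "w \<in> space W"
    then show "undefined = w t" using space_W(3)[of w t] False by simp
  qed
qed

text \<open>Joint measurability in path and time is needed because paths are evaluated at random
  lifetimes. It follows by continuity from evaluation at grid times just below t; at negative times
  the value is constant.\<close>

lemma eval_measurable2:
  "(\<lambda>p. (fst p) (snd p)) \<in> W \<Otimes>\<^sub>M (borel :: real measure) \<rightarrow>\<^sub>M (borel :: 'a measure)"
proof -
  define f where "f n p = (if snd p < 0 then undefined else fst p (of_int \<lfloor>real (Suc n) * snd p\<rfloor> / real (Suc n)))"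
    for n and p :: "(real \<Rightarrow> 'a) \<times> real"
  show ?thesis
  proof (rule borel_measurable_LIMSEQ_metric)
    fix n
    have "(\<lambda>p. (fst p) (of_int i / real (Suc n))) \<in> W \<Otimes>\<^sub>M (borel :: real measure) \<rightarrow>\<^sub>M borel" for i :: int
      by (rule measurable_compose[OF measurable_fst eval_measurable])
    moreover have "(\<lambda>p. \<lfloor>real (Suc n) * snd p\<rfloor>) \<in> W \<Otimes>\<^sub>M (borel :: real measure) \<rightarrow>\<^sub>M count_space UNIV"
      by measurable
    ultimately have "(\<lambda>p. fst p (of_int \<lfloor>real (Suc n) * snd p\<rfloor> / real (Suc n))) \<in> W \<Otimes>\<^sub>M (borel :: real measure) \<rightarrow>\<^sub>M borel"
      by (rule measurable_compose_countable)
    then show "f n \<in> W \<Otimes>\<^sub>M (borel :: real measure) \<rightarrow>\<^sub>M (borel :: 'a measure)"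
      unfolding f_def by measurable
  next
    fix p :: "(real \<Rightarrow> 'a) \<times> real" assume p: "p \<in> space (W \<Otimes>\<^sub>M borel)"
    obtain w t where wt: "p = (w, t)" by force
    with p have w: "w \<in> space W" by (auto simp: space_pair_measure)
    show "(\<lambda>n. f n p) \<longlonglongrightarrow> fst p (snd p)"
    proof (cases "t < 0")
      case True
      then show ?thesis using space_W(3)[OF w] by (simp add: f_def wt)
    next
      case False
      have "(\<lambda>n. real_of_int \<lfloor>real (Suc n) * t\<rfloor> / real (Suc n)) \<longlonglongrightarrow> t"
      proof (rule real_tendsto_sandwich)
        show "(\<lambda>n. t - 1 / real (Suc n)) \<longlonglongrightarrow> t"
          using tendsto_diff[OF tendsto_const[of t] LIMSEQ_inverse_real_of_nat] by (simp add: inverse_eq_divide)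
        show "\<forall>\<^sub>F n in sequentially. t - 1 / real (Suc n) \<le> real_of_int \<lfloor>real (Suc n) * t\<rfloor> / real (Suc n)"
        proof (intro always_eventually allI)
          fix n
          have "real (Suc n) * t - 1 \<le> real_of_int \<lfloor>real (Suc n) * t\<rfloor>" by linarith
          then have "(real (Suc n) * t - 1) / real (Suc n) \<le> real_of_int \<lfloor>real (Suc n) * t\<rfloor> / real (Suc n)"
            by (intro divide_right_mono) auto
          then show "t - 1 / real (Suc n) \<le> real_of_int \<lfloor>real (Suc n) * t\<rfloor> / real (Suc n)"
            by (simp add: diff_divide_distrib)
        qed
        show "\<forall>\<^sub>F n in sequentially. real_of_int \<lfloor>real (Suc n) * t\<rfloor> / real (Suc n) \<le> t"
        proof (intro always_eventually allI)
          fix n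
          have "real_of_int \<lfloor>real (Suc n) * t\<rfloor> / real (Suc n) \<le> real (Suc n) * t / real (Suc n)"
            by (intro divide_right_mono) auto
          then show "real_of_int \<lfloor>real (Suc n) * t\<rfloor> / real (Suc n) \<le> t" by simp
        qed
      qed simp
      moreover have "real_of_int \<lfloor>real (Suc n) * t\<rfloor> / real (Suc n) \<in> {0..}" for n
        using False by auto
      ultimately have "(\<lambda>n. w (real_of_int \<lfloor>real (Suc n) * t\<rfloor> / real (Suc n))) \<longlonglongrightarrow> w t"
        using continuous_on_tendsto_compose[OF space_W(1)[OF w], of _ t sequentially] False by auto
      then show ?thesis using False by (simp add: f_def wt)
    qed
  qed
qed

lemma eval_measurable_comp [measurable (raw)]:
  assumes [measurable]: "f \<in> M \<rightarrow>\<^sub>M W" "g \<in> M \<rightarrow>\<^sub>M (borel :: real measure)"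
  shows "(\<lambda>x. f x (g x)) \<in> M \<rightarrow>\<^sub>M (borel :: 'a measure)"
  using measurable_compose[OF _ eval_measurable2, of "\<lambda>x. (f x, g x)" M] by simp

text \<open>Reduces an uncountable existential to countably many times. They are given as rational
  fractions of the interval, so that one countable set serves intervals with random endpoints. A
  rational time may miss a hit, hence the margins 1 / (n + 1); compactness recovers the hit from
  them.\<close>

lemma exists_norm_le_iff:
  assumes w: "w \<in> space W" and ab: "0 \<le> a" "a \<le> b"
  shows "(\<exists>s\<in>{a..b}. norm (x + w s) \<le> 1) \<longleftrightarrow>
    (\<forall>n. \<exists>\<theta>\<in>{\<theta>\<in>\<rat>. 0 \<le> \<theta> \<and> \<theta> \<le> 1}. norm (x + w (a + \<theta> * (b - a))) < 1 + 1 / real (Suc n))"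
proof
  define g where "g \<theta> = norm (x + w (a + \<theta> * (b - a)))" for \<theta>
  have cg: "continuous_on {0..1} g"
    unfolding g_def using ab
    by (intro continuous_intros continuous_on_compose2[OF space_W(1)[OF w]]) auto
  {
    assume "\<exists>s\<in>{a..b}. norm (x + w s) \<le> 1"
    then obtain s where s: "a \<le> s" "s \<le> b" "norm (x + w s) \<le> 1" by auto
    define \<theta> where "\<theta> = (if a = b then 0 else (s - a) / (b - a))"
    have th: "0 \<le> \<theta>" "\<theta> \<le> 1" "a + \<theta> * (b - a) = s"
      using s ab by (auto simp: \<theta>_def field_simps)
    show "\<forall>n. \<exists>\<theta>\<in>{\<theta>\<in>\<rat>. 0 \<le> \<theta> \<and> \<theta> \<le> 1}. norm (x + w (a + \<theta> * (b - a))) < 1 + 1 / real (Suc n)"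
    proof
      fix n
      have "\<forall>e>0. \<exists>d>0. \<forall>t\<in>{0..1}. dist t \<theta> < d \<longrightarrow> dist (g t) (g \<theta>) < e"
        using cg th unfolding continuous_on_iff by auto
      then obtain d where d: "d > 0" "\<And>t. t \<in> {0..1} \<Longrightarrow> dist t \<theta> < d \<Longrightarrow> dist (g t) (g \<theta>) < 1 / real (Suc n)"
        by (metis of_nat_0_less_iff zero_less_Suc zero_less_divide_1_iff)
      have "\<exists>q\<in>\<rat>. 0 \<le> q \<and> q \<le> 1 \<and> \<bar>q - \<theta>\<bar> < d"
      proof (cases "\<theta> = 0")
        case False
        then obtain q where "q \<in> \<rat>" "max 0 (\<theta> - d) < q" "q < \<theta>" using Rats_dense_in_real[of "max 0 (\<theta> - d)" \<theta>] d th by auto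
        then show ?thesis using th by (intro bexI[of _ q]) auto
      qed (use d in \<open>auto intro!: bexI[of _ 0]\<close>)
      then obtain q where q: "q \<in> \<rat>" "0 \<le> q" "q \<le> 1" "\<bar>q - \<theta>\<bar> < d" by blast
      have "dist (g q) (g \<theta>) < 1 / real (Suc n)" using q by (intro d) (auto simp: dist_real_def)
      moreover have "g \<theta> \<le> 1" using s th by (simp add: g_def)
      ultimately have "g q < 1 + 1 / real (Suc n)" by (simp add: dist_real_def)
      then show "\<exists>\<theta>\<in>{\<theta>\<in>\<rat>. 0 \<le> \<theta> \<and> \<theta> \<le> 1}. norm (x + w (a + \<theta> * (b - a))) < 1 + 1 / real (Suc n)"
        using q by (auto simp: g_def)
    qed
  next
    assume A: "\<forall>n. \<exists>\<theta>\<in>{\<theta>\<in>\<rat>. 0 \<le> \<theta> \<and> \<theta> \<le> 1}. norm (x + w (a + \<theta> * (b - a))) < 1 + 1 / real (Suc n)"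
    obtain m where m: "m \<in> {0..1}" "\<And>t. t \<in> {0..1} \<Longrightarrow> g m \<le> g t"
      using continuous_attains_inf[OF _ _ cg] by auto
    have "g m < 1 + inverse (real (Suc n))" for n
      using A[rule_format, of n] m(2) by (fastforce simp: g_def inverse_eq_divide)
    moreover have "(\<lambda>n. 1 + inverse (real (Suc n))) \<longlonglongrightarrow> 1 + 0"
      by (intro tendsto_intros LIMSEQ_inverse_real_of_nat)
    ultimately have "g m \<le> 1" by (intro LIMSEQ_le_const[of "\<lambda>n. 1 + inverse (real (Suc n))"]) (auto intro: less_imp_le)
    moreover have "a + m * (b - a) \<in> {a..b}"
      using m(1) ab mult_right_mono[of m 1 "b - a"] by auto
    ultimately show "\<exists>s\<in>{a..b}. norm (x + w s) \<le> 1" by (auto simp: g_def)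
  }
qed

lemma pred_exists_norm_le:
  assumes [measurable]: "X \<in> M \<rightarrow>\<^sub>M (borel :: 'a measure)" "f \<in> M \<rightarrow>\<^sub>M W"
    "A \<in> M \<rightarrow>\<^sub>M (borel :: real measure)" "B \<in> M \<rightarrow>\<^sub>M (borel :: real measure)"
    and A: "\<And>p. p \<in> space M \<Longrightarrow> 0 \<le> A p"
  shows "Measurable.pred M (\<lambda>p. \<exists>s\<in>{A p..B p}. norm (X p + f p s) \<le> 1)"
proof -
  have c: "countable {\<theta>::real. \<theta> \<in> \<rat> \<and> 0 \<le> \<theta> \<and> \<theta> \<le> 1}"
    by (rule countable_subset[OF _ countable_rat]) auto
  have "Measurable.pred M (\<lambda>p. A p \<le> B p \<and> (\<forall>n. \<exists>\<theta>\<in>{\<theta>\<in>\<rat>. 0 \<le> \<theta> \<and> \<theta> \<le> 1}. norm (X p + f p (A p + \<theta> * (B p - A p))) < 1 + 1 / real (Suc n)))"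
    using c by measurable
  then show ?thesis
  proof (rule measurable_cong[THEN iffD1, rotated])
    fix p assume p: "p \<in> space M"
    have "f p \<in> space W" using measurable_space[OF assms(2) p] .
    then show "(A p \<le> B p \<and> (\<forall>n. \<exists>\<theta>\<in>{\<theta>\<in>\<rat>. 0 \<le> \<theta> \<and> \<theta> \<le> 1}. norm (X p + f p (A p + \<theta> * (B p - A p))) < 1 + 1 / real (Suc n))) =
       (\<exists>s\<in>{A p..B p}. norm (X p + f p s) \<le> 1)"
      using exists_norm_le_iff[OF _ A[OF p], of "f p" "B p" "X p"] by (cases "A p \<le> B p") auto
  qed
qed

lemma distr_increment:
  assumes st: "0 \<le> s" "s < t"
  shows "distr W borel (\<lambda>w. w t - w s) = distr gauss borel (\<lambda>z. sqrt (t - s) *\<^sub>R z)"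
proof -
  have "distributed W lborel (\<lambda>w. w t - w s) (\<lambda>x. ennreal (\<Prod>b\<in>Basis. normal_density 0 (sqrt (t - s)) (x \<bullet> b)))"
    using wiener st by (auto simp: wiener_measure_def)
  then have "distr W lborel (\<lambda>w. w t - w s) = density lborel (\<lambda>x. ennreal (\<Prod>b\<in>Basis. normal_density 0 (sqrt (t - s)) (x \<bullet> b)))"
    by (rule distributed_distr_eq_density)
  moreover have "distr W lborel (\<lambda>w. w t - w s) = distr W borel (\<lambda>w. w t - w s)"
    by (rule distr_cong) auto
  ultimately show ?thesis
    using st by (simp add: distr_gauss_scale)
qed


section \<open>Markov property along a time grid\<close>

definition alive :: "real \<Rightarrow> real \<Rightarrow> 'a \<Rightarrow> nat \<Rightarrow> (real \<Rightarrow> 'a) \<Rightarrow> bool" where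
  "alive \<rho> \<delta> x k w \<longleftrightarrow> (\<forall>j\<le>k. \<rho> \<le> norm (x + w (real j * \<delta>)))"

lemma alive_measurable [measurable]: "Measurable.pred W (alive \<rho> \<delta> x k)"
  unfolding alive_def by measurable

text \<open>Being alive at step k and the position there depend only on the first k increments, and
  the next increment is independent of these and Gaussian. Fubini on the product of the two laws
  integrates it out.\<close>

lemma markov_step:
  fixes g :: "'a \<Rightarrow> real"
  assumes d: "\<delta> > 0" and [measurable]: "g \<in> borel_measurable borel" and g: "\<And>y. \<bar>g y\<bar> \<le> B"
  shows "(\<integral>w. (if alive \<rho> \<delta> x k w then g (x + w (real (Suc k) * \<delta>)) else 0) \<partial>W) =
    (\<integral>w. (if alive \<rho> \<delta> x k w then (\<integral>z. g (x + w (real k * \<delta>) + sqrt \<delta> *\<^sub>R z) \<partial>gauss) else 0) \<partial>W)"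
proof -
  define D where "D i w = w (real (Suc i) * \<delta>) - w (real i * \<delta>)" for i and w :: "real \<Rightarrow> 'a"
  have Dm[measurable]: "D i \<in> W \<rightarrow>\<^sub>M borel" for i unfolding D_def by measurable
  define P where "P = Pi\<^sub>M {..<k} (\<lambda>_. borel :: 'a measure)"
  define Q where "Q = Pi\<^sub>M {k} (\<lambda>_. borel :: 'a measure)"
  \<comment> \<open>The past increments and the next one, as elements of two product spaces.\<close>
  define a where "a w = restrict (\<lambda>i. D i w) {..<k}" for w
  define b where "b w = restrict (\<lambda>i. D i w) {k}" for w
  have am[measurable]: "a \<in> W \<rightarrow>\<^sub>M P" and bm[measurable]: "b \<in> W \<rightarrow>\<^sub>M Q"
    unfolding a_def[abs_def] b_def[abs_def] P_def Q_def by (intro measurable_restrict Dm)+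
  have comp: "(\<lambda>p. p i) \<in> P \<rightarrow>\<^sub>M borel" if "i < k" for i
    unfolding P_def using that by simp
  have Sm: "(\<lambda>p. \<Sum>i<j. p i) \<in> P \<rightarrow>\<^sub>M borel" if "j \<le> k" for j
    using that by (intro borel_measurable_sum comp) auto
  have compk[measurable]: "(\<lambda>p. p k) \<in> Q \<rightarrow>\<^sub>M borel" unfolding Q_def by simp
  \<comment> \<open>The event \<open>alive\<close> expressed through partial sums of increments
    instead of the path.\<close>
  define al where "al p \<longleftrightarrow> (\<forall>j\<in>{..k}. \<rho> \<le> norm (x + (\<Sum>i<j. p i)))" for p :: "nat \<Rightarrow> 'a"
  have [measurable]: "Measurable.pred P al"
    unfolding al_def
  proof (intro pred_intros_finite)
    fix j assume "j \<in> {..k}"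
    then have [measurable]: "(\<lambda>p. \<Sum>i<j. p i) \<in> P \<rightarrow>\<^sub>M borel" by (intro Sm) auto
    show "Measurable.pred P (\<lambda>p. \<rho> \<le> norm (x + (\<Sum>i<j. p i)))" by measurable
  qed simp
  note Smk[measurable] = Sm[OF order_refl]
  define G where "G p q = (if al p then g (x + (\<Sum>i<k. p i) + q k) else 0)" for p q :: "nat \<Rightarrow> 'a"
  have Gm[measurable]: "(\<lambda>(p, q). G p q) \<in> borel_measurable (P \<Otimes>\<^sub>M Q)"
    unfolding G_def split_beta' by measurable
  have Gb: "\<bar>G p q\<bar> \<le> \<bar>B\<bar>" for p q using g[of "x + (\<Sum>i<k. p i) + q k"] by (auto simp: G_def)
  have tele: "(\<Sum>i<j. D i w) = w (real j * \<delta>)" if "w \<in> space W" for j w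
    using that by (induction j) (auto simp: D_def space_W)
  have al_a: "al (a w) = alive \<rho> \<delta> x k w" if w: "w \<in> space W" for w
  proof -
    have "(\<Sum>i<j. a w i) = w (real j * \<delta>)" if "j \<le> k" for j
      using tele[OF w, of j] that by (simp add: a_def)
    then show ?thesis by (auto simp: al_def alive_def)
  qed
  have sum_a: "(\<Sum>i<k. a w i) = w (real k * \<delta>)" if w: "w \<in> space W" for w
    using tele[OF w, of k] by (simp add: a_def)
  have "indep_vars (\<lambda>_. borel) D {..<Suc k}"
  proof -
    have *: "\<And>(n::nat) t. 0 \<le> t 0 \<and> (\<forall>i<n. t i \<le> t (Suc i)) \<Longrightarrow>
        indep_vars (\<lambda>_. borel) (\<lambda>i w. w (t (Suc i)) - w (t i)) {..<n}"
      using wiener by (auto simp: wiener_measure_def)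
    show ?thesis unfolding D_def[abs_def]
      by (rule *[of "\<lambda>i. real i * \<delta>"]) (use d in \<open>auto intro!: mult_right_mono\<close>)
  qed
  from indep_var_restrict[OF this, of "{..<k}" "{k}"]
  have "indep_var P a Q b" unfolding a_def[abs_def] b_def[abs_def] P_def Q_def by auto
  then have D2: "distr W P a \<Otimes>\<^sub>M distr W Q b = distr W (P \<Otimes>\<^sub>M Q) (\<lambda>w. (a w, b w))"
    by (simp add: indep_var_distribution_eq)
  interpret DA: prob_space "distr W P a" by (rule prob_space_distr[OF am])
  interpret DB: prob_space "distr W Q b" by (rule prob_space_distr[OF bm])
  interpret AB: pair_prob_space "distr W P a" "distr W Q b" ..
  have "(\<integral>w. (if alive \<rho> \<delta> x k w then g (x + w (real (Suc k) * \<delta>)) else 0) \<partial>W) = (\<integral>w. G (a w) (b w) \<partial>W)"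
    by (intro Bochner_Integration.integral_cong) (auto simp: G_def al_a sum_a, simp add: b_def D_def)
  also have "\<dots> = (\<integral>p. (\<lambda>(p, q). G p q) p \<partial>distr W (P \<Otimes>\<^sub>M Q) (\<lambda>w. (a w, b w)))"
    by (subst integral_distr) auto
  also have "\<dots> = (\<integral>p. (\<integral>q. G p q \<partial>distr W Q b) \<partial>distr W P a)"
    unfolding D2[symmetric]
  proof (subst AB.integral_fst'[symmetric])
    show "integrable (distr W P a \<Otimes>\<^sub>M distr W Q b) (\<lambda>(p, q). G p q)"
      by (rule AB.integrable_const_bound[where B = "\<bar>B\<bar>"]) (auto simp: Gb)
  qed simp
  also have "\<dots> = (\<integral>w. (\<integral>q. G (a w) q \<partial>distr W Q b) \<partial>W)"
    by (subst integral_distr) auto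
  also have "\<dots> = (\<integral>w. (if alive \<rho> \<delta> x k w then (\<integral>z. g (x + w (real k * \<delta>) + sqrt \<delta> *\<^sub>R z) \<partial>gauss) else 0) \<partial>W)"
  proof (intro Bochner_Integration.integral_cong refl)
    fix w assume w: "w \<in> space W"
    have "(\<integral>q. G (a w) q \<partial>distr W Q b) = (\<integral>v. G (a w) (b v) \<partial>W)"
    proof (rule integral_distr[OF bm])
      have "a w \<in> space P" using measurable_space[OF am w] .
      then have "(\<lambda>q. (a w, q)) \<in> Q \<rightarrow>\<^sub>M P \<Otimes>\<^sub>M Q" by simp
      from measurable_compose[OF this Gm] show "G (a w) \<in> borel_measurable Q" by simp
    qed
    also have "\<dots> = (if alive \<rho> \<delta> x k w then (\<integral>v. g (x + w (real k * \<delta>) + D k v) \<partial>W) else 0)"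
      by (simp add: G_def al_a[OF w] sum_a[OF w] b_def)
    also have "(\<integral>v. g (x + w (real k * \<delta>) + D k v) \<partial>W) = (\<integral>u. g (x + w (real k * \<delta>) + u) \<partial>distr W borel (D k))"
      by (subst integral_distr) auto
    also have "distr W borel (D k) = distr gauss borel (\<lambda>z. sqrt \<delta> *\<^sub>R z)"
      using distr_increment[of "real k * \<delta>" "real (Suc k) * \<delta>"] d
      by (simp add: D_def[abs_def] algebra_simps)
    also have "(\<integral>u. g (x + w (real k * \<delta>) + u) \<partial>distr gauss borel (\<lambda>z. sqrt \<delta> *\<^sub>R z)) =
        (\<integral>z. g (x + w (real k * \<delta>) + sqrt \<delta> *\<^sub>R z) \<partial>gauss)"
    proof (rule integral_distr)
      show "(\<lambda>z. sqrt \<delta> *\<^sub>R z) \<in> gauss \<rightarrow>\<^sub>M (borel :: 'a measure)"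
        by (simp add: measurable_cong_sets[OF sets_gauss refl])
    qed simp
    finally show "(\<integral>q. G (a w) q \<partial>distr W Q b) =
      (if alive \<rho> \<delta> x k w then (\<integral>z. g (x + w (real k * \<delta>) + sqrt \<delta> *\<^sub>R z) \<partial>gauss) else 0)" .
  qed
  finally show ?thesis .
qed

end

section \<open>Killed Brownian motion\<close>

locale wiener_radial = wiener W + radial h h1 h2 C
  for W :: "(real \<Rightarrow> 'a::euclidean_space) measure" and h h1 h2 C
begin

text \<open>The discounted value, frozen at the first grid time with norm below
  \<open>\<rho>\<close>. The factor \<open>exp (- \<delta> * n)\<close> is the probability that an
  exponential lifetime outlasts the n-th grid time.\<close>

primrec stopped :: "real \<Rightarrow> real \<Rightarrow> 'a \<Rightarrow> (real \<Rightarrow> 'a) \<Rightarrow> nat \<Rightarrow> real" where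
  "stopped \<rho> \<delta> x w 0 = rad x"
| "stopped \<rho> \<delta> x w (Suc n) = (if alive \<rho> \<delta> x n w
     then exp (- \<delta> * real (Suc n)) * rad (x + w (real (Suc n) * \<delta>)) else stopped \<rho> \<delta> x w n)"

text \<open>Minus the discrete generator of Brownian motion killed at rate 1; its limit for small
  steps is \<open>rad\<close> - \<open>gen\<close>.\<close>

definition drift :: "real \<Rightarrow> 'a \<Rightarrow> real" where
  "drift \<delta> y = (rad y - exp (- \<delta>) * heat (sqrt \<delta>) y) / \<delta>"

definition running :: "real \<Rightarrow> real \<Rightarrow> 'a \<Rightarrow> nat \<Rightarrow> (real \<Rightarrow> 'a) \<Rightarrow> real" where
  "running \<rho> \<delta> x k w = (if alive \<rho> \<delta> x k w then exp (- \<delta> * real k) * drift \<delta> (x + w (real k * \<delta>)) else 0)"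

lemma drift_bound_nonneg: "(3 * C * real DIM('a) + C) \<ge> 0"
  using C_nonneg by simp

lemma drift_measurable [measurable]: "drift \<delta> \<in> borel_measurable borel"
  unfolding drift_def by measurable

lemma running_measurable [measurable]: "running \<rho> \<delta> x k \<in> borel_measurable W"
  unfolding running_def by measurable

lemma stopped_measurable [measurable]: "(\<lambda>w. stopped \<rho> \<delta> x w n) \<in> borel_measurable W"
proof (induction n)
  case (Suc n)
  note [measurable] = Suc.IH
  show ?case unfolding stopped.simps by measurable
qed simp

lemma stopped_le:
  assumes "\<delta> > 0" shows "\<bar>stopped \<rho> \<delta> x w n\<bar> \<le> C"
proof (induction n)
  case (Suc n)
  have "exp (- \<delta> * real (Suc n)) * \<bar>rad (x + w (real (Suc n) * \<delta>))\<bar> \<le> 1 * C"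
    using assms by (intro mult_mono rad_le) auto
  then show ?case using Suc by (simp add: abs_mult)
qed (simp add: rad_le)

lemma stopped_alive:
  assumes "w \<in> space W" "alive \<rho> \<delta> x n w"
  shows "stopped \<rho> \<delta> x w n = exp (- \<delta> * real n) * rad (x + w (real n * \<delta>))"
proof (cases n)
  case 0
  then show ?thesis using space_W(2)[OF assms(1)] by simp
next
  case (Suc m)
  then have "alive \<rho> \<delta> x m w" using assms(2) by (auto simp: alive_def)
  then show ?thesis using Suc by simp
qed

lemma stopped_dead:
  assumes "\<not> alive \<rho> \<delta> x N w" "\<And>j. j < N \<Longrightarrow> alive \<rho> \<delta> x j w" "0 < N" "N \<le> n"
  shows "stopped \<rho> \<delta> x w n = exp (- \<delta> * real N) * rad (x + w (real N * \<delta>))"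
  using assms(4)
proof (induction n rule: dec_induct)
  case base
  then show ?case using assms(2)[of "N - 1"] assms(3) by (cases N) auto
next
  case (step n)
  have "\<not> alive \<rho> \<delta> x n w" using assms(1) step(1) by (auto simp: alive_def intro: order_trans)
  then show ?case using step by simp
qed

lemma drift_le:
  assumes d: "\<delta> > 0" shows "\<bar>drift \<delta> y\<bar> \<le> (3 * C * real DIM('a) + C)"
proof -
  have "\<bar>rad y - heat (sqrt \<delta>) y\<bar> \<le> \<delta> * (3 * C * real DIM('a))"
    using heat_diff_le[of "sqrt \<delta>" y] d by (simp add: abs_minus_commute)
  moreover have "\<bar>(1 - exp (- \<delta>)) * heat (sqrt \<delta>) y\<bar> \<le> \<delta> * C"
    unfolding abs_mult using d exp_ge_add_one_self[of "- \<delta>"] by (intro mult_mono heat_le) auto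
  moreover have "rad y - exp (- \<delta>) * heat (sqrt \<delta>) y = (rad y - heat (sqrt \<delta>) y) + (1 - exp (- \<delta>)) * heat (sqrt \<delta>) y"
    by (simp add: algebra_simps)
  ultimately have "\<bar>rad y - exp (- \<delta>) * heat (sqrt \<delta>) y\<bar> \<le> \<delta> * (3 * C * real DIM('a)) + \<delta> * C"
    by linarith
  also have "\<dots> = (3 * C * real DIM('a) + C) * \<delta>" by (simp add: algebra_simps)
  finally show ?thesis using d by (simp add: drift_def abs_divide pos_divide_le_eq)
qed

lemma drift_tendsto:
  assumes y: "Y \<longlonglongrightarrow> y" and d: "\<And>n. \<delta> n > 0" "\<delta> \<longlonglongrightarrow> 0"
  shows "(\<lambda>n. drift (\<delta> n) (Y n)) \<longlonglongrightarrow> rad y - gen y"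
proof -
  have s: "(\<lambda>n. sqrt (\<delta> n)) \<longlonglongrightarrow> 0" using tendsto_real_sqrt[OF d(2)] by simp
  have r: "(\<lambda>n. rad (Y n)) \<longlonglongrightarrow> rad y"
    using cont_rad[of UNIV] y by (auto simp: continuous_on_eq_continuous_at intro: isCont_tendsto_compose)
  have g: "(\<lambda>n. (heat (sqrt (\<delta> n)) (Y n) - rad (Y n)) / \<delta> n) \<longlonglongrightarrow> gen y"
    using heat_tendsto[OF y _ s] d(1) by (simp add: less_imp_le)
  have "(\<lambda>n. \<delta> n * ((heat (sqrt (\<delta> n)) (Y n) - rad (Y n)) / \<delta> n) + rad (Y n)) \<longlonglongrightarrow> 0 * gen y + rad y"
    by (intro tendsto_intros g r d)
  moreover have "\<delta> n * ((heat (sqrt (\<delta> n)) (Y n) - rad (Y n)) / \<delta> n) + rad (Y n) = heat (sqrt (\<delta> n)) (Y n)" for n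
    using d(1)[of n] by simp
  ultimately have h: "(\<lambda>n. heat (sqrt (\<delta> n)) (Y n)) \<longlonglongrightarrow> rad y" by simp
  have "((\<lambda>t. (exp t - 1) / t) \<longlongrightarrow> 1) (at (0::real))"
    using DERIV_exp[of 0] by (simp add: has_field_derivative_iff)
  moreover have "filterlim (\<lambda>n. - \<delta> n) (at 0) sequentially"
  proof -
    have "(\<lambda>n. - \<delta> n) \<longlonglongrightarrow> - 0" by (intro tendsto_intros d)
    moreover have "- \<delta> n \<noteq> 0" for n using d(1)[of n] by simp
    ultimately show ?thesis by (simp add: filterlim_at)
  qed
  ultimately have e: "(\<lambda>n. (exp (- \<delta> n) - 1) / (- \<delta> n)) \<longlonglongrightarrow> 1" by (rule filterlim_compose)
  \<comment> \<open>The drift is split into the heat part, which tends to - \<open>gen\<close>, and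
    the discount part, which tends to \<open>rad\<close>.\<close>
  have "(\<lambda>n. - ((heat (sqrt (\<delta> n)) (Y n) - rad (Y n)) / \<delta> n) + ((exp (- \<delta> n) - 1) / (- \<delta> n)) * heat (sqrt (\<delta> n)) (Y n))
      \<longlonglongrightarrow> - gen y + 1 * rad y"
    by (intro tendsto_intros g e h)
  moreover have "- ((heat (sqrt (\<delta> n)) (Y n) - rad (Y n)) / \<delta> n) + ((exp (- \<delta> n) - 1) / (- \<delta> n)) * heat (sqrt (\<delta> n)) (Y n)
      = drift (\<delta> n) (Y n)" for n
    using d(1)[of n] unfolding drift_def by (simp add: field_simps)
  ultimately show ?thesis by simp
qed

lemma running_le:
  assumes "\<delta> > 0" shows "\<bar>running \<rho> \<delta> x k w\<bar> \<le> exp (- \<delta> * real k) * (3 * C * real DIM('a) + C)"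
  using drift_bound_nonneg drift_le[OF assms] by (auto simp: running_def abs_mult)

text \<open>Telescoping over n: while the walk is alive, one step changes the stopped value by a
  difference whose mean, by \<open>markov_step\<close>, is minus the running term.\<close>

lemma discrete_dynkin:
  assumes d: "\<delta> > 0"
  shows "rad x = (\<integral>w. stopped \<rho> \<delta> x w n \<partial>W) + (\<integral>w. (\<Sum>k<n. \<delta> * running \<rho> \<delta> x k w) \<partial>W)"
proof -
  have si: "integrable W (\<lambda>w. stopped \<rho> \<delta> x w n)" for n
    by (rule integrable_const_bound[where B = C]) (auto simp: stopped_le[OF d])
  have ir: "integrable W (running \<rho> \<delta> x k)" for k
    by (rule integrable_const_bound[where B = "exp (- \<delta> * real k) * (3 * C * real DIM('a) + C)"]) (use running_le[OF d] in auto)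
  show ?thesis
  proof (induction n)
    case 0
    then show ?case by (simp add: prob_space)
  next
    case (Suc n)
    \<comment> \<open>On the event of being alive: the next value, its conditional mean and the
      present value, all without discount.\<close>
    define A where "A w = (if alive \<rho> \<delta> x n w then rad (x + w (real (Suc n) * \<delta>)) else 0)" for w
    define B where "B w = (if alive \<rho> \<delta> x n w then heat (sqrt \<delta>) (x + w (real n * \<delta>)) else 0)" for w
    define R where "R w = (if alive \<rho> \<delta> x n w then rad (x + w (real n * \<delta>)) else 0)" for w
    have [measurable]: "A \<in> borel_measurable W" "B \<in> borel_measurable W" "R \<in> borel_measurable W"
      unfolding A_def[abs_def] B_def[abs_def] R_def[abs_def] by measurable
    have iA: "integrable W A" "integrable W B" "integrable W R"
      by (rule integrable_const_bound[where B = C]; use C_nonneg in \<open>auto simp: A_def B_def R_def rad_le heat_le\<close>)+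
    have AB: "(\<integral>w. A w \<partial>W) = (\<integral>w. B w \<partial>W)"
      unfolding A_def B_def heat_def by (rule markov_step[OF d rad_measurable rad_le])
    have "(\<integral>w. stopped \<rho> \<delta> x w (Suc n) \<partial>W)
        = (\<integral>w. stopped \<rho> \<delta> x w n + (exp (- \<delta> * real (Suc n)) * A w - exp (- \<delta> * real n) * R w) \<partial>W)"
      by (intro Bochner_Integration.integral_cong) (auto simp: A_def R_def stopped_alive)
    also have "\<dots> = (\<integral>w. stopped \<rho> \<delta> x w n \<partial>W) + (exp (- \<delta> * real (Suc n)) * (\<integral>w. A w \<partial>W) - exp (- \<delta> * real n) * (\<integral>w. R w \<partial>W))"
      using iA si by simp
    also have "\<dots> = (\<integral>w. stopped \<rho> \<delta> x w n \<partial>W) + (\<integral>w. exp (- \<delta> * real (Suc n)) * B w - exp (- \<delta> * real n) * R w \<partial>W)"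
      unfolding AB using iA by simp
    also have "(\<integral>w. exp (- \<delta> * real (Suc n)) * B w - exp (- \<delta> * real n) * R w \<partial>W) = (\<integral>w. - (\<delta> * running \<rho> \<delta> x n w) \<partial>W)"
    proof (intro Bochner_Integration.integral_cong refl)
      fix w
      have dd: "\<delta> * (e * drift \<delta> y) = e * (rad y - exp (- \<delta>) * heat (sqrt \<delta>) y)" for e y
        using d by (simp add: drift_def)
      have "exp (- \<delta> * real (Suc n)) = exp (- \<delta> * real n) * exp (- \<delta>)"
        by (simp add: algebra_simps flip: exp_add)
      then show "exp (- \<delta> * real (Suc n)) * B w - exp (- \<delta> * real n) * R w = - (\<delta> * running \<rho> \<delta> x n w)"
        unfolding B_def R_def running_def by (simp add: dd right_diff_distrib mult.assoc)
    qed
    also have "\<dots> = - (\<integral>w. \<delta> * running \<rho> \<delta> x n w \<partial>W)" by simp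
    finally show ?case
      using Suc ir by (simp add: Bochner_Integration.integral_sum)
  qed
qed


text \<open>Mesh 2^-m and horizon m. If no dyadic time sees the path below \<open>\<rho>\<close>,
  the discount exp (- m) makes the value small. Otherwise the walk stops one short step after a
  position outside, so its norm is close to \<open>\<rho>\<close> and its value close to
  \<open>h (\<rho>^2)\<close>.\<close>

lemma eventually_stopped_le:
  assumes w: "w \<in> space W" and \<rho>: "\<rho> \<le> norm x" and e: "\<epsilon> > 0"
  shows "\<forall>\<^sub>F m in sequentially. \<bar>stopped \<rho> (1 / 2 ^ m) x w (m * 2 ^ m)\<bar> \<le> \<bar>h (\<rho>\<^sup>2)\<bar> + \<epsilon>"
proof (cases "\<exists>m j. norm (x + w (real j * (1 / 2 ^ m))) < \<rho>")
  case False
  then have "stopped \<rho> (1 / 2 ^ m) x w (m * 2 ^ m) = exp (- real m) * rad (x + w (real (m * 2 ^ m) * (1 / 2 ^ m)))" for m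
    using stopped_alive[OF w, of \<rho> "1 / 2 ^ m" x "m * 2 ^ m"] by (auto simp: alive_def not_less)
  then have le: "\<bar>stopped \<rho> (1 / 2 ^ m) x w (m * 2 ^ m)\<bar> \<le> exp (- real m) * C" for m
    by (simp add: abs_mult rad_le)
  have "(\<lambda>m. exp (- real m) * C) \<longlonglongrightarrow> 0" by real_asymp
  then have "\<forall>\<^sub>F m in sequentially. exp (- real m) * C < \<epsilon>" using e by (rule order_tendstoD)
  then show ?thesis
  proof (elim eventually_mono)
    fix m assume "exp (- real m) * C < \<epsilon>"
    then show "\<bar>stopped \<rho> (1 / 2 ^ m) x w (m * 2 ^ m)\<bar> \<le> \<bar>h (\<rho>\<^sup>2)\<bar> + \<epsilon>"
      using le[of m] abs_ge_zero[of "h (\<rho>\<^sup>2)"] by linarith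
  qed
next
  case True
  then obtain m0 j0 where bad: "norm (x + w (real j0 * (1 / 2 ^ m0))) < \<rho>" by blast
  define J where "J = real j0 * (1 / 2 ^ m0)"
  have "isCont (\<lambda>r. h (r\<^sup>2)) \<rho>"
    by (intro isCont_o2[OF _ DERIV_isCont[OF h]] continuous_intros)
  then obtain \<eta> where eta: "\<eta> > 0" "\<And>r. \<bar>r - \<rho>\<bar> < \<eta> \<Longrightarrow> \<bar>h (r\<^sup>2) - h (\<rho>\<^sup>2)\<bar> < \<epsilon>"
    using e unfolding continuous_at_eps_delta dist_real_def by blast
  have "uniformly_continuous_on {0..J} w"
    by (intro compact_uniformly_continuous continuous_on_subset[OF space_W(1)[OF w]]) auto
  then obtain d where d: "d > 0" "\<And>s t. s \<in> {0..J} \<Longrightarrow> t \<in> {0..J} \<Longrightarrow> dist s t < d \<Longrightarrow> dist (w s) (w t) < \<eta>"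
    unfolding uniformly_continuous_on_def using eta(1) by (meson dist_commute)
  have "(\<lambda>m. 1 / 2 ^ m :: real) \<longlonglongrightarrow> 0" by real_asymp
  then have "\<forall>\<^sub>F m in sequentially. 1 / 2 ^ m < d" using d(1) by (rule order_tendstoD)
  moreover have "\<forall>\<^sub>F m in sequentially. m \<ge> m0" by (rule eventually_ge_at_top)
  moreover have "\<forall>\<^sub>F m in sequentially. J \<le> real m"
    using eventually_ge_at_top[of "nat \<lceil>J\<rceil>"] by eventually_elim linarith
  ultimately show ?thesis
  proof eventually_elim
    case (elim m)
    define \<delta> where "\<delta> = (1 / 2 ^ m :: real)"
    have del: "\<delta> > 0" by (simp add: \<delta>_def)
    define N where "N = (LEAST j. norm (x + w (real j * \<delta>)) < \<rho>)"
    \<comment> \<open>The grids are nested: the offending time of level \<open>m0\<close> is still a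
      grid time at level \<open>m\<close>, so the walk stops no later than \<open>J\<close>.\<close>
    have J: "J = real (j0 * 2 ^ (m - m0)) * \<delta>"
    proof -
      have "(2::real) ^ m = 2 ^ (m - m0) * 2 ^ m0" using elim(2) by (simp flip: power_add)
      then show ?thesis by (simp add: J_def \<delta>_def)
    qed
    have ex: "norm (x + w (real (j0 * 2 ^ (m - m0)) * \<delta>)) < \<rho>" using bad unfolding J[symmetric] J_def .
    have N: "norm (x + w (real N * \<delta>)) < \<rho>" unfolding N_def using ex by (rule LeastI)
    have NJ: "N \<le> j0 * 2 ^ (m - m0)" unfolding N_def using ex by (rule Least_le)
    then have NJ': "real N * \<delta> \<le> J" unfolding J using del
      by (intro mult_right_mono) (simp_all only: of_nat_le_iff less_imp_le)
    have N_le: "N \<le> m * 2 ^ m"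
    proof -
      have "real N * \<delta> \<le> real m" using NJ' elim(3) by linarith
      then have "real N \<le> real (m * 2 ^ m)" by (simp add: \<delta>_def field_simps)
      then show ?thesis by linarith
    qed
    have small: "\<rho> \<le> norm (x + w (real j * \<delta>))" if "j < N" for j
      using not_less_Least[OF that[unfolded N_def]] by simp
    have "N \<noteq> 0"
    proof
      assume "N = 0"
      then show False using N \<rho> space_W(2)[OF w] by simp
    qed
    then have N0: "0 < N" by simp
    have "stopped \<rho> \<delta> x w (m * 2 ^ m) = exp (- \<delta> * real N) * rad (x + w (real N * \<delta>))"
      by (rule stopped_dead[OF _ _ N0 N_le]) (use N small in \<open>auto simp: alive_def not_le\<close>)
    then have "\<bar>stopped \<rho> \<delta> x w (m * 2 ^ m)\<bar> \<le> \<bar>rad (x + w (real N * \<delta>))\<bar>"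
      using del by (simp add: abs_mult mult_left_le_one_le)
    moreover have "\<bar>norm (x + w (real N * \<delta>)) - \<rho>\<bar> < \<eta>"
    proof -
      \<comment> \<open>The preceding grid time exists because the walk starts outside; there the
        norm is still at least \<open>\<rho>\<close>, and uniform continuity bounds how far below it
        can fall.\<close>
      have "dist (real (N - 1) * \<delta>) (real N * \<delta>) < d"
        using N0 elim(1) del by (simp add: dist_real_def of_nat_diff left_diff_distrib flip: \<delta>_def)
      moreover have "real (N - 1) * \<delta> \<le> J"
        by (rule order_trans[OF _ NJ']) (use del in \<open>auto intro!: mult_right_mono\<close>)
      ultimately have "dist (w (real (N - 1) * \<delta>)) (w (real N * \<delta>)) < \<eta>"
        using NJ' del by (intro d) auto
      then have "norm ((x + w (real (N - 1) * \<delta>)) - (x + w (real N * \<delta>))) < \<eta>" by (simp add: dist_norm)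
      then have "norm (x + w (real (N - 1) * \<delta>)) < norm (x + w (real N * \<delta>)) + \<eta>"
        using norm_triangle_sub[of "x + w (real (N - 1) * \<delta>)" "x + w (real N * \<delta>)"] by linarith
      moreover have "\<rho> \<le> norm (x + w (real (N - 1) * \<delta>))" using N0 by (intro small) auto
      ultimately show ?thesis using N by linarith
    qed
    then have "\<bar>rad (x + w (real N * \<delta>)) - h (\<rho>\<^sup>2)\<bar> < \<epsilon>" unfolding rad_def by (rule eta(2))
    ultimately show "\<bar>stopped \<rho> (1 / 2 ^ m) x w (m * 2 ^ m)\<bar> \<le> \<bar>h (\<rho>\<^sup>2)\<bar> + \<epsilon>"
      unfolding \<delta>_def[symmetric] by linarith
  qed
qed

text \<open>The condition ranges over dyadic times of all levels, so that it is exactly the limit of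
  being alive on the successive nested grids.\<close>

definition avoids :: "real \<Rightarrow> 'a \<Rightarrow> real \<Rightarrow> (real \<Rightarrow> 'a) \<Rightarrow> bool" where
  "avoids \<rho> x s w \<longleftrightarrow> (\<forall>m j. real j * (1 / 2 ^ m) \<le> s \<longrightarrow> \<rho> \<le> norm (x + w (real j * (1 / 2 ^ m))))"

text \<open>The Riemann sum of the running terms as a step function of continuous time, so that
  dominated convergence under Lebesgue measure applies.\<close>

definition step :: "real \<Rightarrow> 'a \<Rightarrow> (real \<Rightarrow> 'a) \<Rightarrow> nat \<Rightarrow> real \<Rightarrow> real" where
  "step \<rho> x w m s = (\<Sum>k<m * 2 ^ m. indicator {real k * (1 / 2 ^ m)..<real (Suc k) * (1 / 2 ^ m)} s * running \<rho> (1 / 2 ^ m) x k w)"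

lemma step_eq:
  "step \<rho> x w m s = (if 0 \<le> s \<and> s < real m then running \<rho> (1 / 2 ^ m) x (nat \<lfloor>s * 2 ^ m\<rfloor>) w else 0)"
proof (cases "0 \<le> s")
  case False
  have "indicator {real k * (1 / 2 ^ m)..<real (Suc k) * (1 / 2 ^ m)} s = (0::real)" for k
  proof -
    have "0 \<le> real k * (1 / 2 ^ m)" by simp
    then have "\<not> real k * (1 / 2 ^ m) \<le> s" using False by linarith
    then show ?thesis by simp
  qed
  then show ?thesis using False unfolding step_def by simp
next
  case True
  define K where "K = nat \<lfloor>s * 2 ^ m\<rfloor>"
  have "indicator {real k * (1 / 2 ^ m)..<real (Suc k) * (1 / 2 ^ m)} s = (if k = K then 1 else 0 :: real)" for k
  proof -
    have "s \<in> {real k * (1 / 2 ^ m)..<real (Suc k) * (1 / 2 ^ m)} \<longleftrightarrow> real k \<le> s * 2 ^ m \<and> s * 2 ^ m < real k + 1"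
      by (auto simp: field_simps)
    also have "\<dots> \<longleftrightarrow> \<lfloor>s * 2 ^ m\<rfloor> = int k" by (simp add: floor_eq_iff)
    also have "\<dots> \<longleftrightarrow> k = K" using True unfolding K_def by (subst nat_eq_iff2) auto
    finally show ?thesis by (simp add: indicator_def)
  qed
  then have "step \<rho> x w m s = (\<Sum>k<m * 2 ^ m. if k = K then running \<rho> (1 / 2 ^ m) x K w else 0)"
    unfolding step_def by (intro sum.cong) auto
  also have "\<dots> = (if K < m * 2 ^ m then running \<rho> (1 / 2 ^ m) x K w else 0)" by simp
  also have "K < m * 2 ^ m \<longleftrightarrow> s < real m"
  proof -
    have "K < m * 2 ^ m \<longleftrightarrow> \<lfloor>s * 2 ^ m\<rfloor> < int (m * 2 ^ m)" unfolding K_def using True by (simp add: nat_less_iff)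
    also have "\<dots> \<longleftrightarrow> s * 2 ^ m < real m * 2 ^ m" by (simp add: floor_less_iff)
    finally show ?thesis by simp
  qed
  finally show ?thesis using True by (simp add: K_def)
qed

lemma integral_step: "(\<integral>s. step \<rho> x w m s \<partial>lborel) = (\<Sum>k<m * 2 ^ m. (1 / 2 ^ m) * running \<rho> (1 / 2 ^ m) x k w)"
proof -
  have "(\<integral>s. step \<rho> x w m s \<partial>lborel) = (\<Sum>k<m * 2 ^ m. (\<integral>s. indicator {real k * (1 / 2 ^ m)..<real (Suc k) * (1 / 2 ^ m)} s * running \<rho> (1 / 2 ^ m) x k w \<partial>lborel))"
    unfolding step_def
  proof (intro Bochner_Integration.integral_sum integrable_mult_left impI)
    fix k
    have "real k * (1 / 2 ^ m) \<le> real (Suc k) * (1 / 2 ^ m)" by (intro mult_right_mono) auto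
    then show "integrable lborel (indicat_real {real k * (1 / 2 ^ m)..<real (Suc k) * (1 / 2 ^ m)})"
      by (intro integrable_real_indicator) (simp_all only: emeasure_lborel_Ico ennreal_less_top infinity_ennreal_def sets_lborel atLeastLessThan_borel)
  qed
  also have "\<dots> = (\<Sum>k<m * 2 ^ m. (1 / 2 ^ m) * running \<rho> (1 / 2 ^ m) x k w)"
    by (intro sum.cong refl) (simp add: field_simps)
  finally show ?thesis .
qed

lemma step_measurable [measurable]: "step \<rho> x w m \<in> borel_measurable borel"
  unfolding step_def[abs_def] by measurable

text \<open>The grid time used lies within one mesh, hence within time 1, below s; replacing it by s
  in the discount costs the factor \<open>exp 1\<close>.\<close>

lemma step_le: "\<bar>step \<rho> x w m s\<bar> \<le> exp 1 * (3 * C * real DIM('a) + C) * exponential_density 1 s"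
proof (cases "0 \<le> s \<and> s < real m")
  case True
  define K where "K = nat \<lfloor>s * 2 ^ m\<rfloor>"
  have "s * 2 ^ m - 1 \<le> real K" unfolding K_def using True by linarith
  then have "(s * 2 ^ m - 1) / 2 ^ m \<le> real K / 2 ^ m" by (intro divide_right_mono) auto
  then have "s - 1 / 2 ^ m \<le> 1 / 2 ^ m * real K" by (simp add: diff_divide_distrib)
  moreover have "(1::real) / 2 ^ m \<le> 1" by simp
  ultimately have "s - 1 \<le> 1 / 2 ^ m * real K" by linarith
  then have e: "exp (- (1 / 2 ^ m) * real K) \<le> exp 1 * exp (- s)" by (simp flip: exp_add)
  have "\<bar>step \<rho> x w m s\<bar> \<le> exp (- (1 / 2 ^ m) * real K) * (3 * C * real DIM('a) + C)"
    using True running_le[of "1 / 2 ^ m" \<rho> x K w] unfolding step_eq K_def by simp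
  also have "\<dots> \<le> exp 1 * exp (- s) * (3 * C * real DIM('a) + C)"
    by (rule mult_right_mono[OF e drift_bound_nonneg])
  finally show ?thesis using True by (simp add: exponential_density_def mult_ac)
next
  case False
  then show ?thesis unfolding step_eq using drift_bound_nonneg by (auto simp: exponential_density_def)
qed

lemma avoids_imp_alive:
  assumes "avoids \<rho> x s w" "real k * (1 / 2 ^ m) \<le> s"
  shows "alive \<rho> (1 / 2 ^ m) x k w"
  unfolding alive_def
proof (intro allI impI)
  fix j assume "j \<le> k"
  then have "real j * (1 / 2 ^ m) \<le> real k * (1 / 2 ^ m)" by (intro mult_right_mono) auto
  then have "real j * (1 / 2 ^ m) \<le> s" using assms(2) by linarith
  then show "\<rho> \<le> norm (x + w (real j * (1 / 2 ^ m)))" using assms(1) by (auto simp: avoids_def)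
qed

text \<open>If the path avoids, every grid is alive up to s and continuity gives the limit. If not,
  an offending dyadic time belongs to all sufficiently fine grids, so the step function vanishes
  from some level on.\<close>

lemma step_tendsto:
  assumes w: "w \<in> space W"
  shows "(\<lambda>m. step \<rho> x w m s) \<longlonglongrightarrow>
    exponential_density 1 s * (if avoids \<rho> x s w then rad (x + w s) - gen (x + w s) else 0)"
proof (cases "0 \<le> s")
  case False
  then show ?thesis by (simp add: step_eq exponential_density_def)
next
  case s: True
  define k where "k m = nat \<lfloor>s * 2 ^ m\<rfloor>" for m :: nat
  have k: "real (k m) \<le> s * 2 ^ m" "s * 2 ^ m - 1 \<le> real (k m)" for m
    unfolding k_def using s by simp_all
  have k': "real (k m) * (1 / 2 ^ m) \<le> s" "s - 1 / 2 ^ m \<le> real (k m) * (1 / 2 ^ m)" for m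
    using divide_right_mono[OF k(1)[of m], of "2 ^ m"] divide_right_mono[OF k(2)[of m], of "2 ^ m"]
    by (simp_all add: diff_divide_distrib)
  have ev: "\<forall>\<^sub>F m in sequentially. step \<rho> x w m s = running \<rho> (1 / 2 ^ m) x (k m) w"
    using eventually_gt_at_top[of "nat \<lceil>s\<rceil>"]
  proof eventually_elim
    case (elim m)
    then have "s < real m" by linarith
    then show ?case using s by (simp add: step_eq k_def)
  qed
  have kl: "(\<lambda>m. real (k m) * (1 / 2 ^ m)) \<longlonglongrightarrow> s"
  proof (rule real_tendsto_sandwich)
    show "(\<lambda>m. s - 1 / 2 ^ m) \<longlonglongrightarrow> s" by real_asymp
  qed (use k' in auto)
  show ?thesis
  proof (cases "avoids \<rho> x s w")
    case True
    have "alive \<rho> (1 / 2 ^ m) x (k m) w" for m by (rule avoids_imp_alive[OF True k'(1)])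
    then have r: "running \<rho> (1 / 2 ^ m) x (k m) w
        = exp (- (real (k m) * (1 / 2 ^ m))) * drift (1 / 2 ^ m) (x + w (real (k m) * (1 / 2 ^ m)))" for m
      by (simp add: running_def)
    have wl: "(\<lambda>m. w (real (k m) * (1 / 2 ^ m))) \<longlonglongrightarrow> w s"
      by (rule continuous_on_tendsto_compose[OF space_W(1)[OF w] kl]) (use s in auto)
    have "(\<lambda>m. drift (1 / 2 ^ m) (x + w (real (k m) * (1 / 2 ^ m)))) \<longlonglongrightarrow> rad (x + w s) - gen (x + w s)"
    proof (rule drift_tendsto)
      show "(\<lambda>m. 1 / 2 ^ m :: real) \<longlonglongrightarrow> 0" by real_asymp
    qed (use tendsto_add[OF tendsto_const wl] in auto)
    then have "(\<lambda>m. running \<rho> (1 / 2 ^ m) x (k m) w) \<longlonglongrightarrow> exp (- s) * (rad (x + w s) - gen (x + w s))"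
      unfolding r by (intro tendsto_intros kl)
    then have "(\<lambda>m. step \<rho> x w m s) \<longlonglongrightarrow> exp (- s) * (rad (x + w s) - gen (x + w s))"
      using tendsto_cong[OF ev] by blast
    then show ?thesis using True s by (simp add: exponential_density_def)
  next
    case False
    then obtain m0 j0 where bad: "real j0 * (1 / 2 ^ m0) \<le> s" "norm (x + w (real j0 * (1 / 2 ^ m0))) < \<rho>"
      by (auto simp: avoids_def not_le)
    have "\<forall>\<^sub>F m in sequentially. step \<rho> x w m s = 0"
      using ev eventually_ge_at_top[of m0]
    proof eventually_elim
      case (elim m)
      have p: "(2::real) ^ m = 2 ^ (m - m0) * 2 ^ m0" using elim(2) by (simp flip: power_add)
      have eq: "real (j0 * 2 ^ (m - m0)) * (1 / 2 ^ m) = real j0 * (1 / 2 ^ m0)" by (simp add: p)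
      have "real (j0 * 2 ^ (m - m0)) \<le> s * 2 ^ m"
        using bad(1) unfolding eq[symmetric] by (simp add: field_simps)
      then have "int (j0 * 2 ^ (m - m0)) \<le> \<lfloor>s * 2 ^ m\<rfloor>" by (simp add: le_floor_iff)
      then have "j0 * 2 ^ (m - m0) \<le> k m" unfolding k_def by linarith
      then have "\<not> alive \<rho> (1 / 2 ^ m) x (k m) w"
        using bad(2) unfolding alive_def eq[symmetric] by (auto simp: not_le)
      then show ?case using elim(1) by (simp add: running_def)
    qed
    then show ?thesis using False tendsto_cong by fastforce
  qed
qed

lemma integrable_exponential_density: "integrable lborel (exponential_density 1)"
proof -
  interpret E: prob_space "density lborel (exponential_density 1)"
    by (rule prob_space_exponential_density) simp
  have "integrable (density lborel (exponential_density 1)) (\<lambda>_. 1 :: real)" by simp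
  then show ?thesis by (subst (asm) integrable_density) (auto simp: exponential_density_nonneg)
qed


lemma integrable_step_bound:
  "integrable lborel (\<lambda>s. exp 1 * (3 * C * real DIM('a) + C) * exponential_density 1 s)"
  by (intro integrable_mult_right integrable_exponential_density)

definition payoff :: "real \<Rightarrow> 'a \<Rightarrow> (real \<Rightarrow> 'a) \<Rightarrow> real" where
  "payoff \<rho> x w = (\<integral>s. exponential_density 1 s * (if avoids \<rho> x s w then rad (x + w s) - gen (x + w s) else 0) \<partial>lborel)"

lemma payoff_tendsto:
  assumes w: "w \<in> space W"
  shows "(\<lambda>m. \<integral>s. step \<rho> x w m s \<partial>lborel) \<longlonglongrightarrow> payoff \<rho> x w"
  unfolding payoff_def
proof (rule integral_dominated_convergence[OF _ _ integrable_step_bound])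
  show "(\<lambda>s. exponential_density 1 s * (if avoids \<rho> x s w then rad (x + w s) - gen (x + w s) else 0)) \<in> borel_measurable lborel"
    by (rule borel_measurable_LIMSEQ_real[OF step_tendsto[OF w]]) simp
qed (use step_tendsto[OF w] step_le in auto)

lemma running_cost_measurable [measurable]: "(\<lambda>w. \<integral>s. step \<rho> x w m s \<partial>lborel) \<in> borel_measurable W"
  unfolding integral_step by measurable

lemma running_cost_le: "\<bar>\<integral>s. step \<rho> x w m s \<partial>lborel\<bar> \<le> exp 1 * (3 * C * real DIM('a) + C)"
proof -
  interpret E: prob_space "density lborel (exponential_density 1)"
    by (rule prob_space_exponential_density) simp
  have "(\<integral>s. exponential_density 1 s \<partial>lborel) = (\<integral>s. 1 \<partial>density lborel (exponential_density 1))"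
    by (subst integral_density) (auto simp: exponential_density_nonneg)
  then have e: "(\<integral>s. exponential_density 1 s \<partial>lborel) = 1" by (simp add: E.prob_space[simplified])
  have i: "integrable lborel (step \<rho> x w m)"
    by (rule Bochner_Integration.integrable_bound[OF integrable_step_bound])
       (auto intro!: AE_I2 order_trans[OF step_le abs_ge_self])
  have "\<bar>\<integral>s. step \<rho> x w m s \<partial>lborel\<bar> \<le> (\<integral>s. \<bar>step \<rho> x w m s\<bar> \<partial>lborel)" by (rule integral_abs_bound)
  also have "\<dots> \<le> (\<integral>s. exp 1 * (3 * C * real DIM('a) + C) * exponential_density 1 s \<partial>lborel)"
    by (intro Bochner_Integration.integral_mono integrable_abs i integrable_step_bound step_le)
  finally show ?thesis by (simp add: e)
qed

lemma payoff_measurable [measurable]: "payoff \<rho> x \<in> borel_measurable W"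
  by (rule borel_measurable_LIMSEQ_real[OF payoff_tendsto running_cost_measurable])

lemma payoff_le: "w \<in> space W \<Longrightarrow> \<bar>payoff \<rho> x w\<bar> \<le> exp 1 * (3 * C * real DIM('a) + C)"
  by (rule LIMSEQ_le_const2[OF tendsto_rabs[OF payoff_tendsto]]) (auto intro: running_cost_le)

text \<open>By \<open>discrete_dynkin\<close> the discrepancy at level m is the mean stopped value,
  which is eventually bounded path by path by the boundary value of h.\<close>

lemma dynkin_approx:
  assumes \<rho>: "\<rho> \<le> norm x"
  shows "\<bar>rad x - (\<integral>w. payoff \<rho> x w \<partial>W)\<bar> \<le> \<bar>h (\<rho>\<^sup>2)\<bar>"
proof -
  let ?V = "\<bar>h (\<rho>\<^sup>2)\<bar>"
  let ?S = "\<lambda>m w. stopped \<rho> (1 / 2 ^ m) x w (m * 2 ^ m)"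
  let ?I = "\<lambda>m w. \<integral>s. step \<rho> x w m s \<partial>lborel"
  \<comment> \<open>Only an eventual upper bound for the stopped values is available, not a limit,
    so their excess over the bound is shown to vanish in mean.\<close>
  define T where "T m w = max 0 (\<bar>?S m w\<bar> - ?V)" for m w
  have S_le: "\<bar>?S m w\<bar> \<le> C" for m w by (rule stopped_le) simp
  have [measurable]: "T m \<in> borel_measurable W" for m unfolding T_def by measurable
  have T_le: "\<bar>T m w\<bar> \<le> C" for m w using S_le[of m w] C_nonneg by (simp add: T_def)
  have T0: "(\<lambda>m. T m w) \<longlonglongrightarrow> 0" if w: "w \<in> space W" for w
  proof (rule tendstoI)
    fix \<epsilon> :: real assume e: "\<epsilon> > 0"
    show "\<forall>\<^sub>F m in sequentially. dist (T m w) 0 < \<epsilon>"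
      using eventually_stopped_le[OF w \<rho>, of "\<epsilon> / 2"] e
      by (auto simp: T_def dist_real_def elim!: eventually_mono)
  qed
  have "(\<lambda>m. \<integral>w. T m w \<partial>W) \<longlonglongrightarrow> (\<integral>w. 0 \<partial>W)"
    by (rule integral_dominated_convergence[where w = "\<lambda>_. C"]) (use T0 T_le in auto)
  then have lT: "(\<lambda>m. ?V + (\<integral>w. T m w \<partial>W)) \<longlonglongrightarrow> ?V + 0" by (intro tendsto_intros) simp
  have "(\<lambda>m. \<integral>w. ?I m w \<partial>W) \<longlonglongrightarrow> (\<integral>w. payoff \<rho> x w \<partial>W)"
    by (rule integral_dominated_convergence[where w = "\<lambda>_. exp 1 * (3 * C * real DIM('a) + C)"])
       (use payoff_tendsto running_cost_le in auto)
  then have lI: "(\<lambda>m. \<bar>rad x - (\<integral>w. ?I m w \<partial>W)\<bar>) \<longlonglongrightarrow> \<bar>rad x - (\<integral>w. payoff \<rho> x w \<partial>W)\<bar>"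
    by (intro tendsto_intros)
  have "\<bar>rad x - (\<integral>w. ?I m w \<partial>W)\<bar> \<le> ?V + (\<integral>w. T m w \<partial>W)" for m
  proof -
    have si: "integrable W (?S m)" by (rule integrable_const_bound[where B = C]) (use S_le in auto)
    have Ti: "integrable W (T m)" by (rule integrable_const_bound[where B = C]) (use T_le in auto)
    have "rad x - (\<integral>w. ?I m w \<partial>W) = (\<integral>w. ?S m w \<partial>W)"
      using discrete_dynkin[of "1 / 2 ^ m" x \<rho> "m * 2 ^ m"] unfolding integral_step by simp
    moreover have "\<bar>\<integral>w. ?S m w \<partial>W\<bar> \<le> (\<integral>w. \<bar>?S m w\<bar> \<partial>W)" by (rule integral_abs_bound)
    moreover have "\<dots> \<le> (\<integral>w. ?V + T m w \<partial>W)"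
      by (intro Bochner_Integration.integral_mono integrable_abs si Bochner_Integration.integrable_add Ti) (auto simp: T_def)
    moreover have "\<dots> = ?V + (\<integral>w. T m w \<partial>W)" using Ti by (simp add: prob_space)
    ultimately show ?thesis by linarith
  qed
  then show ?thesis using LIMSEQ_le[OF lI lT] by auto
qed

text \<open>A hit may happen at a time that is not dyadic, but dyadic times just before it see norms
  close to at most 1. The strict margin \<open>\<rho> > 1\<close> turns this into a violation, and
  approaching from below keeps these times before s.\<close>

lemma not_avoids:
  assumes w: "w \<in> space W" and x: "norm x > 1" and \<rho>: "\<rho> > 1"
    and r: "0 \<le> r" "r \<le> s" "norm (x + w r) \<le> 1"
  shows "\<not> avoids \<rho> x s w"
proof
  assume a: "avoids \<rho> x s w"
  define q where "q m = real (nat \<lfloor>r * 2 ^ m\<rfloor>) * (1 / 2 ^ m)" for m :: nat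
  have k: "real (nat \<lfloor>r * 2 ^ m\<rfloor>) \<le> r * 2 ^ m" "r * 2 ^ m - 1 \<le> real (nat \<lfloor>r * 2 ^ m\<rfloor>)" for m :: nat
    using r(1) by simp_all
  have q: "q m \<le> r" "r - 1 / 2 ^ m \<le> q m" for m
    using divide_right_mono[OF k(1)[of m], of "2 ^ m"] divide_right_mono[OF k(2)[of m], of "2 ^ m"]
    by (simp_all add: diff_divide_distrib q_def)
  have "q \<longlonglongrightarrow> r"
  proof (rule real_tendsto_sandwich)
    show "(\<lambda>m. r - 1 / 2 ^ m) \<longlonglongrightarrow> r" by real_asymp
  qed (use q in auto)
  then have "(\<lambda>m. w (q m)) \<longlonglongrightarrow> w r"
    by (rule continuous_on_tendsto_compose[OF space_W(1)[OF w]]) (use r in \<open>auto simp: q_def\<close>)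
  then have "(\<lambda>m. norm (x + w (q m))) \<longlonglongrightarrow> norm (x + w r)" by (intro tendsto_intros)
  moreover have "\<rho> \<le> norm (x + w (q m))" for m
    using a q(1)[of m] r(2) unfolding avoids_def q_def by (meson order_trans)
  ultimately have "\<rho> \<le> norm (x + w r)" by (intro LIMSEQ_le_const) auto
  then show False using r \<rho> by simp
qed

text \<open>On a compact time interval a path that never hits keeps a positive distance from the
  ball, which exceeds 1 / (j + 1) for large j.\<close>

lemma eventually_avoids:
  assumes w: "w \<in> space W" and s: "0 \<le> s" and n: "\<And>r. r \<in> {0..s} \<Longrightarrow> norm (x + w r) > 1"
  shows "\<forall>\<^sub>F j in sequentially. avoids (1 + 1 / real (Suc j)) x s w"
proof -
  have "continuous_on {0..s} (\<lambda>r. norm (x + w r))"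
    by (intro continuous_intros continuous_on_subset[OF space_W(1)[OF w]]) auto
  then obtain t where t: "t \<in> {0..s}" "\<And>r. r \<in> {0..s} \<Longrightarrow> norm (x + w t) \<le> norm (x + w r)"
    using continuous_attains_inf[of "{0..s}" "\<lambda>r. norm (x + w r)"] s by auto
  have "(\<lambda>j. 1 + 1 / real (Suc j)) \<longlonglongrightarrow> 1" by real_asymp
  then have "\<forall>\<^sub>F j in sequentially. 1 + 1 / real (Suc j) < norm (x + w t)"
    using n[OF t(1)] by (rule order_tendstoD)
  then show ?thesis
  proof eventually_elim
    case (elim j)
    show ?case unfolding avoids_def
    proof (intro allI impI)
      fix m k assume "real k * (1 / 2 ^ m) \<le> s"
      then have "norm (x + w t) \<le> norm (x + w (real k * (1 / 2 ^ m)))" by (intro t) auto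
      then show "1 + 1 / real (Suc j) \<le> norm (x + w (real k * (1 / 2 ^ m)))" using elim by linarith
    qed
  qed
qed

text \<open>Let the killing radius decrease to 1: the dyadic avoidance conditions converge to not
  hitting the unit ball, and the error \<open>h (\<rho>^2)\<close> tends to h(1) = 0.\<close>

theorem dynkin:
  assumes x: "norm x > 1" and h1_0: "h 1 = 0"
  shows "rad x = (\<integral>w. (\<integral>s. exponential_density 1 s *
    (if \<exists>r\<in>{0..s}. norm (x + w r) \<le> 1 then 0 else rad (x + w s) - gen (x + w s)) \<partial>lborel) \<partial>W)"
proof -
  define \<rho> where "\<rho> j = 1 + 1 / real (Suc j)" for j
  have rho: "\<rho> j > 1" for j by (simp add: \<rho>_def)
  have rl: "\<rho> \<longlonglongrightarrow> 1" unfolding \<rho>_def by real_asymp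
  let ?F = "\<lambda>y. rad y - gen y"
  let ?K = "C + (2 + real DIM('a)) * C"
  have F: "\<bar>?F y\<bar> \<le> ?K" for y :: 'a using rad_le[of y] gen_le[of y] by linarith
  let ?f = "\<lambda>j w s. exponential_density 1 s * (if avoids (\<rho> j) x s w then ?F (x + w s) else 0)"
  let ?g = "\<lambda>w s. exponential_density 1 s * (if \<exists>r\<in>{0..s}. norm (x + w r) \<le> 1 then 0 else ?F (x + w s))"
  have ptw: "(\<lambda>j. ?f j w s) \<longlonglongrightarrow> ?g w s" if w: "w \<in> space W" for w s
  proof (cases "s < 0")
    case True
    then show ?thesis by (simp add: exponential_density_def)
  next
    case False
    show ?thesis
    proof (cases "\<exists>r\<in>{0..s}. norm (x + w r) \<le> 1")
      case True
      then have "\<not> avoids (\<rho> j) x s w" for j using not_avoids[OF w x rho] by auto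
      then show ?thesis using True by simp
    next
      case nh: False
      then have "\<forall>\<^sub>F j in sequentially. avoids (\<rho> j) x s w"
        unfolding \<rho>_def using False by (intro eventually_avoids[OF w]) (auto simp: not_le)
      then have "\<forall>\<^sub>F j in sequentially. ?f j w s = ?g w s"
        by eventually_elim (use nh in simp)
      then show ?thesis by (rule tendsto_eventually)
    qed
  qed
  have fm: "?f j w \<in> borel_measurable lborel" if w: "w \<in> space W" for j w
    by (rule borel_measurable_LIMSEQ_real[OF step_tendsto[OF w]]) simp
  have K: "0 \<le> ?K" using C_nonneg by simp
  have pl: "(\<lambda>j. payoff (\<rho> j) x w) \<longlonglongrightarrow> (\<integral>s. ?g w s \<partial>lborel)" if w: "w \<in> space W" for w
    unfolding payoff_def
  proof (rule integral_dominated_convergence[where w = "\<lambda>s. exponential_density 1 s * ?K"])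
    show "?f j w \<in> borel_measurable lborel" for j by (rule fm[OF w])
    show "?g w \<in> borel_measurable lborel"
      by (rule borel_measurable_LIMSEQ_real[OF ptw[OF w] fm[OF w]])
    show "integrable lborel (\<lambda>s. exponential_density 1 s * ?K)"
      by (intro integrable_mult_left integrable_exponential_density)
    show "AE s in lborel. norm (?f j w s) \<le> exponential_density 1 s * ?K" for j
      using F K by (intro AE_I2) (auto simp: abs_mult exponential_density_nonneg intro!: mult_left_mono)
  qed (use ptw[OF w] in auto)
  have "(\<lambda>j. \<integral>w. payoff (\<rho> j) x w \<partial>W) \<longlonglongrightarrow> (\<integral>w. (\<integral>s. ?g w s \<partial>lborel) \<partial>W)"
  proof (rule integral_dominated_convergence[where w = "\<lambda>_. exp 1 * (3 * C * real DIM('a) + C)"])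
    show "(\<lambda>w. \<integral>s. ?g w s \<partial>lborel) \<in> borel_measurable W"
      by (rule borel_measurable_LIMSEQ_real[OF pl payoff_measurable])
  qed (use pl payoff_le in auto)
  then have lp: "(\<lambda>j. \<bar>rad x - (\<integral>w. payoff (\<rho> j) x w \<partial>W)\<bar>) \<longlonglongrightarrow> \<bar>rad x - (\<integral>w. (\<integral>s. ?g w s \<partial>lborel) \<partial>W)\<bar>"
    by (intro tendsto_intros)
  have lh: "(\<lambda>j. \<bar>h ((\<rho> j)\<^sup>2)\<bar>) \<longlonglongrightarrow> \<bar>h (1\<^sup>2)\<bar>"
    by (intro tendsto_intros isCont_tendsto_compose[OF DERIV_isCont[OF h]] rl)
  have "\<forall>\<^sub>F j in sequentially. \<rho> j < norm x" using rl x by (rule order_tendstoD)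
  then have "\<forall>\<^sub>F j in sequentially. \<bar>rad x - (\<integral>w. payoff (\<rho> j) x w \<partial>W)\<bar> \<le> \<bar>h ((\<rho> j)\<^sup>2)\<bar>"
    by eventually_elim (intro dynkin_approx, simp)
  from tendsto_le[OF sequentially_bot lh lp this]
  have "\<bar>rad x - (\<integral>w. (\<integral>s. ?g w s \<partial>lborel) \<partial>W)\<bar> \<le> \<bar>h (1\<^sup>2)\<bar>" .
  then show ?thesis using h1_0 by simp
qed

end

section \<open>The branching property\<close>

text \<open>Builds the marks of a tree from the mark of the root and those of its two subtrees. A
  label has its parent as tail, so the child of the root through which it descends is its last
  letter.\<close>

definition graft :: "'m \<times> (label \<Rightarrow> 'm) \<times> (label \<Rightarrow> 'm) \<Rightarrow> label \<Rightarrow> 'm" where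
  "graft p u = (if u = [] then fst p else if last u then snd (snd p) (butlast u) else fst (snd p) (butlast u))"

lemma graft_simps [simp]:
  "graft (m, \<omega>\<^sub>0, \<omega>\<^sub>1) [] = m"
  "graft (m, \<omega>\<^sub>0, \<omega>\<^sub>1) (v @ [b]) = (if b then \<omega>\<^sub>1 v else \<omega>\<^sub>0 v)"
  by (auto simp: graft_def)

lemma graft_measurable [measurable]:
  "graft \<in> M \<Otimes>\<^sub>M (Pi\<^sub>M UNIV (\<lambda>_. M) \<Otimes>\<^sub>M Pi\<^sub>M UNIV (\<lambda>_. M)) \<rightarrow>\<^sub>M Pi\<^sub>M UNIV (\<lambda>_. M)"
proof (rule measurable_PiM_single')
  show "(\<lambda>p. graft p u) \<in> M \<Otimes>\<^sub>M (Pi\<^sub>M UNIV (\<lambda>_. M) \<Otimes>\<^sub>M Pi\<^sub>M UNIV (\<lambda>_. M)) \<rightarrow>\<^sub>M M" for u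
    unfolding graft_def by measurable
  show "graft \<in> space (M \<Otimes>\<^sub>M (Pi\<^sub>M UNIV (\<lambda>_. M) \<Otimes>\<^sub>M Pi\<^sub>M UNIV (\<lambda>_. M))) \<rightarrow> (\<Pi>\<^sub>E i\<in>UNIV. space M)"
    by (auto simp: graft_def space_pair_measure space_PiM PiE_iff)
qed

text \<open>The branching property in terms of laws: a root mark and two independent copies of the
  whole family, relabelled, form the family again. Both sides are compared on finite cylinders,
  which factor into a root part and one part for each subtree.\<close>

lemma distr_graft:
  assumes M: "prob_space M"
  shows "distr (M \<Otimes>\<^sub>M (Pi\<^sub>M UNIV (\<lambda>_. M) \<Otimes>\<^sub>M Pi\<^sub>M UNIV (\<lambda>_. M))) (Pi\<^sub>M UNIV (\<lambda>_::label. M)) graft = Pi\<^sub>M UNIV (\<lambda>_. M)"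
    (is "distr ?P ?B graft = _")
proof -
  interpret M: prob_space M by fact
  interpret B: product_prob_space "\<lambda>_::label. M" UNIV by standard
  interpret BB: pair_prob_space ?B ?B ..
  interpret MBB: pair_prob_space M "?B \<Otimes>\<^sub>M ?B" ..
  show ?thesis
  proof (rule measure_eqI_PiM_infinite)
    fix A :: "label \<Rightarrow> _" and J :: "label set"
    assume J: "finite J" and AM: "\<And>i. i \<in> J \<Longrightarrow> A i \<in> sets M"
    \<comment> \<open>Padding with the full space lets the finite index set grow to one that is
      visibly a root plus two relabelled finite sets.\<close>
    define A' where "A' u = (if u \<in> J then A u else space M)" for u
    have A'[measurable]: "A' u \<in> sets M" for u using AM by (simp add: A'_def)
    define J' where "J' b = (\<lambda>v. v @ [b]) -` J" for b :: bool
    have inj: "inj_on (\<lambda>v. v @ [b]) S" for b :: bool and S by (auto simp: inj_on_def)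
    have J': "finite (J' b)" for b unfolding J'_def by (rule finite_vimageI[OF J inj])
    define JJ where "JJ = insert [] ((\<lambda>v. v @ [False]) ` J' False \<union> (\<lambda>v. v @ [True]) ` J' True)"
    have JJ: "J \<subseteq> JJ"
    proof
      fix u assume "u \<in> J"
      then show "u \<in> JJ" by (cases u rule: rev_cases; cases "last u") (auto simp: JJ_def J'_def)
    qed
    have fJJ: "finite JJ" unfolding JJ_def using J' by auto
    have emb: "prod_emb UNIV (\<lambda>_. M) J (Pi\<^sub>E J A) = {\<omega> \<in> space ?B. \<forall>i\<in>JJ. \<omega> i \<in> A' i}"
      using subsetD[OF JJ] by (auto simp: prod_emb_def space_PiM A'_def PiE_iff split: if_splits)
    have R: "emeasure ?B {\<omega> \<in> space ?B. \<forall>i\<in>JJ. \<omega> i \<in> A' i} = (\<Prod>i\<in>JJ. emeasure M (A' i))"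
      by (rule B.emeasure_PiM_Collect) (auto simp: fJJ)
    define S where "S b = {\<omega> \<in> space ?B. \<forall>v\<in>J' b. \<omega> v \<in> A' (v @ [b])}" for b
    have S: "emeasure ?B (S b) = (\<Prod>v\<in>J' b. emeasure M (A' (v @ [b])))" for b
      unfolding S_def by (rule B.emeasure_PiM_Collect) (auto simp: J')
    have S_sets[measurable]: "S b \<in> sets ?B" for b
      unfolding S_def using J'[of b] by measurable
    have "emeasure (distr ?P ?B graft) {\<omega> \<in> space ?B. \<forall>i\<in>JJ. \<omega> i \<in> A' i}
        = emeasure ?P (graft -` {\<omega> \<in> space ?B. \<forall>i\<in>JJ. \<omega> i \<in> A' i} \<inter> space ?P)"
    proof (rule emeasure_distr)
      show "{\<omega> \<in> space ?B. \<forall>i\<in>JJ. \<omega> i \<in> A' i} \<in> sets ?B" using fJJ by measurable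
    qed simp
    also have "graft -` {\<omega> \<in> space ?B. \<forall>i\<in>JJ. \<omega> i \<in> A' i} \<inter> space ?P = A' [] \<times> (S False \<times> S True)"
    proof -
      have gs: "graft p \<in> space ?B" if "p \<in> space ?P" for p using measurable_space[OF graft_measurable that] .
      have "A' [] \<subseteq> space M" using sets.sets_into_space[OF A'] by blast
      then show ?thesis
        using gs by (auto simp: JJ_def S_def space_pair_measure ball_Un)
    qed
    also have "emeasure ?P (A' [] \<times> (S False \<times> S True)) = emeasure M (A' []) * (emeasure ?B (S False) * emeasure ?B (S True))"
    proof -
      have "sigma_finite_measure ?B" "sigma_finite_measure (?B \<Otimes>\<^sub>M ?B)"
        by (intro prob_space_imp_sigma_finite B.prob_space_axioms BB.prob_space_axioms)+
      note Times = this[THEN sigma_finite_measure.emeasure_pair_measure_Times]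
      show ?thesis by (simp add: Times)
    qed
    also have "\<dots> = (\<Prod>i\<in>JJ. emeasure M (A' i))"
    proof -
      have "(\<Prod>i\<in>JJ. emeasure M (A' i)) = emeasure M (A' []) *
          (\<Prod>i\<in>(\<lambda>v. v @ [False]) ` J' False \<union> (\<lambda>v. v @ [True]) ` J' True. emeasure M (A' i))"
        unfolding JJ_def by (subst prod.insert) (auto simp: J')
      also have "(\<Prod>i\<in>(\<lambda>v. v @ [False]) ` J' False \<union> (\<lambda>v. v @ [True]) ` J' True. emeasure M (A' i)) =
          (\<Prod>i\<in>(\<lambda>v. v @ [False]) ` J' False. emeasure M (A' i)) * (\<Prod>i\<in>(\<lambda>v. v @ [True]) ` J' True. emeasure M (A' i))"
        by (subst prod.union_disjoint) (auto simp: J')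
      finally show ?thesis by (simp add: prod.reindex[OF inj] S)
    qed
    finally show "emeasure (distr ?P ?B graft) (prod_emb UNIV (\<lambda>_. M) J (Pi\<^sub>E J A)) =
        emeasure ?B (prod_emb UNIV (\<lambda>_. M) J (Pi\<^sub>E J A))"
      unfolding emb R .
  next
    have "prob_space (distr ?P ?B graft)" by (rule MBB.prob_space_distr) simp
    then show "finite_measure (distr ?P ?B graft)" by (rule prob_space.finite_measure)
  qed simp_all
qed

section \<open>Decomposition at the first branching time\<close>

definition lifetime_law :: "real measure" where
  "lifetime_law = density lborel (\<lambda>s. ennreal (exponential_density 1 s))"

lemma prob_space_lifetime_law: "prob_space lifetime_law"
  unfolding lifetime_law_def by (rule prob_space_exponential_density) simp

lemma sets_lifetime_law [measurable_cong, simp]: "sets lifetime_law = sets borel"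
  by (simp add: lifetime_law_def)

lemma space_lifetime_law [simp]: "space lifetime_law = UNIV"
  by (simp add: lifetime_law_def)

lemma integral_lifetime_law:
  fixes f :: "real \<Rightarrow> real"
  assumes [measurable]: "f \<in> borel_measurable borel"
  shows "(\<integral>s. f s \<partial>lifetime_law) = (\<integral>s. exponential_density 1 s * f s \<partial>lborel)"
  unfolding lifetime_law_def by (subst integral_density) (auto simp: exponential_density_nonneg)

lemma AE_lifetime_law_pos: "AE s in lifetime_law. s > 0"
proof -
  have "AE s in lborel. s \<noteq> (0::real)" by (rule AE_lborel_singleton)
  then have "AE s in lborel. 0 < ennreal (exponential_density 1 s) \<longrightarrow> s > 0"
    by eventually_elim (auto simp: exponential_density_def)
  then show ?thesis unfolding lifetime_law_def by (subst AE_density) auto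
qed

text \<open>A recursive-friendly stand-in for the existence of a pioneer: every particle is looked
  at on the closed age interval including its birth, so that both subtrees have the same form as the
  whole.\<close>

definition hits :: "'a::euclidean_space \<Rightarrow> 'a marks \<Rightarrow> bool" where
  "hits x \<omega> \<longleftrightarrow> (\<exists>u. born \<omega> u \<and> (\<exists>s\<in>{0..lifetime \<omega> u}. norm (birthplace x \<omega> u + displacement \<omega> u s) \<le> 1))"

lemma graft_subtree:
  "born (graft (m, \<omega>\<^sub>0, \<omega>\<^sub>1)) (v @ [b]) \<longleftrightarrow> snd (snd m) \<and> born (if b then \<omega>\<^sub>1 else \<omega>\<^sub>0) v"
  "birthplace x (graft (m, \<omega>\<^sub>0, \<omega>\<^sub>1)) (v @ [b]) = birthplace (x + fst m (fst (snd m))) (if b then \<omega>\<^sub>1 else \<omega>\<^sub>0) v"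
  by (induction v) (auto simp: splits_def displacement_def lifetime_def)

text \<open>A label is empty, or belongs to one of the two subtrees according to its last letter; a
  subtree starts where the root dies.\<close>

lemma hits_graft:
  "hits x (graft (m, \<omega>\<^sub>0, \<omega>\<^sub>1)) \<longleftrightarrow> (\<exists>s\<in>{0..fst (snd m)}. norm (x + fst m s) \<le> 1) \<or>
     (snd (snd m) \<and> (hits (x + fst m (fst (snd m))) \<omega>\<^sub>0 \<or> hits (x + fst m (fst (snd m))) \<omega>\<^sub>1))"
proof -
  have split: "(\<exists>u. P u) \<longleftrightarrow> P [] \<or> (\<exists>v. P (v @ [False])) \<or> (\<exists>v. P (v @ [True]))" for P :: "label \<Rightarrow> bool"
    by (metis (full_types) rev_exhaust)
  show ?thesis
    unfolding hits_def by (subst split) (auto simp: graft_subtree displacement_def lifetime_def)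
qed

context wiener
begin

definition mark :: "((real \<Rightarrow> 'a) \<times> real \<times> bool) measure" where
  "mark = W \<Otimes>\<^sub>M (lifetime_law \<Otimes>\<^sub>M measure_pmf (bernoulli_pmf (1/2)))"

lemma bbm_eq: "bbm W = Pi\<^sub>M UNIV (\<lambda>_. mark)"
  by (simp add: bbm_def mark_def lifetime_law_def)

lemma prob_space_mark: "prob_space mark"
proof -
  interpret L: prob_space lifetime_law by (rule prob_space_lifetime_law)
  interpret LB: pair_prob_space lifetime_law "measure_pmf (bernoulli_pmf (1/2))" ..
  interpret WLB: pair_prob_space W "lifetime_law \<Otimes>\<^sub>M measure_pmf (bernoulli_pmf (1/2))" ..
  show ?thesis unfolding mark_def by (rule WLB.prob_space_axioms)
qed

lemma prob_space_bbm: "prob_space (bbm W)"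
  unfolding bbm_eq by (rule prob_space_PiM[OF prob_space_mark])

lemma component_measurable [measurable]: "(\<lambda>\<omega>. \<omega> u) \<in> bbm W \<rightarrow>\<^sub>M mark"
  unfolding bbm_eq by (rule measurable_component_singleton) simp

lemma mark_measurable [measurable]:
  "fst \<in> mark \<rightarrow>\<^sub>M W" "(\<lambda>m. fst (snd m)) \<in> mark \<rightarrow>\<^sub>M borel" "Measurable.pred mark (\<lambda>m. snd (snd m))"
proof -
  show "fst \<in> mark \<rightarrow>\<^sub>M W" unfolding mark_def by simp
  have "(\<lambda>m. fst (snd m)) \<in> mark \<rightarrow>\<^sub>M lifetime_law" unfolding mark_def by simp
  then show "(\<lambda>m. fst (snd m)) \<in> mark \<rightarrow>\<^sub>M borel" by (simp cong: measurable_cong_sets)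
  have "(\<lambda>m. snd (snd m)) \<in> mark \<rightarrow>\<^sub>M measure_pmf (bernoulli_pmf (1/2))" unfolding mark_def by simp
  then show "Measurable.pred mark (\<lambda>m. snd (snd m))" by (simp cong: measurable_cong_sets)
qed

lemma displacement_measurable [measurable]: "(\<lambda>\<omega>. displacement \<omega> u) \<in> bbm W \<rightarrow>\<^sub>M W"
  unfolding displacement_def by measurable

lemma lifetime_measurable [measurable]: "(\<lambda>\<omega>. lifetime \<omega> u) \<in> bbm W \<rightarrow>\<^sub>M borel"
  unfolding lifetime_def by measurable

lemma splits_measurable [measurable]: "Measurable.pred (bbm W) (\<lambda>\<omega>. splits \<omega> u)"
  unfolding splits_def by measurable

lemma born_measurable [measurable]: "Measurable.pred (bbm W) (\<lambda>\<omega>. born \<omega> u)"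
proof (induction u)
  case (Cons b u)
  note [measurable] = Cons.IH
  show ?case unfolding born.simps by measurable
qed simp

lemma birthplace_measurable [measurable]: "(\<lambda>p. birthplace (fst p) (snd p) u) \<in> borel \<Otimes>\<^sub>M bbm W \<rightarrow>\<^sub>M borel"
proof (induction u)
  case (Cons b u)
  note [measurable] = Cons.IH
  show ?case unfolding birthplace.simps by measurable
qed simp

lemma hits_measurable [measurable]: "Measurable.pred (borel \<Otimes>\<^sub>M bbm W) (\<lambda>p. hits (fst p) (snd p))"
proof -
  have [measurable]: "Measurable.pred (borel \<Otimes>\<^sub>M bbm W)
      (\<lambda>p. \<exists>s\<in>{0..lifetime (snd p) u}. norm (birthplace (fst p) (snd p) u + displacement (snd p) u s) \<le> 1)" for u
    by (rule pred_exists_norm_le) measurable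
  show ?thesis unfolding hits_def by measurable
qed

definition survival :: "'a \<Rightarrow> real" where
  "survival x = (\<integral>\<omega>. of_bool (\<not> hits x \<omega>) \<partial>bbm W)"

lemma hits_measurable1 [measurable]: "Measurable.pred (bbm W) (hits x)"
  using measurable_compose[OF measurable_Pair1' hits_measurable, of x] by simp

lemma survival_measurable [measurable]: "survival \<in> borel_measurable borel"
proof -
  interpret bbm: prob_space "bbm W" by (rule prob_space_bbm)
  have "(\<lambda>p. of_bool (\<not> hits (fst p) (snd p)) :: real) \<in> borel_measurable (borel \<Otimes>\<^sub>M bbm W)" by measurable
  then show ?thesis
    unfolding survival_def by (intro bbm.borel_measurable_lebesgue_integral) (simp add: split_beta')
qed

lemma survival_bounds: "0 \<le> survival x" "survival x \<le> 1"
proof -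
  interpret bbm: prob_space "bbm W" by (rule prob_space_bbm)
  show "0 \<le> survival x" unfolding survival_def by simp
  have "survival x \<le> (\<integral>\<omega>. 1 \<partial>bbm W)"
    unfolding survival_def
    by (intro Bochner_Integration.integral_mono bbm.integrable_const_bound[where B = 1]) auto
  then show "survival x \<le> 1" by (simp add: bbm.prob_space)
qed

lemma prob_hits: "measure (bbm W) {\<omega> \<in> space (bbm W). hits x \<omega>} = 1 - survival x"
proof -
  interpret bbm: prob_space "bbm W" by (rule prob_space_bbm)
  have "survival x = (\<integral>\<omega>. indicator {\<omega> \<in> space (bbm W). \<not> hits x \<omega>} \<omega> \<partial>bbm W)"
    unfolding survival_def by (intro Bochner_Integration.integral_cong) (auto simp: indicator_def)
  also have "\<dots> = measure (bbm W) {\<omega> \<in> space (bbm W). \<not> hits x \<omega>}" by simp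
  also have "\<dots> = 1 - measure (bbm W) {\<omega> \<in> space (bbm W). hits x \<omega>}"
    by (rule bbm.prob_neg) measurable
  finally show ?thesis by simp
qed

text \<open>The mean of F at the place of death of one particle, on the event that it has not met
  the ball. For negative s the interval \<open>{0..s}\<close> is empty, so the guard is what makes
  the integrand vanish there.\<close>

definition killed :: "('a \<Rightarrow> real) \<Rightarrow> 'a \<Rightarrow> real" where
  "killed F x = (\<integral>w. (\<integral>s. (if 0 \<le> s \<and> \<not> (\<exists>r\<in>{0..s}. norm (x + w r) \<le> 1) then F (x + w s) else 0) \<partial>lifetime_law) \<partial>W)"

lemma pred_hit_measurable [measurable]:
  "Measurable.pred (W \<Otimes>\<^sub>M (borel :: real measure)) (\<lambda>p. \<exists>r\<in>{0..snd p}. norm (x + fst p r) \<le> 1)"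
  by (rule pred_exists_norm_le) measurable

lemma killed_pair:
  fixes F :: "'a \<Rightarrow> real" and x :: 'a
  assumes [measurable]: "F \<in> borel_measurable borel" and F: "\<And>y. \<bar>F y\<bar> \<le> B"
  defines "f \<equiv> \<lambda>p. if 0 \<le> snd p \<and> \<not> (\<exists>r\<in>{0..snd p}. norm (x + fst p r) \<le> 1) then F (x + fst p (snd p)) else 0"
  shows "killed F x = (\<integral>p. f p \<partial>(W \<Otimes>\<^sub>M lifetime_law))" "integrable (W \<Otimes>\<^sub>M lifetime_law) f"
proof -
  interpret L: prob_space lifetime_law by (rule prob_space_lifetime_law)
  interpret WL: pair_prob_space W lifetime_law ..
  have B: "0 \<le> B" using F[of 0] by linarith
  have fm[measurable]: "f \<in> borel_measurable (W \<Otimes>\<^sub>M lifetime_law)" unfolding f_def by measurable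
  show i: "integrable (W \<Otimes>\<^sub>M lifetime_law) f"
  proof (rule WL.integrable_const_bound[where B = B])
    show "AE p in W \<Otimes>\<^sub>M lifetime_law. norm (f p) \<le> B" using F B by (auto simp: f_def)
  qed (rule fm)
  show "killed F x = (\<integral>p. f p \<partial>(W \<Otimes>\<^sub>M lifetime_law))"
    unfolding WL.integral_fst'[OF i, symmetric] unfolding killed_def f_def fst_conv snd_conv ..
qed

text \<open>The operator integrates against a measure of mass at most 1. Only values outside the
  ball enter, since the time of death itself belongs to the interval on which hits are
  excluded.\<close>

lemma killed_diff_le:
  assumes m: "F \<in> borel_measurable borel" "G \<in> borel_measurable borel"
    and F: "\<And>y. \<bar>F y\<bar> \<le> B" and G: "\<And>y. \<bar>G y\<bar> \<le> B" and c: "0 \<le> c" "\<And>y. norm y > 1 \<Longrightarrow> \<bar>F y - G y\<bar> \<le> c"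
  shows "\<bar>killed F x - killed G x\<bar> \<le> c"
proof -
  interpret L: prob_space lifetime_law by (rule prob_space_lifetime_law)
  interpret WL: pair_prob_space W lifetime_law ..
  define f where "f F p = (if 0 \<le> snd p \<and> \<not> (\<exists>r\<in>{0..snd p}. norm (x + fst p r) \<le> 1) then F (x + fst p (snd p)) else 0)"
    for F :: "'a \<Rightarrow> real" and p :: "(real \<Rightarrow> 'a) \<times> real"
  have kF: "killed F x = (\<integral>p. f F p \<partial>(W \<Otimes>\<^sub>M lifetime_law))" "integrable (W \<Otimes>\<^sub>M lifetime_law) (f F)"
    unfolding f_def[abs_def] by (rule killed_pair[OF m(1) F])+
  have kG: "killed G x = (\<integral>p. f G p \<partial>(W \<Otimes>\<^sub>M lifetime_law))" "integrable (W \<Otimes>\<^sub>M lifetime_law) (f G)"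
    unfolding f_def[abs_def] by (rule killed_pair[OF m(2) G])+
  have "\<bar>f F p - f G p\<bar> \<le> c" for p
  proof (cases "0 \<le> snd p \<and> \<not> (\<exists>r\<in>{0..snd p}. norm (x + fst p r) \<le> 1)")
    case True
    then have "norm (x + fst p (snd p)) > 1" by (auto simp: not_le)
    then show ?thesis using True c(2) by (simp add: f_def)
  qed (auto simp: f_def c)
  then have "(\<integral>p. \<bar>f F p - f G p\<bar> \<partial>(W \<Otimes>\<^sub>M lifetime_law)) \<le> (\<integral>p. c \<partial>(W \<Otimes>\<^sub>M lifetime_law))"
    by (intro Bochner_Integration.integral_mono integrable_abs Bochner_Integration.integrable_diff kF kG) auto
  moreover have "\<bar>\<integral>p. f F p - f G p \<partial>(W \<Otimes>\<^sub>M lifetime_law)\<bar> \<le> (\<integral>p. \<bar>f F p - f G p\<bar> \<partial>(W \<Otimes>\<^sub>M lifetime_law))"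
    by (rule integral_abs_bound)
  ultimately show ?thesis unfolding kF kG by (simp add: kF kG WL.prob_space)
qed

text \<open>Given a root that does not hit, the coin gives no offspring with probability 1/2 and
  otherwise two independent subtrees that both have to survive, whence 1/2 + v^2 / 2.\<close>

lemma survival_branching: "survival x = killed (\<lambda>y. 1 / 2 + (survival y)\<^sup>2 / 2) x"
proof -
  define Z where "Z = measure_pmf (bernoulli_pmf (1/2))"
  interpret L: prob_space lifetime_law by (rule prob_space_lifetime_law)
  interpret Z: prob_space Z unfolding Z_def by (rule measure_pmf.prob_space_axioms)
  interpret LZ: pair_prob_space lifetime_law Z ..
  interpret WLZ: pair_prob_space W "lifetime_law \<Otimes>\<^sub>M Z" ..
  interpret M: prob_space mark by (rule prob_space_mark)
  interpret B: prob_space "bbm W" by (rule prob_space_bbm)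
  interpret BB: pair_prob_space "bbm W" "bbm W" ..
  interpret MBB: pair_prob_space mark "bbm W \<Otimes>\<^sub>M bbm W" ..
  have mark: "mark = W \<Otimes>\<^sub>M (lifetime_law \<Otimes>\<^sub>M Z)" by (simp add: mark_def Z_def)
  define hit where "hit m \<longleftrightarrow> (\<exists>s\<in>{0..fst (snd m)}. norm (x + fst m s) \<le> 1)" for m :: "(real \<Rightarrow> 'a) \<times> real \<times> bool"
  have hit_m[measurable]: "Measurable.pred mark hit"
    unfolding hit_def by (rule pred_exists_norm_le) measurable
  define X where "X m = x + fst m (fst (snd m))" for m :: "(real \<Rightarrow> 'a) \<times> real \<times> bool"
  have X_m[measurable]: "X \<in> mark \<rightarrow>\<^sub>M borel" unfolding X_def by measurable
  define g where "g m = (if hit m then 0 else if snd (snd m) then (survival (X m))\<^sup>2 else 1)" for m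
  have g_m[measurable]: "g \<in> borel_measurable mark" unfolding g_def by measurable
  have gm[measurable]: "graft \<in> mark \<Otimes>\<^sub>M (bbm W \<Otimes>\<^sub>M bbm W) \<rightarrow>\<^sub>M bbm W"
    unfolding bbm_eq by (rule graft_measurable)
  have g_le: "\<bar>g m\<bar> \<le> 1" for m using survival_bounds[of "X m"] by (simp add: g_def power_le_one)
  have "survival x = (\<integral>\<omega>. of_bool (\<not> hits x \<omega>) \<partial>distr (mark \<Otimes>\<^sub>M (bbm W \<Otimes>\<^sub>M bbm W)) (bbm W) graft)"
    unfolding survival_def bbm_eq distr_graft[OF prob_space_mark] ..
  also have "\<dots> = (\<integral>p. of_bool (\<not> hits x (graft p)) \<partial>(mark \<Otimes>\<^sub>M (bbm W \<Otimes>\<^sub>M bbm W)))"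
    by (rule integral_distr[OF gm]) measurable
  also have "\<dots> = (\<integral>m. (\<integral>q. of_bool (\<not> hits x (graft (m, q))) \<partial>(bbm W \<Otimes>\<^sub>M bbm W)) \<partial>mark)"
    by (rule MBB.integral_fst'[symmetric], rule MBB.integrable_const_bound[where B = 1]) (auto)
  also have "\<dots> = (\<integral>m. g m \<partial>mark)"
  proof (intro Bochner_Integration.integral_cong refl)
    fix m
    have pw: "of_bool (\<not> hits x (graft (m, q))) = (if hit m then 0 else if snd (snd m)
        then of_bool (\<not> hits (X m) (fst q)) * of_bool (\<not> hits (X m) (snd q)) else (1::real))" for q
      by (cases q) (auto simp: hits_graft hit_def X_def)
    have "(\<integral>q. of_bool (\<not> hits (X m) (fst q)) * of_bool (\<not> hits (X m) (snd q)) \<partial>(bbm W \<Otimes>\<^sub>M bbm W)) = (survival (X m))\<^sup>2"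
    proof -
      have i: "integrable (bbm W \<Otimes>\<^sub>M bbm W) (\<lambda>q. of_bool (\<not> hits (X m) (fst q)) * of_bool (\<not> hits (X m) (snd q)) :: real)"
        by (rule BB.integrable_const_bound[where B = 1]) auto
      show ?thesis
        unfolding BB.integral_fst'[OF i, symmetric] by (simp add: survival_def power2_eq_square)
    qed
    then show "(\<integral>q. of_bool (\<not> hits x (graft (m, q))) \<partial>(bbm W \<Otimes>\<^sub>M bbm W)) = g m"
      unfolding pw g_def by (simp add: BB.prob_space)
  qed
  also have "\<dots> = (\<integral>w. (\<integral>q. g (w, q) \<partial>(lifetime_law \<Otimes>\<^sub>M Z)) \<partial>W)"
    unfolding mark
    by (rule WLZ.integral_fst'[symmetric], rule WLZ.integrable_const_bound[where B = 1])
       (use g_le g_m in \<open>auto simp: mark\<close>)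
  also have "\<dots> = killed (\<lambda>y. 1 / 2 + (survival y)\<^sup>2 / 2) x"
    unfolding killed_def
  proof (intro Bochner_Integration.integral_cong refl)
    fix w assume w: "w \<in> space W"
    have gw[measurable]: "(\<lambda>q. g (w, q)) \<in> borel_measurable (lifetime_law \<Otimes>\<^sub>M Z)"
      using measurable_compose[OF measurable_Pair1'[OF w] g_m[unfolded mark]] .
    have "(\<integral>q. g (w, q) \<partial>(lifetime_law \<Otimes>\<^sub>M Z)) = (\<integral>s. (\<integral>c. g (w, s, c) \<partial>Z) \<partial>lifetime_law)"
      by (rule LZ.integral_fst'[symmetric], rule LZ.integrable_const_bound[where B = 1]) (use g_le in auto)
    also have "\<dots> = (\<integral>s. (if hit (w, s, True) then 0 else 1 / 2 + (survival (x + w s))\<^sup>2 / 2) \<partial>lifetime_law)"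
      unfolding Z_def by (intro Bochner_Integration.integral_cong) (auto simp: g_def hit_def X_def)
    also have "\<dots> = (\<integral>s. (if 0 \<le> s \<and> \<not> (\<exists>r\<in>{0..s}. norm (x + w r) \<le> 1) then 1 / 2 + (survival (x + w s))\<^sup>2 / 2 else 0) \<partial>lifetime_law)"
    \<comment> \<open>The integrands can differ only at negative ages, which have no mass.\<close>
    proof (rule integral_cong_AE)
      have [measurable]: "(\<lambda>s. w s) \<in> lifetime_law \<rightarrow>\<^sub>M borel" using w by measurable
      have ph: "Measurable.pred lifetime_law (\<lambda>s. \<exists>r\<in>{0..s}. norm (x + w r) \<le> 1)"
        using w by (intro pred_exists_norm_le) measurable
      note [measurable] = ph
      show "(\<lambda>s. if hit (w, s, True) then 0 else 1 / 2 + (survival (x + w s))\<^sup>2 / 2) \<in> borel_measurable lifetime_law"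
        unfolding hit_def fst_conv snd_conv by measurable
      show "(\<lambda>s. if 0 \<le> s \<and> \<not> (\<exists>r\<in>{0..s}. norm (x + w r) \<le> 1) then 1 / 2 + (survival (x + w s))\<^sup>2 / 2 else 0) \<in> borel_measurable lifetime_law"
        by measurable
      show "AE s in lifetime_law. (if hit (w, s, True) then 0 else 1 / 2 + (survival (x + w s))\<^sup>2 / 2) =
         (if 0 \<le> s \<and> \<not> (\<exists>r\<in>{0..s}. norm (x + w r) \<le> 1) then 1 / 2 + (survival (x + w s))\<^sup>2 / 2 else 0)"
        using AE_lifetime_law_pos by eventually_elim (auto simp: hit_def)
    qed
    finally show "(\<integral>q. g (w, q) \<partial>(lifetime_law \<Otimes>\<^sub>M Z)) =
      (\<integral>s. (if 0 \<le> s \<and> \<not> (\<exists>r\<in>{0..s}. norm (x + w r) \<le> 1) then 1 / 2 + (survival (x + w s))\<^sup>2 / 2 else 0) \<partial>lifetime_law)" .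
  qed
  finally show ?thesis .
qed

end

section \<open>Identification of the survival probability with the radial solution\<close>

context wiener_radial
begin

lemma rad_killed:
  assumes x: "norm x > 1" and h1_0: "h 1 = 0"
  shows "rad x = killed (\<lambda>y. rad y - gen y) x"
proof -
  have F: "\<bar>rad y - gen y\<bar> \<le> C + (2 + real DIM('a)) * C" for y :: 'a
    using rad_le[of y] gen_le[of y] by linarith
  have [measurable]: "(\<lambda>y::'a. rad y - gen y) \<in> borel_measurable borel" by measurable
  have "killed (\<lambda>y. rad y - gen y) x = (\<integral>w. (\<integral>s. exponential_density 1 s *
    (if \<exists>r\<in>{0..s}. norm (x + w r) \<le> 1 then 0 else rad (x + w s) - gen (x + w s)) \<partial>lborel) \<partial>W)"
    unfolding killed_def
  proof (rule Bochner_Integration.integral_cong[OF refl])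
    fix w assume w: "w \<in> space W"
    have [measurable]: "(\<lambda>s. w s) \<in> borel \<rightarrow>\<^sub>M borel" using w by measurable
    have ph[measurable]: "Measurable.pred borel (\<lambda>s. \<exists>r\<in>{0..s}. norm (x + w r) \<le> 1)"
      using w by (intro pred_exists_norm_le) measurable
    have "(\<integral>s. (if 0 \<le> s \<and> \<not> (\<exists>r\<in>{0..s}. norm (x + w r) \<le> 1) then rad (x + w s) - gen (x + w s) else 0) \<partial>lifetime_law)
      = (\<integral>s. exponential_density 1 s * (if 0 \<le> s \<and> \<not> (\<exists>r\<in>{0..s}. norm (x + w r) \<le> 1) then rad (x + w s) - gen (x + w s) else 0) \<partial>lborel)"
      by (rule integral_lifetime_law) measurable
    also have "\<dots> = (\<integral>s. exponential_density 1 s *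
        (if \<exists>r\<in>{0..s}. norm (x + w r) \<le> 1 then 0 else rad (x + w s) - gen (x + w s)) \<partial>lborel)"
      by (intro Bochner_Integration.integral_cong) (auto simp: exponential_density_def)
    finally show "(\<integral>s. (if 0 \<le> s \<and> \<not> (\<exists>r\<in>{0..s}. norm (x + w r) \<le> 1) then rad (x + w s) - gen (x + w s) else 0) \<partial>lifetime_law)
      = (\<integral>s. exponential_density 1 s *
        (if \<exists>r\<in>{0..s}. norm (x + w r) \<le> 1 then 0 else rad (x + w s) - gen (x + w s)) \<partial>lborel)" .
  qed
  then show ?thesis using dynkin[OF x h1_0] by simp
qed

text \<open>Both \<^term>\<open>rad\<close> and \<^term>\<open>survival\<close> solve the same fixed point equation with nonlinearity
  \<open>v \<mapsto> 1/2 + v\<^sup>2/2\<close>.  On \<open>[0, 1]\<close> this map sends a difference \<open>D\<close> to at most \<open>D (1 - D/2)\<close>, so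
  the supremum \<open>M\<close> of the difference satisfies \<open>M \<le> M (1 - M/2)\<close> and vanishes.\<close>

theorem survival_eq_rad:
  assumes h1_0: "h 1 = 0"
    and h01: "\<And>s. s \<ge> 1 \<Longrightarrow> 0 \<le> h s \<and> h s \<le> 1"
    and ode: "\<And>s. s \<ge> 1 \<Longrightarrow> h s - (2 * s * h2 s + real DIM('a) * h1 s) = 1 / 2 + (h s)\<^sup>2 / 2"
    and x: "norm x > 1"
  shows "survival x = rad (x::'a)"
proof -
  define S where "S = {y::'a. norm y > 1}"
  have sq: "(norm y)\<^sup>2 \<ge> 1" if "y \<in> S" for y using that by (simp add: S_def)
  have r01: "0 \<le> rad y" "rad y \<le> 1" if "y \<in> S" for y using h01[OF sq[OF that]] by (auto simp: rad_def)
  have rg: "rad y - gen y = 1 / 2 + (rad y)\<^sup>2 / 2" if "y \<in> S" for y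
    using ode[OF sq[OF that]] by (simp add: rad_def gen_def)
  define D where "D y = \<bar>rad y - survival y\<bar>" for y
  define M where "M = Sup (D ` S)"
  have D1: "0 \<le> D y" "D y \<le> 1" if "y \<in> S" for y
    using r01[OF that] survival_bounds[of y] by (auto simp: D_def)
  have bdd: "bdd_above (D ` S)" using D1 by (auto intro!: bdd_aboveI[of _ 1])
  have DM: "D y \<le> M" if "y \<in> S" for y unfolding M_def using that by (intro cSup_upper bdd) auto
  have xS: "x \<in> S" using x by (simp add: S_def)
  have M01: "0 \<le> M" "M \<le> 1"
    using DM[OF xS] D1(1)[OF xS] D1(2) xS unfolding M_def by (auto intro!: cSup_least)
  have main: "D y \<le> M * (1 - M / 2)" if y: "y \<in> S" for y
  proof -
    let ?F = "\<lambda>y. rad y - gen y" and ?G = "\<lambda>y. 1 / 2 + (survival y)\<^sup>2 / 2"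
    define K where "K = C + (2 + real DIM('a)) * C + 1"
    have F: "\<bar>?F y\<bar> \<le> K" for y :: 'a using rad_le[of y] gen_le[of y] unfolding K_def by linarith
    have G: "\<bar>?G y\<bar> \<le> K" for y
    proof -
      have "(survival y)\<^sup>2 \<le> 1" "0 \<le> (survival y)\<^sup>2" using survival_bounds[of y] by (auto simp: power_le_one)
      moreover have "1 \<le> K" using C_nonneg by (simp add: K_def)
      ultimately show ?thesis by linarith
    qed
    have "\<bar>killed ?F y - killed ?G y\<bar> \<le> M * (1 - M / 2)"
    proof (rule killed_diff_le[OF _ _ F G])
      show "0 \<le> M * (1 - M / 2)" using M01 by (intro mult_nonneg_nonneg) auto
      fix z :: 'a assume "norm z > 1"
      then have z: "z \<in> S" by (simp add: S_def)
      define a b where "a = rad z" and "b = survival z"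
      have ab: "0 \<le> a" "a \<le> 1" "0 \<le> b" "b \<le> 1" using r01[OF z] survival_bounds[of z] by (auto simp: a_def b_def)
      have "?F z - ?G z = (a - b) * (a + b) / 2"
        unfolding rg[OF z] a_def b_def by (simp add: power2_eq_square field_simps)
      then have "\<bar>?F z - ?G z\<bar> = \<bar>(a - b) * (a + b) / 2\<bar>" by (rule arg_cong)
      also have "\<dots> = \<bar>a - b\<bar> * ((a + b) / 2)" using ab by (simp add: abs_mult)
      \<comment> \<open>The mean of a and b is their maximum minus half their distance, and the
        maximum is at most 1.\<close>
      also have "\<dots> \<le> \<bar>a - b\<bar> * (1 - \<bar>a - b\<bar> / 2)"
        using ab by (intro mult_left_mono) auto
      also have "\<dots> \<le> M * (1 - M / 2)"
      proof -
        have d: "0 \<le> \<bar>a - b\<bar>" "\<bar>a - b\<bar> \<le> M" using DM[OF z] by (auto simp: D_def a_def b_def)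
        \<comment> \<open>The map t -> t (1 - t/2) is nondecreasing on [0, 1].\<close>
        have "M * (1 - M / 2) - \<bar>a - b\<bar> * (1 - \<bar>a - b\<bar> / 2) = (M - \<bar>a - b\<bar>) * (1 - (M + \<bar>a - b\<bar>) / 2)"
          by (simp add: field_simps)
        moreover have "\<dots> \<ge> 0" using d M01 by (intro mult_nonneg_nonneg) auto
        ultimately show ?thesis by linarith
      qed
      finally show "\<bar>?F z - ?G z\<bar> \<le> M * (1 - M / 2)" .
    qed measurable
    moreover have "rad y = killed ?F y" by (rule rad_killed[OF _ h1_0]) (use y in \<open>simp add: S_def\<close>)
    moreover have "survival y = killed ?G y" by (rule survival_branching)
    ultimately show ?thesis by (simp add: D_def)
  qed
  have "M \<le> M * (1 - M / 2)" unfolding M_def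
    by (rule cSup_least) (use xS main in \<open>auto simp: M_def\<close>)
  then have "M * M \<le> 0" by (simp add: algebra_simps)
  then have "M = 0" using M01 by (simp add: mult_le_0_iff)
  then show ?thesis using DM[OF xS] by (simp add: D_def)
qed

end

section \<open>Pioneers\<close>

definition hit_node :: "'a::euclidean_space \<Rightarrow> 'a marks \<Rightarrow> label \<Rightarrow> bool" where
  "hit_node x \<omega> u \<longleftrightarrow> (\<exists>s. (u, s) \<in> genealogical_tree \<omega> \<and> norm (position x \<omega> (u, s)) \<le> 1)"

text \<open>Asks for an earliest hit that is attained. Away from the root the ages of a particle
  form a half-open interval, so hits could accumulate at age 0 without a first one.\<close>

definition first_hit :: "'a::euclidean_space \<Rightarrow> 'a marks \<Rightarrow> label \<Rightarrow> bool" where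
  "first_hit x \<omega> u \<longleftrightarrow> (\<exists>s. (u, s) \<in> genealogical_tree \<omega> \<and> norm (position x \<omega> (u, s)) \<le> 1 \<and>
     (\<forall>s'<s. (u, s') \<in> genealogical_tree \<omega> \<longrightarrow> \<not> norm (position x \<omega> (u, s')) \<le> 1))"

lemma N1_pos_iff:
  "N1 x \<omega> > 0 \<longleftrightarrow> (\<exists>u. first_hit x \<omega> u \<and> (\<forall>v. strict_suffix v u \<longrightarrow> \<not> hit_node x \<omega> v))"
proof -
  have "N1 x \<omega> > 0 \<longleftrightarrow> pioneers (cball 0 1) x \<omega> \<noteq> {}"
    unfolding N1_def by (simp add: zero_less_iff_neq_zero emeasure_count_space_eq_0)
  also have "\<dots> \<longleftrightarrow> (\<exists>u s. (u, s) \<in> pioneers (cball 0 1) x \<omega>)" by auto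
  also have "\<dots> \<longleftrightarrow> (\<exists>u. first_hit x \<omega> u \<and> (\<forall>v. strict_suffix v u \<longrightarrow> \<not> hit_node x \<omega> v))"
  proof -
    have "(u, s) \<in> pioneers (cball 0 1) x \<omega> \<longleftrightarrow> (u, s) \<in> genealogical_tree \<omega> \<and> norm (position x \<omega> (u, s)) \<le> 1 \<and>
        (\<forall>s'<s. (u, s') \<in> genealogical_tree \<omega> \<longrightarrow> \<not> norm (position x \<omega> (u, s')) \<le> 1) \<and>
        (\<forall>v. strict_suffix v u \<longrightarrow> \<not> hit_node x \<omega> v)" for u s
      unfolding pioneers_def hit_node_def strict_ancestor_def by auto
    then show ?thesis unfolding first_hit_def by blast
  qed
  finally show ?thesis .
qed

lemma genealogical_tree_iff:
  "(u, s) \<in> genealogical_tree \<omega> \<longleftrightarrow> u = [] \<and> s = 0 \<or> born \<omega> u \<and> 0 < s \<and> s \<le> lifetime \<omega> u"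
  by (auto simp: genealogical_tree_def)

text \<open>Turns half-open age intervals into countable unions of closed ones, on which hitting is
  measurable.\<close>

lemma pos_iff_inverse_le: "0 < (s::real) \<longleftrightarrow> (\<exists>k. 1 / real (Suc k) \<le> s)"
proof
  assume "0 < s"
  then show "\<exists>k. 1 / real (Suc k) \<le> s"
    using reals_Archimedean[of s] by (auto simp: inverse_eq_divide intro: less_imp_le)
next
  assume "\<exists>k. 1 / real (Suc k) \<le> s"
  then obtain k where "1 / real (Suc k) \<le> s" by blast
  moreover have "0 < 1 / real (Suc k)" by simp
  ultimately show "0 < s" by linarith
qed

context wiener
begin

lemma displacement_path: "\<omega> \<in> space (bbm W) \<Longrightarrow> displacement \<omega> u \<in> space W"
  using measurable_space[OF displacement_measurable] .

lemma continuous_on_position: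
  assumes "\<omega> \<in> space (bbm W)" "A \<subseteq> {0..}"
  shows "continuous_on A (\<lambda>s. norm (position x \<omega> (u, s)))"
  unfolding position_def
  by (simp, intro continuous_intros continuous_on_subset[OF space_W(1)[OF displacement_path[OF assms(1)]] assms(2)])

text \<open>By continuity the set of hitting ages in a closed interval is compact, so it has a least
  element.\<close>

lemma first_position_exists:
  assumes w: "\<omega> \<in> space (bbm W)" and a: "0 \<le> a" and s: "a \<le> s" "s \<le> b" "norm (position x \<omega> (u, s)) \<le> 1"
  obtains m where "a \<le> m" "m \<le> b" "norm (position x \<omega> (u, m)) \<le> 1"
    "\<And>r. a \<le> r \<Longrightarrow> r < m \<Longrightarrow> \<not> norm (position x \<omega> (u, r)) \<le> 1"
proof -
  define T where "T = {r \<in> {a..b}. norm (position x \<omega> (u, r)) \<le> 1}"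
  have "closed T" unfolding T_def
    by (intro continuous_on_closed_Collect_le continuous_on_position[OF w] continuous_on_const) (use a in auto)
  then have "compact T" unfolding compact_eq_bounded_closed
    by (auto simp: T_def intro: bounded_subset[OF bounded_closed_interval])
  moreover have "s \<in> T" using s by (simp add: T_def)
  ultimately obtain m where m: "m \<in> T" "\<And>r. r \<in> T \<Longrightarrow> m \<le> r"
    using compact_attains_inf[of T] by auto
  show ?thesis
    by (rule that[of m]) (use m in \<open>force simp: T_def\<close>)+
qed

text \<open>A countable description for measurability. A first hit at positive age is attained
  exactly if, for some k, there is a hit at age at least 1 / (k + 1) but none at positive ages up to
  1 / (k + 1); the latter is tested on closed intervals. A root starting in the ball is the other
  case.\<close>

lemma first_hit_iff:
  assumes w: "\<omega> \<in> space (bbm W)"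
  shows "first_hit x \<omega> u \<longleftrightarrow> (u = [] \<and> norm (position x \<omega> ([], 0)) \<le> 1) \<or>
    (born \<omega> u \<and> (\<exists>k. (\<exists>s\<in>{1 / real (Suc k)..lifetime \<omega> u}. norm (position x \<omega> (u, s)) \<le> 1) \<and>
       (\<forall>j. \<not> (\<exists>s\<in>{1 / real (Suc j)..1 / real (Suc k)}. norm (position x \<omega> (u, s)) \<le> 1))))"
    (is "_ \<longleftrightarrow> ?A \<or> ?B")
proof
  assume "first_hit x \<omega> u"
  then obtain s where s: "(u, s) \<in> genealogical_tree \<omega>" "norm (position x \<omega> (u, s)) \<le> 1"
    "\<And>s'. s' < s \<Longrightarrow> (u, s') \<in> genealogical_tree \<omega> \<Longrightarrow> \<not> norm (position x \<omega> (u, s')) \<le> 1"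
    unfolding first_hit_def by blast
  show "?A \<or> ?B"
  proof (cases "u = [] \<and> s = 0")
    case True
    then show ?thesis using s by simp
  next
    case False
    then have b: "born \<omega> u" "0 < s" "s \<le> lifetime \<omega> u" using s(1) by (auto simp: genealogical_tree_iff)
    \<comment> \<open>The strict inequality matters: every age up to 1 / (k + 1) then lies strictly
      before the first hit.\<close>
    obtain k where k: "1 / real (Suc k) < s"
      using reals_Archimedean[OF b(2)] by (auto simp: inverse_eq_divide)
    have "\<not> norm (position x \<omega> (u, r)) \<le> 1" if "r \<in> {1 / real (Suc j)..1 / real (Suc k)}" for j r
    proof (rule s(3))
      have "0 < r" using that pos_iff_inverse_le[of r] by auto
      then show "r < s" "(u, r) \<in> genealogical_tree \<omega>"
        using that k b by (auto simp: genealogical_tree_iff)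
    qed
    then show ?thesis using b k s(2) by (intro disjI2 conjI exI[of _ k]) auto
  qed
next
  assume AB: "?A \<or> ?B"
  show "first_hit x \<omega> u"
  proof (cases ?A)
    case True
    then show ?thesis
      unfolding first_hit_def by (intro exI[of _ 0]) (auto simp: genealogical_tree_iff)
  next
    case nA: False
    with AB obtain k s where b: "born \<omega> u" and s: "1 / real (Suc k) \<le> s" "s \<le> lifetime \<omega> u" "norm (position x \<omega> (u, s)) \<le> 1"
      and n: "\<And>j r. 1 / real (Suc j) \<le> r \<Longrightarrow> r \<le> 1 / real (Suc k) \<Longrightarrow> \<not> norm (position x \<omega> (u, r)) \<le> 1"
      by fastforce
    have k0: "0 < 1 / real (Suc k)" by simp
    obtain m where m: "1 / real (Suc k) \<le> m" "m \<le> lifetime \<omega> u" "norm (position x \<omega> (u, m)) \<le> 1"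
      "\<And>r. 1 / real (Suc k) \<le> r \<Longrightarrow> r < m \<Longrightarrow> \<not> norm (position x \<omega> (u, r)) \<le> 1"
      using first_position_exists[OF w less_imp_le[OF k0] s] by blast
    have m0: "0 < m" using less_le_trans[OF k0 m(1)] .
    show ?thesis unfolding first_hit_def
    proof (intro exI[of _ m] conjI allI impI)
      show "(u, m) \<in> genealogical_tree \<omega>" using m b m0 by (auto simp: genealogical_tree_iff)
      fix r assume r: "r < m" "(u, r) \<in> genealogical_tree \<omega>"
      show "\<not> norm (position x \<omega> (u, r)) \<le> 1"
      proof (cases "r \<le> 1 / real (Suc k)")
        case True
        show ?thesis
        proof (cases "u = [] \<and> r = 0")
          case False
          then have "0 < r" using r(2) by (auto simp: genealogical_tree_iff)
          then obtain j where "1 / real (Suc j) \<le> r" using pos_iff_inverse_le by blast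
          then show ?thesis using n True by blast
        qed (use nA in auto)
      qed (use m(4) r in auto)
    qed (use m in auto)
  qed
qed

lemma hit_node_iff:
  "hit_node x \<omega> u \<longleftrightarrow> (u = [] \<and> norm (position x \<omega> ([], 0)) \<le> 1) \<or>
    (born \<omega> u \<and> (\<exists>k. \<exists>s\<in>{1 / real (Suc k)..lifetime \<omega> u}. norm (position x \<omega> (u, s)) \<le> 1))"
  unfolding hit_node_def genealogical_tree_iff pos_iff_inverse_le Bex_def atLeastAtMost_iff by blast

lemma pred_position_measurable:
  assumes [measurable]: "B \<in> borel_measurable (bbm W)" and a: "0 \<le> a"
  shows "Measurable.pred (bbm W) (\<lambda>\<omega>. \<exists>s\<in>{a..B \<omega>}. norm (position x \<omega> (u, s)) \<le> 1)"
proof -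
  have [measurable]: "(\<lambda>\<omega>. birthplace x \<omega> u) \<in> bbm W \<rightarrow>\<^sub>M borel"
    using measurable_compose[OF measurable_Pair1' birthplace_measurable, of x] by simp
  show ?thesis unfolding position_def fst_conv snd_conv
    by (rule pred_exists_norm_le) (use a in measurable)
qed

lemma N1_pos_measurable: "{\<omega> \<in> space (bbm W). N1 x \<omega> > 0} \<in> sets (bbm W)"
proof -
  have M1: "Measurable.pred (bbm W) (\<lambda>\<omega>. \<exists>s\<in>{1 / real (Suc k)..lifetime \<omega> u}. norm (position x \<omega> (u, s)) \<le> 1)" for k u
    by (rule pred_position_measurable[OF lifetime_measurable]) simp
  have M2: "Measurable.pred (bbm W) (\<lambda>\<omega>. \<exists>s\<in>{1 / real (Suc j)..1 / real (Suc k)}. norm (position x \<omega> (u, s)) \<le> 1)" for j k u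
    by (rule pred_position_measurable) simp_all
  have M0: "Measurable.pred (bbm W) (\<lambda>\<omega>. norm (position x \<omega> ([], 0)) \<le> 1)"
  proof -
    have "(\<exists>s\<in>{0..0}. norm (position x \<omega> ([], s)) \<le> 1) \<longleftrightarrow> norm (position x \<omega> ([], 0)) \<le> 1" for \<omega> by auto
    then show ?thesis using pred_position_measurable[of "\<lambda>_. 0" 0 x "[]"] by simp
  qed
  have [measurable]: "Measurable.pred (bbm W) (\<lambda>\<omega>. hit_node x \<omega> u)" for u
    unfolding hit_node_iff by (intro pred_intros_logic pred_intros_countable M0 M1 born_measurable) simp_all
  have [measurable]: "Measurable.pred (bbm W) (\<lambda>\<omega>. first_hit x \<omega> u)" for u
  proof (subst measurable_cong[OF first_hit_iff])
    show "Measurable.pred (bbm W) (\<lambda>\<omega>. (u = [] \<and> norm (position x \<omega> ([], 0)) \<le> 1) \<or>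
      (born \<omega> u \<and> (\<exists>k. (\<exists>s\<in>{1 / real (Suc k)..lifetime \<omega> u}. norm (position x \<omega> (u, s)) \<le> 1) \<and>
         (\<forall>j. \<not> (\<exists>s\<in>{1 / real (Suc j)..1 / real (Suc k)}. norm (position x \<omega> (u, s)) \<le> 1)))))"
      by (intro pred_intros_logic pred_intros_countable M0 M1 M2 born_measurable) simp_all
  qed
  show ?thesis unfolding N1_pos_iff by measurable
qed

lemma AE_lifetime_pos: "AE \<omega> in bbm W. \<forall>u. lifetime \<omega> u > 0"
proof -
  interpret L: prob_space lifetime_law by (rule prob_space_lifetime_law)
  interpret LB: pair_prob_space lifetime_law "measure_pmf (bernoulli_pmf (1/2))" ..
  interpret WLB: pair_prob_space W "lifetime_law \<Otimes>\<^sub>M measure_pmf (bernoulli_pmf (1/2))" ..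
  have "AE m in mark. fst (snd m) > 0"
  proof -
    have "AE q in lifetime_law \<Otimes>\<^sub>M measure_pmf (bernoulli_pmf (1/2)). fst q > 0"
      by (intro LB.AE_pair_measure) (use AE_lifetime_law_pos in \<open>auto\<close>)
    then show ?thesis unfolding mark_def
      by (intro WLB.AE_pair_measure) auto
  qed
  then have "AE \<omega> in bbm W. fst (snd (\<omega> u)) > 0" for u
    unfolding bbm_eq by (intro AE_PiM_component[OF prob_space_mark]) auto
  then show ?thesis unfolding lifetime_def by (simp add: AE_all_countable)
qed

text \<open>The two notions differ in the age 0 of a child, which is not a tree point of its own. A
  hit there is a hit at the death of the parent, which is a tree point because lifetimes are
  positive.\<close>

lemma N1_pos_iff_hits:
  assumes w: "\<omega> \<in> space (bbm W)" and L: "\<And>u. lifetime \<omega> u > 0"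
  shows "N1 x \<omega> > 0 \<longleftrightarrow> hits x \<omega>"
proof
  assume "N1 x \<omega> > 0"
  then obtain u s where "(u, s) \<in> genealogical_tree \<omega>" "norm (position x \<omega> (u, s)) \<le> 1"
    unfolding N1_pos_iff first_hit_def by blast
  then show "hits x \<omega>" using L[of u] unfolding hits_def genealogical_tree_iff position_def
    by (auto intro!: exI[of _ u] intro: less_imp_le)
next
  assume "hits x \<omega>"
  then obtain u s where u: "born \<omega> u" "0 \<le> s" "s \<le> lifetime \<omega> u" "norm (position x \<omega> (u, s)) \<le> 1"
    unfolding hits_def position_def by auto
  have start: "position x \<omega> (b # v, 0) = position x \<omega> (v, lifetime \<omega> v)" for b v
    using space_W(2)[OF displacement_path[OF w]] by (simp add: position_def)
  have parent: "hit_node x \<omega> v" if "born \<omega> (b # v)" "norm (position x \<omega> (b # v, 0)) \<le> 1" for b v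
    unfolding hit_node_def using that L[of v]
    by (intro exI[of _ "lifetime \<omega> v"]) (auto simp: genealogical_tree_iff start)
  have "\<exists>v. hit_node x \<omega> v"
  proof (cases "s = 0 \<and> u \<noteq> []")
    case True
    then obtain b v where "u = b # v" by (cases u) auto
    then show ?thesis using parent[of b v] u True by auto
  next
    case False
    then have "(u, s) \<in> genealogical_tree \<omega>" using u by (auto simp: genealogical_tree_iff)
    then show ?thesis using u unfolding hit_node_def by blast
  qed
  \<comment> \<open>Strict suffixes are shorter, so a hit label of minimal length has no hit
    ancestor.\<close>
  then obtain v where v: "hit_node x \<omega> v" "\<And>v'. hit_node x \<omega> v' \<Longrightarrow> length v \<le> length v'"
    using ex_has_least_nat[of "hit_node x \<omega>" _ length] by blast
  have min: "\<not> hit_node x \<omega> v'" if "strict_suffix v' v" for v'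
    using v(2)[of v'] suffix_length_less[OF that] by auto
  obtain r where r: "(v, r) \<in> genealogical_tree \<omega>" "norm (position x \<omega> (v, r)) \<le> 1"
    using v(1) unfolding hit_node_def by blast
  then have bv: "born \<omega> v" "0 \<le> r" "r \<le> lifetime \<omega> v" using L[of v] by (auto simp: genealogical_tree_iff intro: less_imp_le)
  obtain m where m: "0 \<le> m" "m \<le> lifetime \<omega> v" "norm (position x \<omega> (v, m)) \<le> 1"
    "\<And>r. 0 \<le> r \<Longrightarrow> r < m \<Longrightarrow> \<not> norm (position x \<omega> (v, r)) \<le> 1"
    using first_position_exists[OF w order_refl bv(2,3) r(2)] by blast
  \<comment> \<open>A first hit at the birth of a child would already be a hit of its parent,
    against minimality; hence the first hit is a genuine tree point.\<close>
  have "m \<noteq> 0 \<or> v = []"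
  proof (rule ccontr)
    assume "\<not> ?thesis"
    then obtain b v' where "v = b # v'" "m = 0" by (cases v) auto
    then have "hit_node x \<omega> v'" using parent[of b v'] bv(1) m(3) by simp
    then show False using min[of v'] \<open>v = b # v'\<close> by (auto simp: strict_suffix_def suffix_def)
  qed
  then have "(v, m) \<in> genealogical_tree \<omega>" using m bv by (auto simp: genealogical_tree_iff)
  moreover have "\<not> norm (position x \<omega> (v, r)) \<le> 1" if "r < m" "(v, r) \<in> genealogical_tree \<omega>" for r
    using that m(4)[of r] by (auto simp: genealogical_tree_iff)
  ultimately have "first_hit x \<omega> v" using m(3) unfolding first_hit_def by blast
  then show "N1 x \<omega> > 0" unfolding N1_pos_iff using min by blast
qed

lemma prob_N1_pos: "measure (bbm W) {\<omega> \<in> space (bbm W). N1 x \<omega> > 0} = 1 - survival x"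
proof -
  interpret bbm: prob_space "bbm W" by (rule prob_space_bbm)
  have "measure (bbm W) {\<omega> \<in> space (bbm W). N1 x \<omega> > 0} = measure (bbm W) {\<omega> \<in> space (bbm W). hits x \<omega>}"
  proof (rule bbm.finite_measure_eq_AE)
    show "AE \<omega> in bbm W. (\<omega> \<in> {\<omega> \<in> space (bbm W). N1 x \<omega> > 0}) = (\<omega> \<in> {\<omega> \<in> space (bbm W). hits x \<omega>})"
      using AE_lifetime_pos by (rule AE_mp) (auto intro!: AE_I2 simp: N1_pos_iff_hits)
  qed (use N1_pos_measurable in auto)
  then show ?thesis by (simp add: prob_hits)
qed

end

section \<open>The expansion of the hitting probability\<close>

text \<open>Translates the threshold for r into convergence of the series at
  \<open>\<mu> * r powr (- b)\<close>. With an infinite radius there is nothing to check, so only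
  finite radii need the calculation.\<close>

lemma series_radius:
  assumes b: "0 < b" and R: "0 < R"
    and r: "max 1 (real_of_ereal (ereal \<bar>\<mu>\<bar> / R) powr (1 / b)) < r"
  shows "ereal \<bar>\<mu> * r powr (- b)\<bar> < R"
proof (cases R)
  case (real \<rho>)
  then have \<rho>: "\<rho> > 0" using R by simp
  have "(\<bar>\<mu>\<bar> / \<rho>) powr (1 / b) < r" using r real \<rho> by simp
  then have "((\<bar>\<mu>\<bar> / \<rho>) powr (1 / b)) powr b < r powr b"
    using b by (intro powr_less_mono2) auto
  then have "\<bar>\<mu>\<bar> / \<rho> < r powr b"
    using b \<rho> by (simp add: powr_powr)
  then have "\<bar>\<mu>\<bar> * r powr (- b) < \<rho>"
    using \<rho> r by (simp add: powr_minus field_simps)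
  then show ?thesis using real by (simp add: abs_mult)
next
  case PInf
  then show ?thesis by simp
next
  case MInf
  then show ?thesis using R by simp
qed

text \<open>The hitting probability is 1 - h(r^2) = y(ln r) / r^2, and above the threshold
  \<open>y\<close> is the series at mu r^(-b) with b = \<open>beta DIM('a)\<close>.\<close>

lemma (in wiener) hitting_probability_expansion:
  assumes pr: "profile DIM('a) \<mu> y z" and d: "DIM('a) \<noteq> 4"
    and r: "max 1 (real_of_ereal (ereal \<bar>\<mu>\<bar> / conv_radius (alpha DIM('a))) powr (1 / beta DIM('a))) < norm x"
  shows "(\<lambda>l. alpha DIM('a) l * \<mu> ^ l * norm x powr (- 2 - beta DIM('a) * real l)) sums
    measure (bbm W) {\<omega> \<in> space (bbm W). N1 x \<omega> > 0}"
proof -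
  let ?d = "DIM('a)" and ?r = "norm x"
  define b where "b = beta ?d"
  have d1: "1 \<le> ?d" using DIM_positive[where 'a = 'a] by linarith
  have b: "b > 0" unfolding b_def by (rule beta_pos[OF d1 d])
  have "0 < ereal (4 * b\<^sup>2)" using b by simp
  then have R: "conv_radius (alpha ?d) > 0"
    using conv_radius_alpha_ge[OF d1 d] unfolding b_def by (rule less_le_trans)
  have r1: "?r > 1" using r by simp
  then have x0: "x \<noteq> 0" by auto
  obtain h h1 h2 C where sol: "\<And>s. (h has_real_derivative h1 s) (at s)" "\<And>s. (h1 has_real_derivative h2 s) (at s)"
    "continuous_on UNIV h2" "h 1 = 0"
    "\<And>s. s \<ge> 1 \<Longrightarrow> h s = 1 - y (ln s / 2) / s \<and> 0 \<le> h s \<and> h s \<le> 1 \<and>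
       h s - (2 * s * h2 s + real ?d * h1 s) = 1 / 2 + (h s)\<^sup>2 / 2"
    "\<And>s. s \<ge> 0 \<Longrightarrow> \<bar>h s\<bar> \<le> C \<and> \<bar>h1 s\<bar> \<le> C \<and> \<bar>s * h2 s\<bar> \<le> C"
    using radial_solution[OF pr] by metis
  interpret wiener_radial W h h1 h2 C
    by unfold_locales (use sol in auto)
  have "survival x = rad x"
    by (rule survival_eq_rad[OF sol(4)]) (use sol(5) r1 in blast)+
  then have "measure (bbm W) {\<omega> \<in> space (bbm W). N1 x \<omega> > 0} = 1 - h (?r\<^sup>2)"
    by (simp add: prob_N1_pos rad_def)
  also have "\<dots> = y (ln ?r) * ?r powr (- 2)"
  proof -
    have "ln (?r\<^sup>2) / 2 = ln ?r" using x0 by (simp add: ln_realpow)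
    moreover have "?r\<^sup>2 \<ge> 1" using r1 by simp
    moreover have "?r powr (- 2) = 1 / ?r\<^sup>2" using x0 by (simp add: powr_minus_divide)
    ultimately show ?thesis using sol(5)[of "?r\<^sup>2"] by simp
  qed
  also have "y (ln ?r) = alpha_fun ?d (\<mu> * ?r powr (- b))"
  proof -
    have e: "?r powr (- b) = exp (- b * ln ?r)" using x0 by (simp add: powr_def)
    have "ln ?r \<ge> 0" using r1 by simp
    then show ?thesis
      using pr series_radius[OF b R r[folded b_def]] unfolding profile_def e unfolding b_def by blast
  qed
  finally have p: "measure (bbm W) {\<omega> \<in> space (bbm W). N1 x \<omega> > 0}
      = alpha_fun ?d (\<mu> * ?r powr (- b)) * ?r powr (- 2)" .
  have "(\<lambda>l. alpha ?d l * (\<mu> * ?r powr (- b)) ^ l * ?r powr (- 2)) sums (alpha_fun ?d (\<mu> * ?r powr (- b)) * ?r powr (- 2))"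
    by (intro sums_mult2 alpha_fun_sums series_radius[OF b R]) (use r in \<open>simp add: b_def\<close>)
  moreover have "alpha ?d l * (\<mu> * ?r powr (- b)) ^ l * ?r powr (- 2) = alpha ?d l * \<mu> ^ l * ?r powr (- 2 - b * real l)" for l
  proof -
    have "(?r powr (- b)) ^ l * ?r powr (- 2) = ?r powr (- 2 - b * real l)"
    proof -
      have "(?r powr (- b)) ^ l * ?r powr (- 2) = ?r powr (- b * real l + - 2)"
        unfolding powr_add using x0 by (simp add: powr_power mult.commute)
      also have "- b * real l + - 2 = - 2 - b * real l" by simp
      finally show ?thesis .
    qed
    then show ?thesis by (simp add: power_mult_distrib mult.assoc)
  qed
  ultimately show ?thesis unfolding p b_def by simp
qed

theorem theorem1p9:
  fixes d :: nat and W :: "(real \<Rightarrow> real ^ 'n::finite) measure"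
  assumes "d = CARD('n)" and "d \<noteq> 4" and "wiener_measure W"
  shows "conv_radius (alpha d) > 0 \<and>
    (\<exists>\<mu>::real.
      (\<forall>r x. r > max 1 (real_of_ereal (ereal \<bar>\<mu>\<bar> / conv_radius (alpha d)) powr (1 / beta d))
          \<and> norm x = r \<longrightarrow>
        (\<lambda>l. alpha d l * \<mu> ^ l * r powr (- 2 - beta d * real l)) sums
          measure (bbm W) {\<omega> \<in> space (bbm W). N1 x \<omega> > 0}) \<and>
      (d \<le> 3 \<longrightarrow> \<mu> < 0) \<and>
      (d \<ge> 5 \<longrightarrow> 0 < \<mu> \<and> \<mu> < 1 \<and>
        (\<forall>y. 0 < y \<and> y < 1 \<longrightarrow>
          ((\<lambda>l. alpha d (Suc l) * y ^ Suc l) sums 1 \<longleftrightarrow> y = \<mu>))))"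
proof -
  interpret wiener W by unfold_locales (rule assms(3))
  have d: "d = DIM(real ^ 'n)" using assms(1) by simp
  have d1: "1 \<le> d" using assms(1) by (simp add: Suc_le_eq)
  have "0 < ereal (4 * (beta d)\<^sup>2)" using beta_pos[OF d1 assms(2)] by simp
  then have R: "conv_radius (alpha d) > 0"
    using conv_radius_alpha_ge[OF d1 assms(2)] by (rule less_le_trans)
  have "\<exists>\<mu> y z. profile d \<mu> y z \<and> (d \<le> 3 \<longrightarrow> \<mu> < 0) \<and>
      (d \<ge> 5 \<longrightarrow> 0 < \<mu> \<and> \<mu> < 1 \<and>
        (\<forall>y. 0 < y \<and> y < 1 \<longrightarrow> ((\<lambda>l. alpha d (Suc l) * y ^ Suc l) sums 1 \<longleftrightarrow> y = \<mu>)))"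
  proof (cases "d \<le> 3")
    case True
    obtain \<mu> y z where "profile d \<mu> y z" "\<mu> < 0" using profile_low_dim[OF d1 True] by blast
    then show ?thesis using True by (intro exI[of _ \<mu>] exI[of _ y] exI[of _ z]) auto
  next
    case False
    then have "5 \<le> d" using assms(2) by linarith
    then show ?thesis using profile_high_dim[of d] False by blast
  qed
  then obtain \<mu> y z where pr: "profile d \<mu> y z" and \<mu>: "d \<le> 3 \<longrightarrow> \<mu> < 0"
      "d \<ge> 5 \<longrightarrow> 0 < \<mu> \<and> \<mu> < 1 \<and>
        (\<forall>y. 0 < y \<and> y < 1 \<longrightarrow> ((\<lambda>l. alpha d (Suc l) * y ^ Suc l) sums 1 \<longleftrightarrow> y = \<mu>))"
    by blast
  have "(\<lambda>l. alpha d l * \<mu> ^ l * r powr (- 2 - beta d * real l)) sums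
      measure (bbm W) {\<omega> \<in> space (bbm W). N1 x \<omega> > 0}"
    if "r > max 1 (real_of_ereal (ereal \<bar>\<mu>\<bar> / conv_radius (alpha d)) powr (1 / beta d)) \<and> norm x = r" for r x
    using hitting_probability_expansion[of \<mu> y z x, folded d] pr assms(2) that by blast
  then show ?thesis using R \<mu> by blast
qed

end
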